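(* Let $n\ge4$ be even, $n'=n/2$, $s\ge1$, and consider the $\imath$quantum group $\mathbf U^\imath$ of type A.4 (affine type $A^{(1)}_{n-1}$, $\tau(i)=i+n'$ mod $n$, $B_i=F_i+E_{i+n'}K_i^{-1}$). Define $\mathcal K:\mathcal B_s(x)\to\mathcal B_s^\vee(x^{-1})$ by $\mathcal K(x^db_\alpha)=x^{d+I(\alpha)}b_{\alpha'}^\vee$, where $$I(\alpha)=\min(\alpha_1,\alpha_{n'+1})-\sum_{j=n'+1}^n\alpha_j,$$ $$\alpha'_i=\alpha_{i+1}+\alpha_{i+n'+1}+\max(\alpha_i,\alpha_{i+n'})-\alpha_i-\max(\alpha_{i+1},\alpha_{i+n'+1})\qquad(i\in\mathbb Z/n\mathbb Z).$$ Then $\mathcal K$ is the combinatorial $K$-matrix $\mathcal K_{\mathcal B_s}(x)$.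
   Context: Type A setting. $I=\mathbb Z/n\mathbb Z$; $\mathbf U$ is the quantum affine algebra of type $A^{(1)}_{n-1}$ over $\mathbb C(q)$ with Chevalley generators $E_i,F_i,K_i^{\pm1}$ and coproduct $\Delta(E_i)=E_i\otimes1+K_i\otimes E_i$, $\Delta(F_i)=F_i\otimes K_i^{-1}+1\otimes F_i$, $\Delta(K_i)=K_i\otimes K_i$. For $\alpha=(\alpha_1,\dots,\alpha_n)\in\mathbb Z_{\ge0}^n$ with $\sum\alpha_i=s$, indices mod $n$, $\mathbf e_i$ standard basis vectors, $[m]=\frac{q^m-q^{-m}}{q-q^{-1}}$: the KR module $\mathcal W_s$ has basis $v_\alpha$ with $E_iv_\alpha=[\alpha_i+1]v_{\alpha+\mathbf e_i-\mathbf e_{i+1}}$, $F_iv_\alpha=[\alpha_{i+1}+1]v_{\alpha-\mathbf e_i+\mathbf e_{i+1}}$, $K_iv_\alpha=q^{\alpha_i-\alpha_{i+1}}v_\alpha$; the dual KR module $\mathcal W_s^\vee$ has basis $v_\alpha^\vee$ with $E_iv_\alpha^\vee=[\alpha_{i+1}+1]v^\vee_{\alpha-\mathbf e_i+\mathbf e_{i+1}}$, $F_iv_\alpha^\vee=[\alpha_i+1]v^\vee_{\alpha+\mathbf e_i-\mathbf e_{i+1}}$, $K_iv_\alpha^\vee=q^{-\alpha_i+\alpha_{i+1}}v_\alpha^\vee$ (vectors with a negative index entry are $0$). Write $\mathcal W=\mathcal W_1$ (basis $v_j=v_{\mathbf e_j}$) and $\mathcal W^\vee=\mathcal W_1^\vee$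 (basis $v_j^\vee$). $U(x)$ is $U$ (scalars extended to $\mathbb C(q,x)$) with $E_0,F_0$ acting as $xE_0,x^{-1}F_0$. $\mathcal W_s(x)$ is embedded in $\mathcal W(q^{1-s}x)\otimes\mathcal W(q^{3-s}x)\otimes\cdots\otimes\mathcal W(q^{s-1}x)$ by $v_\alpha=\sum_{\mathbf i}q^{-\#\{p<p':\,i_p>i_{p'}\}}v_{i_1}\otimes\cdots\otimes v_{i_s}$, sum over $\mathbf i\in\{1,\dots,n\}^s$ containing each $i$ exactly $\alpha_i$ times; similarly $v^\vee_\alpha=\sum_{\mathbf i}q^{-\#\{p<p':\,i_p<i_{p'}\}}v^\vee_{i_1}\otimes\cdots\otimes v^\vee_{i_s}$ for $\mathcal W_s^\vee$. Quantum $K$-matrix (twisted type). $\mathbf U^\imath\subset\mathbf U$ is generated by $K_iK_{i+n'}^{-1}$ and $B_i=F_i+E_{i+n'}K_i^{-1}$, $i\in I$. $K_{\mathcal W}(x):\mathcal W(x)\to\mathcal W^\vee(x^{-1})$ is the $\mathbf U^\imath$-linear map $v_j\mapsto v_{j+n'}^\vee$ for $1\le j\le n'$ and $v_j\mapsto x^{-1}v_{j+n'}^\vee$ for $n'<j\le n$. $R_{\mathcal W^\vee,\mathcal W}(u,v):\mathcal W^\vee(u)\otimes\mathcal W(v)\to\mathcal W(v)\otimes\mathcal W^\vee(u)$ is the $\mathbf U$-linear isomorphism (for generic $u/v$), unique up to scalar. $K_{\mathcal W_s}(x):\mathcal W_s(x)\to\mathcal W_s^\vee(x^{-1})$ is the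 restriction to $\mathcal W_s(x)$ of $K^{(s)}(x)\cdots K^{(1)}(x)$, where $K^{(j)}(x)=K_1(q^{-s+2j-1}x)R_{1,2}(q^{s-2j+3}x^{-1},q^{-s+2j-1}x)R_{2,3}(q^{s-2j+5}x^{-1},q^{-s+2j-1}x)\cdots R_{j-1,j}(q^{s-1}x^{-1},q^{-s+2j-1}x)$, $K_1$ is $K_{\mathcal W}$ on the first component and $R_{i,i+1}$ is $R_{\mathcal W^\vee,\mathcal W}$ on components $i,i+1$. It is $\mathbf U^\imath$-linear. Combinatorial $K$-matrix. Let $\mathbf A_x=\mathbb C(q,x)\cap\mathbb C(x)[[q^{-1}]]$, and let $\mathcal L_s(x)$, $\mathcal L_s^\vee(x^{-1})$ be the $\mathbf A_x$-spans of the $v_\alpha$, resp. $v_\alpha^\vee$. Let $b_\alpha,b_\alpha^\vee$ be the classes of $v_\alpha,v_\alpha^\vee$ modulo $q^{-1}$, $\mathcal B_s(x)=\{x^db_\alpha\mid d\in\mathbb Z\}$, $\mathcal B_s^\vee(x^{-1})=\{x^db_\alpha^\vee\mid d\in\mathbb Z\}$. Rescale $K_{\mathcal W_s}(x)$ by a nonzero scalar in $\mathbb C(q,x)$ so that it maps $\mathcal L_s(x)$ into $\mathcal L_s^\vee(x^{-1})$ and the induced $\mathbb C(x)$-linear map $\bar K_{\mathcal W_s}(x)$ modulo $q^{-1}$ is nonzero. If (for a suitable such scalar) the restriction $\mathcal K_{\mathcal B_s}(x)$ of $\bar K_{\mathcal W_s}(x)$ to $\mathcal B_s(x)$ is a bijection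 $\mathcal B_s(x)\to\mathcal B_s^\vee(x^{-1})$, this bijection is called the combinatorial $K$-matrix on $\mathcal B_s$; it is unique up to multiplication by a power of $x$. *)

theory Defs
  imports "HOL-Computational_Algebra.Computational_Algebra"
begin

text \<open>The field \<open>\<complex>(q,x)\<close> is represented as \<open>\<complex>(x)(t)\<close> with \<open>t = q\<^sup>-\<^sup>1\<close>: the inner polynomial
  variable is \<open>x\<close>, the outer one is \<open>q\<^sup>-\<^sup>1\<close>, so that expanding in \<open>q\<^sup>-\<^sup>1\<close> is expanding in the
  outer variable.\<close>

type_synonym ratx = "complex poly fract"
type_synonym scalar = "ratx poly fract"

definition rat_x :: ratx where
  "rat_x = Fract [:0, 1:] 1"

definition xx :: scalar where
  "xx = Fract [:rat_x:] 1"

definition qq :: scalar where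
  "qq = inverse (Fract [:0, 1:] 1)"

definition qint :: "int \<Rightarrow> scalar" where
  "qint m = (qq powi m - qq powi (- m)) / (qq - inverse qq)"

text \<open>\<open>expands f g\<close>: the formal power series \<open>g \<in> \<complex>(x)[[q\<^sup>-\<^sup>1]]\<close> is the expansion of \<open>f \<in> \<complex>(q,x)\<close>;
  it exists exactly for \<open>f \<in> \<complex>(q,x) \<inter> \<complex>(x)[[q\<^sup>-\<^sup>1]]\<close>. The constant coefficient is the class
  modulo \<open>q\<^sup>-\<^sup>1\<close>.\<close>

definition expands :: "scalar \<Rightarrow> ratx fps \<Rightarrow> bool" where
  "expands f g \<longleftrightarrow> (\<exists>a b. b \<noteq> 0 \<and> f = Fract a b \<and> fps_of_poly b * g = fps_of_poly a)"

definition A_x :: "scalar set" where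
  "A_x = {f. \<exists>g. expands f g}"

definition mod_qinv :: "scalar \<Rightarrow> ratx" where
  "mod_qinv f = (THE c. \<exists>g. expands f g \<and> c = fps_nth g 0)"

text \<open>A module over the quantum affine algebra of type \<open>A\<^sub>n\<^sub>-\<^sub>1\<^sup>(\<^sup>1\<^sup>)\<close> is given by a finite basis and the
  matrices of the Chevalley generators; \<open>T c b\<close> is the coefficient of the basis vector \<open>c\<close> in the
  image of the basis vector \<open>b\<close>. The generators are indexed by all integers \<open>i\<close>, read modulo \<open>n\<close>.
  Matrix entries outside the bases are irrelevant.\<close>

type_synonym ('c, 'b) matr = "'c \<Rightarrow> 'b \<Rightarrow> scalar"

definition mmul :: "'d set \<Rightarrow> ('c, 'd) matr \<Rightarrow> ('d, 'b) matr \<Rightarrow> ('c, 'b) matr" where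
  "mmul D S T = (\<lambda>c b. \<Sum>d\<in>D. S c d * T d b)"

definition eq_on :: "'c set \<Rightarrow> 'b set \<Rightarrow> ('c, 'b) matr \<Rightarrow> ('c, 'b) matr \<Rightarrow> bool" where
  "eq_on C B S T \<longleftrightarrow> (\<forall>c\<in>C. \<forall>b\<in>B. S c b = T c b)"

definition idm :: "('b, 'b) matr" where
  "idm = (\<lambda>c b. of_bool (c = b))"

record 'b umodule =
  basis :: "'b set"
  Eop :: "int \<Rightarrow> ('b, 'b) matr"
  Fop :: "int \<Rightarrow> ('b, 'b) matr"
  Kop :: "int \<Rightarrow> ('b, 'b) matr"
  Kiop :: "int \<Rightarrow> ('b, 'b) matr"

text \<open>\<open>Kop\<close> and \<open>Kiop\<close> are the actions of \<open>K\<^sub>i\<close> and \<open>K\<^sub>i\<^sup>-\<^sup>1\<close>. The coproduct is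
  \<open>\<Delta>(E\<^sub>i) = E\<^sub>i \<otimes> 1 + K\<^sub>i \<otimes> E\<^sub>i\<close>, \<open>\<Delta>(F\<^sub>i) = F\<^sub>i \<otimes> K\<^sub>i\<^sup>-\<^sup>1 + 1 \<otimes> F\<^sub>i\<close>, \<open>\<Delta>(K\<^sub>i) = K\<^sub>i \<otimes> K\<^sub>i\<close>.\<close>

definition mtensor :: "('c, 'b) matr \<Rightarrow> ('c', 'b') matr \<Rightarrow> ('c \<times> 'c', 'b \<times> 'b') matr" where
  "mtensor S T = (\<lambda>c b. S (fst c) (fst b) * T (snd c) (snd b))"

definition tensor :: "'a umodule \<Rightarrow> 'b umodule \<Rightarrow> ('a \<times> 'b) umodule" where
  "tensor M N =
     \<lparr> basis = basis M \<times> basis N,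
       Eop = (\<lambda>i c b. mtensor (Eop M i) idm c b + mtensor (Kop M i) (Eop N i) c b),
       Fop = (\<lambda>i c b. mtensor (Fop M i) (Kiop N i) c b + mtensor idm (Fop N i) c b),
       Kop = (\<lambda>i. mtensor (Kop M i) (Kop N i)),
       Kiop = (\<lambda>i. mtensor (Kiop M i) (Kiop N i)) \<rparr>"

definition affinize :: "nat \<Rightarrow> 'b umodule \<Rightarrow> scalar \<Rightarrow> 'b umodule" where
  "affinize n M z = M
     \<lparr> Eop := (\<lambda>i c b. (if i mod int n = 0 then z else 1) * Eop M i c b),
       Fop := (\<lambda>i c b. (if i mod int n = 0 then inverse z else 1) * Fop M i c b) \<rparr>"

definition intertwines ::
  "'b umodule \<Rightarrow> 'c umodule \<Rightarrow> ('c, 'b) matr \<Rightarrow> ('b, 'b) matr \<Rightarrow> ('c, 'c) matr \<Rightarrow> bool" where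
  "intertwines M N T X Y \<longleftrightarrow>
     eq_on (basis N) (basis M) (mmul (basis N) Y T) (mmul (basis M) T X)"

definition U_linear :: "'b umodule \<Rightarrow> 'c umodule \<Rightarrow> ('c, 'b) matr \<Rightarrow> bool" where
  "U_linear M N T \<longleftrightarrow> (\<forall>i.
     intertwines M N T (Eop M i) (Eop N i) \<and> intertwines M N T (Fop M i) (Fop N i) \<and>
     intertwines M N T (Kop M i) (Kop N i) \<and> intertwines M N T (Kiop M i) (Kiop N i))"

definition U_isomorphism :: "'b umodule \<Rightarrow> 'c umodule \<Rightarrow> ('c, 'b) matr \<Rightarrow> bool" where
  "U_isomorphism M N T \<longleftrightarrow> U_linear M N T \<and>
     (\<exists>S. eq_on (basis M) (basis M) (mmul (basis N) S T) idm \<and>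
          eq_on (basis N) (basis N) (mmul (basis M) T S) idm)"

text \<open>The generators \<open>B\<^sub>i = F\<^sub>i + E\<^bsub>i+n'\<^esub>K\<^sub>i\<^sup>-\<^sup>1\<close> and \<open>K\<^sub>iK\<^bsub>i+n'\<^esub>\<^sup>-\<^sup>1\<close> (\<open>n' = n/2\<close>) of the \<open>\<imath>\<close>quantum group;
  a map is linear over it iff it commutes with these.\<close>

definition Bop :: "nat \<Rightarrow> 'b umodule \<Rightarrow> int \<Rightarrow> ('b, 'b) matr" where
  "Bop n M i = (\<lambda>c b. Fop M i c b + mmul (basis M) (Eop M (i + int (n div 2))) (Kiop M i) c b)"

definition KKop :: "nat \<Rightarrow> 'b umodule \<Rightarrow> int \<Rightarrow> ('b, 'b) matr" where
  "KKop n M i = mmul (basis M) (Kop M i) (Kiop M (i + int (n div 2)))"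

definition Ui_linear :: "nat \<Rightarrow> 'b umodule \<Rightarrow> 'c umodule \<Rightarrow> ('c, 'b) matr \<Rightarrow> bool" where
  "Ui_linear n M N T \<longleftrightarrow> (\<forall>i.
     intertwines M N T (Bop n M i) (Bop n N i) \<and> intertwines M N T (KKop n M i) (KKop n N i))"

text \<open>Indices in \<open>\<int>/n\<int>\<close> are integers read modulo \<open>n\<close>: a vector \<open>\<alpha> = (\<alpha>\<^sub>1,\<dots>,\<alpha>\<^sub>n)\<close> is an
  \<open>n\<close>-periodic function on the integers.\<close>

type_synonym comp = "int \<Rightarrow> int"

definition comps :: "nat \<Rightarrow> nat \<Rightarrow> comp set" where
  "comps n s = {\<alpha>. (\<forall>i. \<alpha> (i + int n) = \<alpha> i) \<and> (\<forall>i. \<alpha> i \<ge> 0) \<and> (\<Sum>i=1..int n. \<alpha> i) = int s}"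

definition evec :: "nat \<Rightarrow> int \<Rightarrow> comp" where
  "evec n i = (\<lambda>j. of_bool (j mod int n = i mod int n))"

text \<open>The convention that \<open>v\<^sub>\<alpha> = 0\<close> if \<open>\<alpha>\<close> has a negative entry is implicit: such \<open>\<alpha>\<close> are not in
  the basis \<open>comps n s\<close>.\<close>

definition KR :: "nat \<Rightarrow> nat \<Rightarrow> comp umodule" where
  "KR n s =
     \<lparr> basis = comps n s,
       Eop = (\<lambda>i \<beta> \<alpha>. of_bool (\<beta> = (\<lambda>k. \<alpha> k + evec n i k - evec n (i + 1) k)) * qint (\<alpha> i + 1)),
       Fop = (\<lambda>i \<beta> \<alpha>. of_bool (\<beta> = (\<lambda>k. \<alpha> k - evec n i k + evec n (i + 1) k)) * qint (\<alpha> (i + 1) + 1)),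
       Kop = (\<lambda>i \<beta> \<alpha>. of_bool (\<beta> = \<alpha>) * qq powi (\<alpha> i - \<alpha> (i + 1))),
       Kiop = (\<lambda>i \<beta> \<alpha>. of_bool (\<beta> = \<alpha>) * qq powi (- (\<alpha> i - \<alpha> (i + 1)))) \<rparr>"

definition dual_KR :: "nat \<Rightarrow> nat \<Rightarrow> comp umodule" where
  "dual_KR n s =
     \<lparr> basis = comps n s,
       Eop = (\<lambda>i \<beta> \<alpha>. of_bool (\<beta> = (\<lambda>k. \<alpha> k - evec n i k + evec n (i + 1) k)) * qint (\<alpha> (i + 1) + 1)),
       Fop = (\<lambda>i \<beta> \<alpha>. of_bool (\<beta> = (\<lambda>k. \<alpha> k + evec n i k - evec n (i + 1) k)) * qint (\<alpha> i + 1)),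
       Kop = (\<lambda>i \<beta> \<alpha>. of_bool (\<beta> = \<alpha>) * qq powi (- \<alpha> i + \<alpha> (i + 1))),
       Kiop = (\<lambda>i \<beta> \<alpha>. of_bool (\<beta> = \<alpha>) * qq powi (- (- \<alpha> i + \<alpha> (i + 1)))) \<rparr>"

text \<open>The map \<open>\<W>(z) \<rightarrow> \<W>\<^sup>\<or>(z\<^sup>-\<^sup>1)\<close> with \<open>v\<^sub>j \<mapsto> v\<^sup>\<or>\<^bsub>j+n'\<^esub>\<close> for \<open>1 \<le> j \<le> n'\<close> and
  \<open>v\<^sub>j \<mapsto> z\<^sup>-\<^sup>1v\<^sup>\<or>\<^bsub>j+n'\<^esub>\<close> for \<open>n' < j \<le> n\<close>.\<close>

definition K_W :: "nat \<Rightarrow> scalar \<Rightarrow> (comp, comp) matr" where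
  "K_W n z = (\<lambda>c b. \<Sum>j=1..int n.
     (if j \<le> int (n div 2) then 1 else inverse z) *
     of_bool (b = evec n j \<and> c = evec n (j + int (n div 2))))"

text \<open>A choice of the \<open>U\<close>-linear isomorphism \<open>\<W>\<^sup>\<or>(u) \<otimes> \<W>(v) \<rightarrow> \<W>(v) \<otimes> \<W>\<^sup>\<or>(u)\<close>, which for generic
  \<open>u/v\<close> is unique up to a scalar. It is only used for \<open>u/v = q\<^sup>m x\<^sup>-\<^sup>2\<close>.\<close>

definition R_W :: "nat \<Rightarrow> scalar \<Rightarrow> scalar \<Rightarrow> (comp \<times> comp, comp \<times> comp) matr" where
  "R_W n u v = (SOME T. U_isomorphism
     (tensor (affinize n (dual_KR n 1) u) (affinize n (KR n 1) v))
     (tensor (affinize n (KR n 1) v) (affinize n (dual_KR n 1) u)) T)"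

text \<open>Vectors of \<open>\<W>\<^sub>s(x)\<close> and of \<open>\<W>\<^sub>s\<^sup>\<or>(x\<^sup>-\<^sup>1)\<close> are written in the coordinates of the bases \<open>v\<^sub>\<alpha>\<close> and
  \<open>v\<^sub>\<alpha>\<^sup>\<or>\<close>; vectors of the \<open>s\<close>-fold tensor products are written in the tensor product bases,
  indexed by lists of length \<open>s\<close>. Component \<open>k\<close> of the tensor product is list entry \<open>k - 1\<close>.\<close>

definition coord_space :: "nat \<Rightarrow> nat \<Rightarrow> (comp \<Rightarrow> scalar) set" where
  "coord_space n s = {f. \<forall>\<alpha>. \<alpha> \<notin> comps n s \<longrightarrow> f \<alpha> = 0}"

definition tbasis :: "nat \<Rightarrow> nat \<Rightarrow> comp list set" where
  "tbasis n s = {l. length l = s \<and> set l \<subseteq> comps n 1}"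

definition words :: "nat \<Rightarrow> nat \<Rightarrow> comp \<Rightarrow> int list set" where
  "words n s \<alpha> = {w. length w = s \<and> set w \<subseteq> {1..int n} \<and>
     (\<forall>i\<in>{1..int n}. int (count_list w i) = \<alpha> i)}"

definition descs :: "int list \<Rightarrow> nat" where
  "descs w = card {(p, p'). p < p' \<and> p' < length w \<and> w ! p > w ! p'}"

definition ascs :: "int list \<Rightarrow> nat" where
  "ascs w = card {(p, p'). p < p' \<and> p' < length w \<and> w ! p < w ! p'}"

definition embed :: "nat \<Rightarrow> nat \<Rightarrow> (comp \<Rightarrow> scalar) \<Rightarrow> comp list \<Rightarrow> scalar" where
  "embed n s f = (\<lambda>l. \<Sum>\<alpha>\<in>comps n s. f \<alpha> *
     (\<Sum>w\<in>words n s \<alpha>. qq powi (- int (descs w)) * of_bool (l = map (evec n) w)))"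

definition embed_dual :: "nat \<Rightarrow> nat \<Rightarrow> (comp \<Rightarrow> scalar) \<Rightarrow> comp list \<Rightarrow> scalar" where
  "embed_dual n s f = (\<lambda>l. \<Sum>\<alpha>\<in>comps n s. f \<alpha> *
     (\<Sum>w\<in>words n s \<alpha>. qq powi (- int (ascs w)) * of_bool (l = map (evec n) w)))"

definition tensor_op :: "nat \<Rightarrow> nat \<Rightarrow> (comp list, comp list) matr \<Rightarrow>
    (comp list \<Rightarrow> scalar) \<Rightarrow> comp list \<Rightarrow> scalar" where
  "tensor_op n s T f = (\<lambda>l'. if l' \<in> tbasis n s then (\<Sum>l\<in>tbasis n s. T l' l * f l) else 0)"

definition K_first :: "nat \<Rightarrow> nat \<Rightarrow> scalar \<Rightarrow> (comp list, comp list) matr" where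
  "K_first n s z = (\<lambda>l' l.
     of_bool (\<forall>m<s. m \<noteq> 0 \<longrightarrow> l' ! m = l ! m) * K_W n z (l' ! 0) (l ! 0))"

definition R_comp :: "nat \<Rightarrow> nat \<Rightarrow> nat \<Rightarrow> scalar \<Rightarrow> scalar \<Rightarrow> (comp list, comp list) matr" where
  "R_comp n s k u v = (\<lambda>l' l.
     of_bool (\<forall>m<s. m \<noteq> k - 1 \<and> m \<noteq> k \<longrightarrow> l' ! m = l ! m) *
     R_W n u v (l' ! (k - 1), l' ! k) (l ! (k - 1), l ! k))"

text \<open>\<open>K_factor n s j\<close> is \<open>K\<^sup>(\<^sup>j\<^sup>)(x) = K\<^sub>1 R\<^sub>1\<^sub>,\<^sub>2 R\<^sub>2\<^sub>,\<^sub>3 \<dots> R\<^bsub>j-1,j\<^esub>\<close>, and \<open>K_full n s\<close> is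
  \<open>K\<^sup>(\<^sup>s\<^sup>)(x) \<dots> K\<^sup>(\<^sup>1\<^sup>)(x)\<close>; products are compositions.\<close>

definition K_factor :: "nat \<Rightarrow> nat \<Rightarrow> nat \<Rightarrow> (comp list \<Rightarrow> scalar) \<Rightarrow> comp list \<Rightarrow> scalar" where
  "K_factor n s j =
     (let v = qq powi (- int s + 2 * int j - 1) * xx;
          u = (\<lambda>k. qq powi (int s - 2 * int j + 2 * int k + 1) * inverse xx)
      in tensor_op n s (K_first n s v) \<circ>
         foldr (\<lambda>k g. tensor_op n s (R_comp n s k (u k) v) \<circ> g) [1..<j] id)"

definition K_full :: "nat \<Rightarrow> nat \<Rightarrow> (comp list \<Rightarrow> scalar) \<Rightarrow> comp list \<Rightarrow> scalar" where
  "K_full n s = fold (K_factor n s) [1..<Suc s]"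

definition is_K_Ws :: "nat \<Rightarrow> nat \<Rightarrow> ((comp \<Rightarrow> scalar) \<Rightarrow> comp \<Rightarrow> scalar) \<Rightarrow> bool" where
  "is_K_Ws n s \<kappa> \<longleftrightarrow> (\<forall>f\<in>coord_space n s.
     \<kappa> f \<in> coord_space n s \<and> embed_dual n s (\<kappa> f) = K_full n s (embed n s f))"

text \<open>In coordinates, both lattices \<open>\<L>\<^sub>s(x)\<close> and \<open>\<L>\<^sub>s\<^sup>\<or>(x\<^sup>-\<^sup>1)\<close> are the vectors with entries in \<open>A_x\<close>, reduction
  modulo \<open>q\<^sup>-\<^sup>1\<close> is entrywise, and \<open>x\<^sup>d b\<^sub>\<alpha>\<close> and \<open>x\<^sup>d b\<^sub>\<alpha>\<^sup>\<or>\<close> are both represented by \<open>crystal_elt d \<alpha>\<close>.\<close>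

definition lattice_s :: "nat \<Rightarrow> nat \<Rightarrow> (comp \<Rightarrow> scalar) set" where
  "lattice_s n s = {f \<in> coord_space n s. \<forall>\<alpha>\<in>comps n s. f \<alpha> \<in> A_x}"

definition reduce :: "(comp \<Rightarrow> scalar) \<Rightarrow> comp \<Rightarrow> ratx" where
  "reduce f = (\<lambda>\<alpha>. mod_qinv (f \<alpha>))"

definition crystal_elt :: "int \<Rightarrow> comp \<Rightarrow> comp \<Rightarrow> ratx" where
  "crystal_elt d \<alpha> = (\<lambda>\<beta>. of_bool (\<beta> = \<alpha>) * rat_x powi d)"

definition crystal_s :: "nat \<Rightarrow> nat \<Rightarrow> (comp \<Rightarrow> ratx) set" where
  "crystal_s n s = {crystal_elt d \<alpha> | d \<alpha>. \<alpha> \<in> comps n s}"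

text \<open>\<open>c\<close> is the rescaling factor and \<open>\<kappa>'\<close> the induced map modulo \<open>q\<^sup>-\<^sup>1\<close>. The
  combinatorial K-matrix is unique only up to a power of \<open>x\<close>, hence a predicate.\<close>

definition is_combinatorial_K_matrix ::
  "nat \<Rightarrow> nat \<Rightarrow> ((comp \<Rightarrow> ratx) \<Rightarrow> comp \<Rightarrow> ratx) \<Rightarrow> bool" where
  "is_combinatorial_K_matrix n s \<K> \<longleftrightarrow> (\<exists>\<kappa> c \<kappa>'.
     is_K_Ws n s \<kappa> \<and> c \<noteq> 0 \<and>
     (\<forall>f\<in>lattice_s n s. (\<lambda>\<alpha>. c * \<kappa> f \<alpha>) \<in> lattice_s n s \<and>
        \<kappa>' (reduce f) = reduce (\<lambda>\<alpha>. c * \<kappa> f \<alpha>)) \<and>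
     (\<exists>f\<in>lattice_s n s. \<kappa>' (reduce f) \<noteq> (\<lambda>_. 0)) \<and>
     bij_betw \<kappa>' (crystal_s n s) (crystal_s n s) \<and>
     (\<forall>b\<in>crystal_s n s. \<K> b = \<kappa>' b))"

lemma rat_x_powi_inject: "rat_x powi d = rat_x powi e \<longleftrightarrow> d = e"
proof -
  have x0: "rat_x \<noteq> 0"
    by (simp add: rat_x_def Zero_fract_def eq_fract)
  have pow: "rat_x ^ k = Fract ([:0, 1:] ^ k) 1" for k
    by (induction k) (simp_all add: rat_x_def One_fract_def mult_fract)
  have nt: "rat_x ^ k \<noteq> 1" if "k > 0" for k
  proof
    assume "rat_x ^ k = 1"
    then have "([:0, 1:] :: complex poly) ^ k = 1"
      by (simp add: pow One_fract_def eq_fract)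
    then have "degree (([:0, 1:] :: complex poly) ^ k) = 0"
      by simp
    with that show False
      by (simp add: degree_power_eq)
  qed
  have le: "a = b" if "rat_x powi a = rat_x powi b" "a \<le> b" for a b
  proof -
    have "rat_x powi (b - a) = 1"
      using that x0 by (simp add: power_int_diff)
    then have "rat_x ^ nat (b - a) = 1"
      using that by (simp add: power_int_def)
    then have "nat (b - a) = 0"
      using nt by blast
    then show ?thesis using that by simp
  qed
  show ?thesis
    using le[of d e] le[of e d] by (metis linear)
qed

text \<open>Hence a map on \<open>{x\<^sup>d b\<^sub>\<alpha>}\<close> can be prescribed by its values at all pairs \<open>(d, \<alpha>)\<close>.\<close>

lemma crystal_elt_inject: "crystal_elt d \<alpha> = crystal_elt e \<beta> \<longleftrightarrow> d = e \<and> \<alpha> = \<beta>"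
proof
  assume h: "crystal_elt d \<alpha> = crystal_elt e \<beta>"
  have x0: "rat_x \<noteq> 0"
    by (simp add: rat_x_def Zero_fract_def eq_fract)
  from fun_cong[OF h, of \<alpha>] have "\<alpha> = \<beta>"
    using x0 by (cases "\<alpha> = \<beta>") (simp_all add: crystal_elt_def)
  with fun_cong[OF h, of \<alpha>] show "d = e \<and> \<alpha> = \<beta>"
    by (simp add: crystal_elt_def rat_x_powi_inject)
qed simp

lemma evec_eq_iff: "evec n i = evec n j \<longleftrightarrow> i mod int n = j mod int n"
proof
  assume "evec n i = evec n j"
  from fun_cong[OF this, of i] show "i mod int n = j mod int n"
    by (simp add: evec_def split: if_splits)
qed (simp add: evec_def)

lemma mod_1_n_eq:
  assumes "(i :: int) \<in> {1..m}" "j \<in> {1..m}" "i mod m = j mod m"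
  shows "i = j"
proof -
  from assms(3) have "m dvd i - j"
    by (simp add: mod_eq_dvd_iff)
  then show ?thesis using assms(1,2)
    by (auto simp: dvd_def) (smt (verit) mult_le_cancel_left1 mult_minus_right)
qed

lemma rep_1_n:
  assumes "(m :: int) > 0"
  shows "(i - 1) mod m + 1 \<in> {1..m}" "((i - 1) mod m + 1) mod m = i mod m"
  using pos_mod_bound[OF assms, of "i - 1"] pos_mod_sign[OF assms, of "i - 1"]
  by (simp_all add: mod_add_left_eq del: pos_mod_bound pos_mod_sign)

lemma periodic_mod:
  fixes \<alpha> :: "int \<Rightarrow> int"
  assumes per: "\<forall>i. \<alpha> (i + int n) = \<alpha> i" and eq: "i mod int n = j mod int n"
  shows "\<alpha> i = \<alpha> j"
proof -
  have nat_shift: "\<alpha> (i + int k * int n) = \<alpha> i" for i k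
  proof (induction k)
    case (Suc k)
    have "i + int (Suc k) * int n = (i + int k * int n) + int n"
      by (simp add: distrib_right)
    with Suc per show ?case by metis
  qed simp
  have shift: "\<alpha> (i + k * int n) = \<alpha> i" for i k
  proof (cases "k \<ge> 0")
    case True
    then show ?thesis using nat_shift[of i "nat k"] by simp
  next
    case False
    then show ?thesis using nat_shift[of "i + k * int n" "nat (- k)"] by simp
  qed
  from eq have "int n dvd i - j"
    by (simp add: mod_eq_dvd_iff)
  then obtain k where "i - j = int n * k" ..
  then have "i = j + k * int n"
    by (simp add: mult.commute)
  then show ?thesis using shift by simp
qed

lemma evec_in_comps:
  assumes "n > 0"
  shows "evec n j \<in> comps n 1"
proof -
  let ?r = "(j - 1) mod int n + 1"
  have r: "?r \<in> {1..int n}" "?r mod int n = j mod int n"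
    using rep_1_n[of "int n" j] assms by simp_all
  have "(\<Sum>i=1..int n. evec n j i) = (\<Sum>i=1..int n. of_bool (i = ?r))"
    by (rule sum.cong) (use r mod_1_n_eq in \<open>force simp: evec_def\<close>)+
  also have "\<dots> = 1"
    using r(1) by (simp add: of_bool_def sum.delta)
  finally show ?thesis
    by (auto simp: comps_def evec_def)
qed

lemma comps_1_eq:
  assumes "n > 0"
  shows "comps n 1 = evec n ` {1..int n}"
proof
  show "evec n ` {1..int n} \<subseteq> comps n 1"
    using evec_in_comps[OF assms] by auto
next
  show "comps n 1 \<subseteq> evec n ` {1..int n}"
  proof
    fix \<alpha> assume a: "\<alpha> \<in> comps n 1"
    then have per: "\<forall>i. \<alpha> (i + int n) = \<alpha> i" and nn: "\<And>i. \<alpha> i \<ge> 0"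
      and sm: "(\<Sum>i=1..int n. \<alpha> i) = 1"
      by (auto simp: comps_def)
    from sm obtain j where j: "j \<in> {1..int n}" "\<alpha> j \<noteq> 0"
      by (metis sum.neutral zero_neq_one)
    have "(\<Sum>i=1..int n. \<alpha> i) = \<alpha> j + (\<Sum>i\<in>{1..int n} - {j}. \<alpha> i)"
      using j by (simp add: sum.remove)
    moreover have "(\<Sum>i\<in>{1..int n} - {j}. \<alpha> i) \<ge> 0"
      using nn by (simp add: sum_nonneg)
    ultimately have j1: "\<alpha> j = 1" and rest: "(\<Sum>i\<in>{1..int n} - {j}. \<alpha> i) = 0"
      using sm nn[of j] j(2) by linarith+
    have z: "\<alpha> i = 0" if "i \<in> {1..int n} - {j}" for i
      using rest nn that by (subst (asm) sum_nonneg_eq_0_iff) auto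
    have "\<alpha> i = evec n j i" for i
    proof -
      let ?r = "(i - 1) mod int n + 1"
      have r: "?r \<in> {1..int n}" "?r mod int n = i mod int n"
        using rep_1_n[of "int n" i] assms by simp_all
      have "\<alpha> i = \<alpha> ?r"
        by (rule periodic_mod[OF per r(2)[symmetric]])
      also have "\<dots> = evec n j ?r"
      proof (cases "?r = j")
        case True
        with j1 show ?thesis unfolding evec_def by simp
      next
        case False
        then have "?r mod int n \<noteq> j mod int n"
          using mod_1_n_eq[OF r(1) j(1)] by blast
        moreover have "\<alpha> ?r = 0"
          using z False r(1) by blast
        ultimately show ?thesis unfolding evec_def by simp
      qed
      also have "\<dots> = evec n j i"
        unfolding evec_def r(2) ..
      finally show ?thesis .
    qed
    then have "\<alpha> = evec n j" by (rule ext)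
    with j(1) show "\<alpha> \<in> evec n ` {1..int n}" by blast
  qed
qed

lemma qint_1: "qint 1 = 1"
proof -
  have t: "Fract [:0, 1:] 1 \<noteq> (0 :: scalar)"
    by (simp add: Zero_fract_def[where 'a = "ratx poly"] eq_fract)
  have "qq \<noteq> inverse qq"
  proof
    assume "qq = inverse qq"
    then have "Fract [:0, 1:] 1 * Fract [:0, 1:] 1 = (1 :: scalar)"
      using t by (simp add: qq_def field_simps)
    then have "[:0, 1:] * [:0, 1:] = (1 :: ratx poly)"
      by (simp add: One_fract_def[where 'a = "ratx poly"] eq_fract)
    then have "degree ([:0, 1:] * [:0, 1:] :: ratx poly) = 0"
      by simp
    then show False by simp
  qed
  then show ?thesis by (simp add: qint_def)
qed

lemma int_mod_neq_Suc:
  assumes "n \<ge> 4"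
  shows "(i + 1) mod int n \<noteq> i mod int n"
proof
  assume "(i + 1) mod int n = i mod int n"
  then have "int n dvd 1" by (simp add: mod_eq_dvd_iff)
  with assms show False by simp
qed

lemma evec_move:
  assumes d: "d \<in> comps n 1" and pq: "p mod int n \<noteq> q mod int n"
  shows "d = (\<lambda>k. evec n j k - evec n p k + evec n q k) \<longleftrightarrow>
         j mod int n = p mod int n \<and> d = evec n q"
proof
  assume h: "d = (\<lambda>k. evec n j k - evec n p k + evec n q k)"
  have jp: "j mod int n = p mod int n"
  proof (rule ccontr)
    assume "j mod int n \<noteq> p mod int n"
    then have "d p = -1"
      using pq unfolding h by (auto simp: evec_def)
    moreover have "d p \<ge> 0" using d by (simp add: comps_def)
    ultimately show False by simp
  qed
  then have "evec n j = evec n p" by (simp add: evec_eq_iff)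
  with h jp show "j mod int n = p mod int n \<and> d = evec n q" by auto
next
  assume "j mod int n = p mod int n \<and> d = evec n q"
  then show "d = (\<lambda>k. evec n j k - evec n p k + evec n q k)"
    by (auto simp: evec_def)
qed

lemma finite_comps_1: "n > 0 \<Longrightarrow> finite (comps n 1)"
  by (subst comps_1_eq) simp_all

lemma sum_pick:
  assumes "n > 0"
  shows "(\<Sum>d\<in>comps n 1. f d * (of_bool (d = evec n m) * g d)) = f (evec n m) * (g (evec n m) :: scalar)"
    and "(\<Sum>d\<in>comps n 1. f d * (of_bool (P \<and> d = evec n m) * y)) = of_bool P * f (evec n m) * y"
proof -
  have fin: "finite (comps n 1)" and m: "evec n m \<in> comps n 1"
    using assms finite_comps_1 evec_in_comps by auto
  have "(\<Sum>d\<in>comps n 1. f d * (of_bool (d = evec n m) * g d)) =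
        (\<Sum>d\<in>comps n 1. if d = evec n m then f (evec n m) * g (evec n m) else 0)"
    by (rule sum.cong) auto
  with fin m show "(\<Sum>d\<in>comps n 1. f d * (of_bool (d = evec n m) * g d)) = f (evec n m) * g (evec n m)"
    by simp
  have "(\<Sum>d\<in>comps n 1. f d * (of_bool (P \<and> d = evec n m) * y)) =
        (\<Sum>d\<in>comps n 1. if d = evec n m then of_bool P * f (evec n m) * y else 0)"
    by (rule sum.cong) auto
  with fin m show "(\<Sum>d\<in>comps n 1. f d * (of_bool (P \<and> d = evec n m) * y)) = of_bool P * f (evec n m) * y"
    by simp
qed

definition aff_w :: "nat \<Rightarrow> scalar \<Rightarrow> int \<Rightarrow> scalar" where
  "aff_w n z i = (if i mod int n = 0 then z else 1)"

definition K_w :: "nat \<Rightarrow> scalar \<Rightarrow> int \<Rightarrow> scalar" where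
  "K_w n z j = (if (j - 1) mod int n + 1 \<le> int (n div 2) then 1 else inverse z)"

lemma K_W_column:
  assumes "n > 0"
  shows "K_W n z c (evec n j) = of_bool (c = evec n (j + int (n div 2))) * K_w n z j"
proof -
  let ?r = "(j - 1) mod int n + 1"
  have r: "?r \<in> {1..int n}" "?r mod int n = j mod int n"
    using rep_1_n[of "int n" j] assms by simp_all
  have sh: "evec n (?r + int (n div 2)) = evec n (j + int (n div 2))"
    using r(2) unfolding evec_eq_iff by (metis mod_add_left_eq)
  have eq: "evec n j = evec n j' \<longleftrightarrow> j' = ?r" if "j' \<in> {1..int n}" for j'
    using that r mod_1_n_eq[of j' "int n" ?r] by (auto simp: evec_eq_iff)
  have "K_W n z c (evec n j) = (\<Sum>j'=1..int n. if j' = ?r then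
      K_w n z j * of_bool (c = evec n (j + int (n div 2))) else 0)"
    unfolding K_W_def
  proof (rule sum.cong)
    fix j' assume "j' \<in> {1..int n}"
    then show "(if j' \<le> int (n div 2) then 1 else inverse z) *
        of_bool (evec n j = evec n j' \<and> c = evec n (j' + int (n div 2))) =
        (if j' = ?r then K_w n z j * of_bool (c = evec n (j + int (n div 2))) else 0)"
      using eq[of j'] sh by (cases "j' = ?r") (simp_all add: K_w_def)
  qed simp
  also have "\<dots> = K_w n z j * of_bool (c = evec n (j + int (n div 2)))"
    using r(1) by simp
  finally show ?thesis by simp
qed

lemma KR_columns:
  assumes n: "n \<ge> 4" and c: "c \<in> comps n 1"
  shows "Eop (affinize n (KR n 1) z) i c (evec n j) =
           of_bool (j mod int n = (i + 1) mod int n \<and> c = evec n i) * aff_w n z i"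
    and "Fop (affinize n (KR n 1) z) i c (evec n j) =
           of_bool (j mod int n = i mod int n \<and> c = evec n (i + 1)) * aff_w n (inverse z) i"
    and "Eop (affinize n (dual_KR n 1) z) i c (evec n j) =
           of_bool (j mod int n = i mod int n \<and> c = evec n (i + 1)) * aff_w n z i"
    and "Fop (affinize n (dual_KR n 1) z) i c (evec n j) =
           of_bool (j mod int n = (i + 1) mod int n \<and> c = evec n i) * aff_w n (inverse z) i"
proof -
  have ne: "i mod int n \<noteq> (i + 1) mod int n" "(i + 1) mod int n \<noteq> i mod int n"
    using int_mod_neq_Suc[OF n, of i] by auto
  have comm: "(\<lambda>k. evec n j k + evec n i k - evec n (i + 1) k) =
              (\<lambda>k. evec n j k - evec n (i + 1) k + evec n i k)"
    by auto
  have e: "evec n j i = 0" if "j mod int n = (i + 1) mod int n"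
    using that ne by (simp add: evec_def)
  have e': "evec n j (i + 1) = 0" if "j mod int n = i mod int n"
    using that ne by (simp add: evec_def)
  note mv = evec_move[OF c ne(1), of j] evec_move[OF c ne(2), of j]
  show "Eop (affinize n (KR n 1) z) i c (evec n j) =
           of_bool (j mod int n = (i + 1) mod int n \<and> c = evec n i) * aff_w n z i"
    unfolding affinize_def KR_def umodule.simps comm mv
    using e by (auto simp: aff_w_def qint_1)
  show "Fop (affinize n (KR n 1) z) i c (evec n j) =
           of_bool (j mod int n = i mod int n \<and> c = evec n (i + 1)) * aff_w n (inverse z) i"
    unfolding affinize_def KR_def umodule.simps mv
    using e' by (auto simp: aff_w_def qint_1)
  show "Eop (affinize n (dual_KR n 1) z) i c (evec n j) =
           of_bool (j mod int n = i mod int n \<and> c = evec n (i + 1)) * aff_w n z i"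
    unfolding affinize_def dual_KR_def umodule.simps mv
    using e' by (auto simp: aff_w_def qint_1)
  show "Fop (affinize n (dual_KR n 1) z) i c (evec n j) =
           of_bool (j mod int n = (i + 1) mod int n \<and> c = evec n i) * aff_w n (inverse z) i"
    unfolding affinize_def dual_KR_def umodule.simps comm mv
    using e by (auto simp: aff_w_def qint_1)
qed

lemma qq_nonzero: "qq \<noteq> 0"
proof -
  have "Fract [:0, 1:] 1 \<noteq> (0 :: scalar)"
    by (simp add: Zero_fract_def[where 'a = "ratx poly"] eq_fract)
  then show ?thesis unfolding qq_def by (rule nonzero_imp_inverse_nonzero)
qed

context
  fixes n :: nat and h :: int
  assumes n: "n \<ge> 4" "even n" and h: "h = int (n div 2)"
begin

lemma n_eq: "int n = 2 * h" and h2: "h \<ge> 2"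
  using n by (auto simp: h)

lemma mod_shift_h:
  "(i + h) mod int n = (j + h) mod int n \<longleftrightarrow> i mod int n = j mod int n"
  "(i + h + h) mod int n = i mod int n"
  "(i + h) mod int n = j mod int n \<longleftrightarrow> i mod int n = (j + h) mod int n"
proof -
  show 1: "(i + h) mod int n = (j + h) mod int n \<longleftrightarrow> i mod int n = j mod int n" for i j
    by (simp add: mod_eq_dvd_iff)
  have "i + h + h = i + int n" for i
    using n_eq by simp
  then show 2: "(i + h + h) mod int n = i mod int n" for i
    by simp
  show "(i + h) mod int n = j mod int n \<longleftrightarrow> i mod int n = (j + h) mod int n"
    using 1[of "i + h" j] 2[of i] by simp
qed

lemma evec_far:
  assumes "j mod int n = (i + h) mod int n \<or> j mod int n = (i + h + 1) mod int n"
  shows "evec n j i = evec n j (i + 1)"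
proof -
  have nd: "\<not> int n dvd h" "\<not> int n dvd h + 1" "\<not> int n dvd h - 1"
    using n_eq h2 zdvd_imp_le[of "int n"] by fastforce+
  have "(i + h) mod int n \<noteq> i mod int n" "(i + h + 1) mod int n \<noteq> i mod int n"
    "(i + h) mod int n \<noteq> (i + 1) mod int n" "(i + h + 1) mod int n \<noteq> (i + 1) mod int n"
    unfolding mod_eq_dvd_iff using nd by (simp_all add: algebra_simps)
  with assms show ?thesis unfolding evec_def by (elim disjE) simp_all
qed

lemma w_step:
  assumes z: "z \<noteq> 0"
  shows "aff_w n (inverse z) i * K_w n z (i + 1) = aff_w n (inverse z) (i + h) * K_w n z i"
proof -
  define r where "r = i mod int n"
  have r: "0 \<le> r" "r < int n"
    using n by (simp_all add: r_def)
  have a: "(i + 1 - 1) mod int n = r"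
    by (simp add: r_def)
  have b: "(i - 1) mod int n = (if r = 0 then int n - 1 else r - 1)"
  proof -
    have "(i - 1) mod int n = (r - 1) mod int n"
      by (simp add: r_def mod_diff_left_eq)
    also have "\<dots> = (if r = 0 then int n - 1 else r - 1)"
      using r by (auto simp: zmod_minus1)
    finally show ?thesis .
  qed
  have c: "(i + h) mod int n = (if r < h then r + h else r - h)"
  proof -
    have "(i + h) mod int n = (r + h) mod int n"
      by (simp add: r_def mod_add_left_eq)
    also have "\<dots> = (if r < h then r + h else r - h)"
    proof (cases "r < h")
      case True
      then show ?thesis using r n_eq by (simp add: mod_pos_pos_trivial)
    next
      case False
      then have "(r + h) mod int n = (r - h) mod int n"
        using n_eq by (metis add.assoc diff_add_cancel mod_add_self2 mult_2)
      also have "\<dots> = r - h"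
        using False r h2 by (intro mod_pos_pos_trivial) auto
      finally show ?thesis using False by simp
    qed
    finally show ?thesis .
  qed
  show ?thesis
    unfolding aff_w_def K_w_def a b c h[symmetric] r_def[symmetric]
    using r n_eq h2 z by auto
qed

lemma aff_w_inverse: "z \<noteq> 0 \<Longrightarrow> aff_w n z i * aff_w n (inverse z) i = 1"
  by (simp add: aff_w_def)

lemma w_step':
  assumes z: "z \<noteq> 0"
  shows "aff_w n z (i + h) * K_w n z (i + h) = aff_w n z i * K_w n z (i + h + 1)"
proof -
  have p: "aff_w n (inverse z) (i + h + h) = aff_w n (inverse z) i"
    unfolding aff_w_def mod_shift_h ..
  have "aff_w n z i * K_w n z (i + h + 1) =
      aff_w n z i * (aff_w n z (i + h) * aff_w n (inverse z) (i + h)) * K_w n z (i + h + 1)"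
    using z by (simp add: aff_w_inverse)
  also have "\<dots> = aff_w n z i * aff_w n z (i + h) *
      (aff_w n (inverse z) (i + h) * K_w n z (i + h + 1))"
    by (simp add: mult_ac)
  also have "\<dots> = aff_w n z i * aff_w n z (i + h) * (aff_w n (inverse z) i * K_w n z (i + h))"
    using w_step[OF z, of "i + h"] p by simp
  also have "\<dots> = (aff_w n z i * aff_w n (inverse z) i) * (aff_w n z (i + h) * K_w n z (i + h))"
    by (simp add: mult_ac)
  finally show ?thesis using z by (simp add: aff_w_inverse)
qed

lemma K_w_cong: "i mod int n = j mod int n \<Longrightarrow> K_w n z i = K_w n z j"
  unfolding K_w_def by (metis mod_diff_left_eq)

lemma B_columns:
  assumes c: "c \<in> comps n 1"
  shows "Bop n (affinize n (KR n 1) z) i c (evec n j) =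
           of_bool (j mod int n = i mod int n \<and> c = evec n (i + 1)) * aff_w n (inverse z) i +
           of_bool (j mod int n = (i + h + 1) mod int n \<and> c = evec n (i + h)) * aff_w n z (i + h)"
    and "Bop n (affinize n (dual_KR n 1) z) i c (evec n j) =
           of_bool (j mod int n = (i + 1) mod int n \<and> c = evec n i) * aff_w n (inverse z) i +
           of_bool (j mod int n = (i + h) mod int n \<and> c = evec n (i + h + 1)) * aff_w n z (i + h)"
proof -
  have n0: "n > 0" using n by simp
  have bs: "basis (affinize n (KR n 1) z) = comps n 1" "basis (affinize n (dual_KR n 1) z) = comps n 1"
    by (simp_all add: affinize_def KR_def dual_KR_def)
  have ki: "Kiop (affinize n (KR n 1) z) i = (\<lambda>\<beta> \<alpha>. of_bool (\<beta> = \<alpha>) * qq powi (- (\<alpha> i - \<alpha> (i + 1))))"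
    "Kiop (affinize n (dual_KR n 1) z) i = (\<lambda>\<beta> \<alpha>. of_bool (\<beta> = \<alpha>) * qq powi (- (- \<alpha> i + \<alpha> (i + 1))))"
    by (simp_all add: affinize_def KR_def dual_KR_def)
  show "Bop n (affinize n (KR n 1) z) i c (evec n j) =
           of_bool (j mod int n = i mod int n \<and> c = evec n (i + 1)) * aff_w n (inverse z) i +
           of_bool (j mod int n = (i + h + 1) mod int n \<and> c = evec n (i + h)) * aff_w n z (i + h)"
    unfolding Bop_def mmul_def bs ki h[symmetric] sum_pick(1)[OF n0] KR_columns[OF n(1) c]
    using evec_far[of j i] by auto
  show "Bop n (affinize n (dual_KR n 1) z) i c (evec n j) =
           of_bool (j mod int n = (i + 1) mod int n \<and> c = evec n i) * aff_w n (inverse z) i +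
           of_bool (j mod int n = (i + h) mod int n \<and> c = evec n (i + h + 1)) * aff_w n z (i + h)"
    unfolding Bop_def mmul_def bs ki h[symmetric] sum_pick(1)[OF n0] KR_columns[OF n(1) c]
    using evec_far[of j i] by auto
qed

lemma KK_columns:
  "KKop n (affinize n (KR n 1) z) i c (evec n j) = of_bool (c = evec n j) *
     qq powi (evec n j i - evec n j (i + 1) - evec n j (i + h) + evec n j (i + h + 1))"
  "KKop n (affinize n (dual_KR n 1) z) i c (evec n j) = of_bool (c = evec n j) *
     qq powi (- evec n j i + evec n j (i + 1) + evec n j (i + h) - evec n j (i + h + 1))"
proof -
  have n0: "n > 0" using n by simp
  have bs: "basis (affinize n (KR n 1) z) = comps n 1" "basis (affinize n (dual_KR n 1) z) = comps n 1"
    by (simp_all add: affinize_def KR_def dual_KR_def)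
  have ki: "Kiop (affinize n (KR n 1) z) (i + h) =
      (\<lambda>\<beta> \<alpha>. of_bool (\<beta> = \<alpha>) * qq powi (- (\<alpha> (i + h) - \<alpha> (i + h + 1))))"
    "Kiop (affinize n (dual_KR n 1) z) (i + h) =
      (\<lambda>\<beta> \<alpha>. of_bool (\<beta> = \<alpha>) * qq powi (- (- \<alpha> (i + h) + \<alpha> (i + h + 1))))"
    by (simp_all add: affinize_def KR_def dual_KR_def)
  have k: "Kop (affinize n (KR n 1) z) i = (\<lambda>\<beta> \<alpha>. of_bool (\<beta> = \<alpha>) * qq powi (\<alpha> i - \<alpha> (i + 1)))"
    "Kop (affinize n (dual_KR n 1) z) i = (\<lambda>\<beta> \<alpha>. of_bool (\<beta> = \<alpha>) * qq powi (- \<alpha> i + \<alpha> (i + 1)))"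
    by (simp_all add: affinize_def KR_def dual_KR_def)
  show "KKop n (affinize n (KR n 1) z) i c (evec n j) = of_bool (c = evec n j) *
     qq powi (evec n j i - evec n j (i + 1) - evec n j (i + h) + evec n j (i + h + 1))"
    unfolding KKop_def mmul_def bs ki k h[symmetric] sum_pick(1)[OF n0]
    unfolding mult.assoc power_int_add[symmetric, OF disjI1[OF qq_nonzero]]
    by (simp add: algebra_simps)
  show "KKop n (affinize n (dual_KR n 1) z) i c (evec n j) = of_bool (c = evec n j) *
     qq powi (- evec n j i + evec n j (i + 1) + evec n j (i + h) - evec n j (i + h + 1))"
    unfolding KKop_def mmul_def bs ki k h[symmetric] sum_pick(1)[OF n0]
    unfolding mult.assoc power_int_add[symmetric, OF disjI1[OF qq_nonzero]]
    by (simp add: algebra_simps)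
qed

lemma K_W_Ui_linear:
  assumes z: "z \<noteq> 0"
  shows "Ui_linear n (affinize n (KR n 1) z) (affinize n (dual_KR n 1) (inverse z)) (K_W n z)"
proof -
  have n0: "n > 0" using n by simp
  let ?M = "affinize n (KR n 1) z" and ?N = "affinize n (dual_KR n 1) (inverse z)"
  have bs: "basis ?M = comps n 1" "basis ?N = comps n 1"
    by (simp_all add: affinize_def KR_def dual_KR_def)
  have T: "K_W n z c (evec n j) = of_bool (c = evec n (j + h)) * K_w n z j" for c j
    using K_W_column[OF n0] by (simp add: h)
  have "mmul (comps n 1) (Bop n ?N i) (K_W n z) c b = mmul (comps n 1) (K_W n z) (Bop n ?M i) c b"
    if c: "c \<in> comps n 1" and b: "b \<in> comps n 1" for i b c
  proof -
    obtain j where j: "b = evec n j" using b comps_1_eq[OF n0] by auto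
    have 1: "mmul (comps n 1) (Bop n ?N i) (K_W n z) c b = Bop n ?N i c (evec n (j + h)) * K_w n z j"
      unfolding mmul_def j T by (rule sum_pick(1)[OF n0])
    have e1: "evec n (i + h + h) = evec n i"
      unfolding evec_eq_iff by (rule mod_shift_h(2))
    have e2: "i + 1 + h = i + h + 1"
      by simp
    have "mmul (comps n 1) (K_W n z) (Bop n ?M i) c b =
       (\<Sum>d\<in>comps n 1. K_W n z c d *
          (of_bool (j mod int n = i mod int n \<and> d = evec n (i + 1)) * aff_w n (inverse z) i)) +
       (\<Sum>d\<in>comps n 1. K_W n z c d *
          (of_bool (j mod int n = (i + h + 1) mod int n \<and> d = evec n (i + h)) * aff_w n z (i + h)))"
      unfolding mmul_def j sum.distrib[symmetric]
      by (rule sum.cong) (simp_all only: B_columns distrib_left)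
    also have "\<dots> = of_bool (j mod int n = i mod int n) * K_W n z c (evec n (i + 1)) * aff_w n (inverse z) i +
       of_bool (j mod int n = (i + h + 1) mod int n) * K_W n z c (evec n (i + h)) * aff_w n z (i + h)"
      unfolding sum_pick(2)[OF n0] ..
    finally have 2: "mmul (comps n 1) (K_W n z) (Bop n ?M i) c b =
       of_bool (j mod int n = i mod int n) * (of_bool (c = evec n (i + h + 1)) * K_w n z (i + 1)) * aff_w n (inverse z) i +
       of_bool (j mod int n = (i + h + 1) mod int n) * (of_bool (c = evec n i) * K_w n z (i + h)) * aff_w n z (i + h)"
      unfolding T e1 e2 .
    have m: "(j + h) mod int n = (i + 1) mod int n \<longleftrightarrow> j mod int n = (i + h + 1) mod int n"
      "(j + h) mod int n = (i + h) mod int n \<longleftrightarrow> j mod int n = i mod int n"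
      using mod_shift_h(3)[of j "i + 1"] mod_shift_h(1)[of j i] by (simp_all add: add_ac)
    have ji: "of_bool (j mod int n = k mod int n) * K_w n z j = of_bool (j mod int n = k mod int n) * K_w n z k" for k
      using K_w_cong[of j k] by auto
    have "Bop n ?N i c (evec n (j + h)) * K_w n z j =
       of_bool (c = evec n i) * aff_w n z i * (of_bool (j mod int n = (i + h + 1) mod int n) * K_w n z j) +
       of_bool (c = evec n (i + h + 1)) * aff_w n (inverse z) (i + h) * (of_bool (j mod int n = i mod int n) * K_w n z j)"
      unfolding B_columns(2)[OF c] m by (simp add: of_bool_conj algebra_simps)
    also have "\<dots> = of_bool (c = evec n i) * of_bool (j mod int n = (i + h + 1) mod int n) *
         (aff_w n z i * K_w n z (i + h + 1)) +
       of_bool (c = evec n (i + h + 1)) * of_bool (j mod int n = i mod int n) *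
         (aff_w n (inverse z) (i + h) * K_w n z i)"
      unfolding ji by (simp add: mult_ac)
    also have "\<dots> = mmul (comps n 1) (K_W n z) (Bop n ?M i) c b"
      unfolding 2 w_step[OF z, symmetric] w_step'[OF z, symmetric] by (simp add: mult_ac)
    finally show ?thesis unfolding 1 .
  qed
  moreover have "mmul (comps n 1) (KKop n ?N i) (K_W n z) c b = mmul (comps n 1) (K_W n z) (KKop n ?M i) c b"
    if b: "b \<in> comps n 1" for i b c
  proof -
    obtain j where j: "b = evec n j" using b comps_1_eq[OF n0] by auto
    have 1: "mmul (comps n 1) (KKop n ?N i) (K_W n z) c b = KKop n ?N i c (evec n (j + h)) * K_w n z j"
      unfolding mmul_def j T by (rule sum_pick(1)[OF n0])
    have 2: "mmul (comps n 1) (K_W n z) (KKop n ?M i) c b = K_W n z c (evec n j) *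
       qq powi (evec n j i - evec n j (i + 1) - evec n j (i + h) + evec n j (i + h + 1))"
      unfolding mmul_def j KK_columns by (rule sum_pick(1)[OF n0])
    have sh: "evec n (j + h) (k + h) = evec n j k" "evec n (j + h) k = evec n j (k + h)" for k
      using mod_shift_h(1)[of k j] mod_shift_h(3)[of k j] by (auto simp: evec_def)
    have sh': "evec n (j + h) (i + h + 1) = evec n j (i + 1)" "evec n j (i + 1 + h) = evec n j (i + h + 1)"
      using sh(1)[of "i + 1"] by (simp_all add: add_ac)
    have "- evec n (j + h) i + evec n (j + h) (i + 1) + evec n (j + h) (i + h) - evec n (j + h) (i + h + 1)
        = evec n j i - evec n j (i + 1) - evec n j (i + h) + evec n j (i + h + 1)"
      unfolding sh(2)[of i] sh(2)[of "i + 1"] sh(1)[of i] sh' by simp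
    then show ?thesis unfolding 1 2 KK_columns T by (simp add: mult_ac)
  qed
  ultimately show ?thesis
    unfolding Ui_linear_def intertwines_def eq_on_def bs by blast
qed

end

end

theory Submission
  imports Defs
begin

text \<open>The operators \<open>K\<^sub>1\<close> and \<open>R\<close> commute with the generators \<open>B\<^sub>i\<close> (the
  \<open>\<imath>\<close>quantum group is a coideal), hence so does their product \<open>K\<close>. The vector \<open>v\<close> with all
  \<open>s\<close> units at site \<open>1\<close> is mapped to a nonzero multiple of its analogue at site \<open>n' + 1\<close>. It generates
  \<open>W\<^sub>s\<close> under the \<open>B\<^sub>i\<close>: specialise to \<open>q = 1\<close> and let \<open>x\<close> tend to infinity along the principal
  grading, where \<open>B\<^sub>i\<close> degenerates to \<open>E\<^bsub>i+n'\<^esub>\<close>. Therefore \<open>K\<close> maps \<open>W\<^sub>s\<close> into its dual.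

  Rescale \<open>K\<close> so that its matrix entries are regular at \<open>q = \<infinity>\<close> and do not all vanish there. The leading
  terms of \<open>K B\<^sub>i = B\<^sub>i K\<close> on \<open>v\<^sub>\<alpha>\<close> with \<open>\<alpha>\<^sub>i > \<alpha>\<^bsub>i+n'\<^esub>\<close> show that the limit of the entry
  \<open>(\<gamma>, \<eta>)\<close> vanishes unless \<open>\<gamma>\<^sub>i \<ge> min \<eta>\<^bsub>i+1\<^esub> \<eta>\<^bsub>i+n'+1\<^esub>\<close> whenever
  \<open>\<eta>\<^sub>i \<ge> \<eta>\<^bsub>i+n'\<^esub>\<close>. Together with the weight condition \<open>\<gamma>\<^sub>i - \<gamma>\<^bsub>i+n'\<^esub> = \<eta>\<^bsub>i+n'\<^esub> - \<eta>\<^sub>i\<close> and the equal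
  sums of the entries this forces \<open>\<gamma> = \<eta>'\<close>. The same equations give the ratio of the entries \<open>(\<eta>', \<eta>)\<close>
  for \<open>\<alpha>\<close> with \<open>\<alpha>\<^sub>i > \<alpha>\<^bsub>i+n'\<^esub>\<close> and for its neighbour with one unit moved from \<open>i\<close> to
  \<open>i + 1\<close>. These moves connect all compositions, so the exponent of \<open>x\<close> is \<open>I\<close> up to a
  common constant.\<close>

section \<open>Values and degrees of rational functions\<close>

text \<open>K is built from an R-matrix picked by a choice operator, so only what every
  U-isomorphism satisfies may enter: it commutes with the generators, preserves weights and is
  invertible. The explicit matrix \<open>Cc\<close> shows that such an isomorphism exists, so that
  the choice has these properties. For a \<noteq> b the tensor of the dual vector at a and the
  primal vector at b spans a weight space, hence any R swaps these two up to a nonzero scalar. This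
  is why the vector concentrated at one site can be followed through K: the moving primal factor
  carries the letter 1, the dual factors it passes carry n' + 1, and equal letters never meet.

  F_i and E_{i+n'} occur in B_i only together, which obstructs a highest weight argument for
  generation. Instead a linear functional killing all generated vectors is normalised at q = 1 and
  tested against a generated vector with one dominant coordinate. Lying in the embedded dual module
  is a system of linear conditions, so it passes from the generated vectors to all of W_s; no fusion
  identity for R is used.\<close>

text \<open>\<open>place \<tau> f c\<close>: the rational function \<open>f\<close> is regular with value \<open>c\<close> when the variable
  \<open>q\<^sup>-\<^sup>1\<close> is set to \<open>\<tau>\<close>; the two places used are \<open>q = \<infinity>\<close> (\<open>\<tau> = 0\<close>) and \<open>q = 1\<close>.\<close>

definition place :: "'a::field \<Rightarrow> 'a poly fract \<Rightarrow> 'a \<Rightarrow> bool" where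
  "place \<tau> f c \<longleftrightarrow> (\<exists>a b. f = Fract a b \<and> poly b \<tau> \<noteq> 0 \<and> c = poly a \<tau> / poly b \<tau>)"

lemma placeI: "poly b \<tau> \<noteq> 0 \<Longrightarrow> place \<tau> (Fract a b) (poly a \<tau> / poly b \<tau>)"
  by (auto simp: place_def)

lemma place_unique:
  assumes "place \<tau> f c" "place \<tau> f d"
  shows "c = d"
proof -
  obtain a b where 1: "f = Fract a b" "poly b \<tau> \<noteq> 0" "c = poly a \<tau> / poly b \<tau>"
    using assms(1) by (auto simp: place_def)
  obtain a' b' where 2: "f = Fract a' b'" "poly b' \<tau> \<noteq> 0" "d = poly a' \<tau> / poly b' \<tau>"
    using assms(2) by (auto simp: place_def)
  have "b \<noteq> 0" "b' \<noteq> 0" using 1 2 by auto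
  then have "a * b' = a' * b" using 1 2 by (metis eq_fract(1))
  then have "poly a \<tau> * poly b' \<tau> = poly a' \<tau> * poly b \<tau>" by (metis poly_mult)
  then show ?thesis unfolding 1(3) 2(3) using 1(2) 2(2) by (simp add: frac_eq_eq)
qed

lemma place_const: "place \<tau> (Fract [:c:] 1) c"
  using placeI[of 1 \<tau> "[:c:]"] by simp

lemma place_0: "place \<tau> 0 0"
  using place_const[of \<tau> 0] by (simp add: Zero_fract_def)

lemma place_1: "place \<tau> 1 1"
  using placeI[of 1 \<tau> 1] by (simp add: One_fract_def)

lemma place_add:
  assumes "place \<tau> f c" "place \<tau> g d"
  shows "place \<tau> (f + g) (c + d)"
proof -
  obtain a b where 1: "f = Fract a b" "poly b \<tau> \<noteq> 0" "c = poly a \<tau> / poly b \<tau>"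
    using assms(1) by (auto simp: place_def)
  obtain a' b' where 2: "g = Fract a' b'" "poly b' \<tau> \<noteq> 0" "d = poly a' \<tau> / poly b' \<tau>"
    using assms(2) by (auto simp: place_def)
  have "b \<noteq> 0" "b' \<noteq> 0" using 1 2 by auto
  then have "f + g = Fract (a * b' + a' * b) (b * b')" using 1 2 by simp
  moreover have "place \<tau> (Fract (a * b' + a' * b) (b * b'))
      (poly (a * b' + a' * b) \<tau> / poly (b * b') \<tau>)"
    using 1 2 by (intro placeI) simp
  moreover have "poly (a * b' + a' * b) \<tau> / poly (b * b') \<tau> = c + d"
    unfolding 1(3) 2(3) using 1(2) 2(2) by (simp add: add_frac_eq)
  ultimately show ?thesis by simp
qed

lemma place_mult:
  assumes "place \<tau> f c" "place \<tau> g d"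
  shows "place \<tau> (f * g) (c * d)"
proof -
  obtain a b where 1: "f = Fract a b" "poly b \<tau> \<noteq> 0" "c = poly a \<tau> / poly b \<tau>"
    using assms(1) by (auto simp: place_def)
  obtain a' b' where 2: "g = Fract a' b'" "poly b' \<tau> \<noteq> 0" "d = poly a' \<tau> / poly b' \<tau>"
    using assms(2) by (auto simp: place_def)
  show ?thesis
    using placeI[of "b * b'" \<tau> "a * a'"] 1 2 by simp
qed

lemma place_inverse:
  assumes "place \<tau> f c" "c \<noteq> 0"
  shows "place \<tau> (inverse f) (inverse c)"
proof -
  obtain a b where 1: "f = Fract a b" "poly b \<tau> \<noteq> 0" "c = poly a \<tau> / poly b \<tau>"
    using assms(1) by (auto simp: place_def)
  with assms(2) show ?thesis
    using placeI[of a \<tau> b] by auto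
qed

lemma place_sum:
  "(\<And>x. x \<in> A \<Longrightarrow> place \<tau> (f x) (g x)) \<Longrightarrow> place \<tau> (\<Sum>x\<in>A. f x) (\<Sum>x\<in>A. g x)"
  by (induction A rule: infinite_finite_induct) (auto intro: place_0 place_add)

lemma place_power: "place \<tau> f c \<Longrightarrow> place \<tau> (f ^ k) (c ^ k)"
  by (induction k) (auto intro: place_1 place_mult)

lemma place_power_int:
  assumes "place \<tau> f c" "c \<noteq> 0"
  shows "place \<tau> (f powi k) (c powi k)"
  using place_power[OF assms(1)] place_power[OF place_inverse[OF assms]]
  by (simp add: power_int_def)

lemma place_of_bool: "place \<tau> (of_bool P) (of_bool P)"
  by (simp add: place_0 place_1)

text \<open>Splitting off all powers of the linear factor vanishing at \<open>\<tau>\<close> from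
  numerator and denominator exhibits the order of f: if it is nonnegative, f is regular, otherwise
  the inverse of f vanishes at \<open>\<tau>\<close>.\<close>

lemma place_total: "(\<exists>c. place \<tau> f c) \<or> place \<tau> (inverse f) 0"
proof -
  obtain a b where 1: "f = Fract a b" "b \<noteq> 0" by (cases f) auto
  show ?thesis
  proof (cases "a = 0")
    case True
    with 1 have "f = 0" by (simp add: fract_collapse)
    then show ?thesis using place_0 by blast
  next
    case False
    let ?l = "[:-\<tau>, 1:]"
    obtain i a' where a: "a = ?l ^ i * a'" "\<not> ?l dvd a'"
      using order_decomp[OF False] by blast
    obtain j b' where b: "b = ?l ^ j * b'" "\<not> ?l dvd b'"
      using order_decomp[OF 1(2)] by blast
    have nz: "poly a' \<tau> \<noteq> 0" "poly b' \<tau> \<noteq> 0" "a' \<noteq> 0" "b' \<noteq> 0"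
      using a(2) b(2) by (auto simp: poly_eq_0_iff_dvd)
    show ?thesis
    proof (cases "i \<ge> j")
      case True
      then obtain k where k: "i = j + k" using le_Suc_ex by blast
      have "a * b' = ?l ^ k * a' * b"
        unfolding a(1) b(1) k power_add by (simp only: mult_ac)
      then have "f = Fract (?l ^ k * a') b'"
        unfolding 1(1) eq_fract(1)[OF 1(2) nz(4)] .
      then show ?thesis using placeI[OF nz(2)] by blast
    next
      case False
      then obtain k where k: "j = i + Suc k"
        by (metis less_iff_Suc_add add_Suc_right not_le)
      have "b * a' = ?l ^ Suc k * b' * a"
        unfolding a(1) b(1) k power_add by (simp only: mult_ac)
      then have "inverse f = Fract (?l ^ Suc k * b') a'"
        unfolding 1(1) inverse_fract eq_fract(1)[OF \<open>a \<noteq> 0\<close> nz(3)] .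
      moreover have "poly (?l ^ Suc k * b') \<tau> = 0" by simp
      ultimately show ?thesis using placeI[OF nz(1), of "?l ^ Suc k * b'"] by simp
    qed
  qed
qed

text \<open>An entry of smallest order at \<open>\<tau>\<close> serves as \<open>y\<close>. Its own
  quotient is 1, so the normalised family is regular but does not vanish identically at the place.
  This is used at q = 1 for a linear functional and at q = infinity for the entries of K.\<close>

lemma place_normalize:
  assumes "finite A" "\<exists>x\<in>A. F x \<noteq> 0"
  shows "\<exists>y\<in>A. F y \<noteq> 0 \<and> (\<forall>x\<in>A. \<exists>c. place \<tau> (F x / F y) c)"
  using assms
proof (induction A rule: finite_induct)
  case (insert x A)
  show ?case
  proof (cases "\<exists>x\<in>A. F x \<noteq> 0")
    case False
    then have 0: "F x \<noteq> 0" "\<forall>z\<in>A. F z = 0" using insert by auto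
    then have "\<exists>c. place \<tau> (F z / F x) c" if "z \<in> insert x A" for z
      using that place_1 place_0 by (cases "z = x") auto
    then show ?thesis using 0 by blast
  next
    case True
    then obtain y where y: "y \<in> A" "F y \<noteq> 0" "\<forall>x\<in>A. \<exists>c. place \<tau> (F x / F y) c"
      using insert by blast
    show ?thesis
    proof (cases "\<exists>c. place \<tau> (F x / F y) c")
      case True
      then show ?thesis using y by blast
    next
      case False
      then have p: "place \<tau> (F y / F x) 0"
        using place_total[of \<tau> "F x / F y"] by simp
      have x0: "F x \<noteq> 0" using False place_0 by fastforce
      have "\<exists>c. place \<tau> (F z / F x) c" if "z \<in> insert x A" for z
      proof (cases "z = x")
        case True
        then show ?thesis using x0 place_1 by auto
      next
        case False
        then have "z \<in> A" using that by simp
        then obtain c where "place \<tau> (F z / F y) c" using y(3) by blast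
        from place_mult[OF this p] have "place \<tau> (F z / F x) (c * 0)"
          using y(2) by simp
        then show ?thesis by (rule exI)
      qed
      then show ?thesis using x0 by blast
    qed
  qed
qed simp

lemma place_nonzero: "place \<tau> f c \<Longrightarrow> c \<noteq> 0 \<Longrightarrow> f \<noteq> 0"
  using place_unique place_0 by blast

section \<open>Regularity at q = infinity and the ring \<open>A_x\<close>\<close>

lemma place_0_expands:
  assumes "place 0 f c"
  shows "\<exists>g. expands f g \<and> fps_nth g 0 = c"
proof -
  obtain a b where 1: "f = Fract a b" "poly b 0 \<noteq> 0" "c = poly a 0 / poly b 0"
    using assms(1) by (auto simp: place_def)
  let ?g = "fps_of_poly a / fps_of_poly b"
  have b0: "fps_nth (fps_of_poly b) 0 \<noteq> 0" using 1 by (simp add: poly_0_coeff_0)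
  then have eq: "?g = fps_of_poly a * inverse (fps_of_poly b)"
    by (rule fps_divide_unit)
  have "fps_of_poly b * ?g = fps_of_poly a * (inverse (fps_of_poly b) * fps_of_poly b)"
    unfolding eq by (simp only: mult_ac)
  also have "\<dots> = fps_of_poly a"
    using inverse_mult_eq_1[OF b0] by simp
  finally have "fps_of_poly b * ?g = fps_of_poly a" .
  moreover have "b \<noteq> 0" using 1 by auto
  ultimately have "expands f ?g" unfolding expands_def using 1 by blast
  moreover have "fps_nth ?g 0 = c"
    unfolding eq using 1 by (simp add: poly_0_coeff_0 divide_inverse)
  ultimately show ?thesis by blast
qed

text \<open>By \<open>key\<close> the power series equation holds for every fraction representing f.
  If f had a pole at 0, it could be written with a denominator vanishing at 0 and a numerator that
  does not, and comparing constant coefficients would give 0 on one side only.\<close>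

lemma expands_place_0:
  assumes "expands f g"
  shows "place 0 f (fps_nth g 0)"
proof -
  obtain a b where ab: "b \<noteq> 0" "f = Fract a b" "fps_of_poly b * g = fps_of_poly a"
    using assms by (auto simp: expands_def)
  have key: "fps_of_poly b' * g = fps_of_poly a'" if f: "f = Fract a' b'" and b': "b' \<noteq> 0" for a' b'
  proof -
    have "a * b' = a' * b" using f ab b' by (metis eq_fract(1))
    then have "fps_of_poly b * (fps_of_poly b' * g) = fps_of_poly b * fps_of_poly a'"
      using ab(3) by (metis (no_types, lifting) fps_of_poly_mult mult.assoc mult.commute)
    then show ?thesis using ab(1) by simp
  qed
  show ?thesis
  proof (cases "\<exists>c. place 0 f c")
    case True
    then obtain a' b' where 1: "f = Fract a' b'" "poly b' 0 \<noteq> 0" by (auto simp: place_def)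
    then have "fps_of_poly b' * g = fps_of_poly a'" using key[of a' b'] by fastforce
    then have "fps_nth (fps_of_poly b' * g) 0 = fps_nth (fps_of_poly a') 0" by simp
    then have "fps_nth g 0 = poly a' 0 / poly b' 0"
      using 1 by (simp add: poly_0_coeff_0 field_simps)
    then show ?thesis using 1 by (auto simp: place_def)
  next
    case False
    then have p: "place 0 (inverse f) 0" using place_total by blast
    then obtain a' b' where 1: "inverse f = Fract a' b'" "poly b' 0 \<noteq> 0" "poly a' 0 = 0"
      by (auto simp: place_def)
    have f0: "f \<noteq> 0" using False place_0 by auto
    then have a0: "a' \<noteq> 0" using 1 by (auto simp: fract_collapse)
    have "f = Fract b' a'" using 1(1) by (metis inverse_fract inverse_inverse_eq)
    then have "fps_of_poly a' * g = fps_of_poly b'" using key a0 by blast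
    then have "fps_nth (fps_of_poly a' * g) 0 = fps_nth (fps_of_poly b') 0" by simp
    then show ?thesis using 1 by (simp add: poly_0_coeff_0)
  qed
qed

lemma A_x_iff: "f \<in> A_x \<longleftrightarrow> (\<exists>c. place 0 f c)"
  unfolding A_x_def using place_0_expands expands_place_0 by blast

lemma mod_qinv_eq: "place 0 f c \<Longrightarrow> mod_qinv f = c"
  unfolding mod_qinv_def
  using place_0_expands expands_place_0 place_unique by (intro the_equality) blast+

section \<open>The degree in x of a rational function\<close>

definition rdeg :: "'a::field poly fract \<Rightarrow> int" where
  "rdeg f = (THE k. \<exists>a b. a \<noteq> 0 \<and> b \<noteq> 0 \<and> f = Fract a b \<and> k = int (degree a) - int (degree b))"

lemma rdeg_Fract:
  assumes "a \<noteq> 0" "b \<noteq> 0"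
  shows "rdeg (Fract a b) = int (degree a) - int (degree b)"
  unfolding rdeg_def
proof (rule the_equality)
  fix k assume "\<exists>a' b'. a' \<noteq> 0 \<and> b' \<noteq> 0 \<and> Fract a b = Fract a' b' \<and> k = int (degree a') - int (degree b')"
  then obtain a' b' where 1: "a' \<noteq> 0" "b' \<noteq> 0" "Fract a b = Fract a' b'"
    "k = int (degree a') - int (degree b')" by blast
  then have "a * b' = a' * b" using assms by (simp add: eq_fract)
  then have "degree (a * b') = degree (a' * b)" by simp
  then show "k = int (degree a) - int (degree b)" using 1 assms by (simp add: degree_mult_eq)
qed (use assms in blast)

lemma Fract_cases_nonzero:
  assumes "f \<noteq> (0 :: 'a::idom fract)"
  obtains a b where "f = Fract a b" "a \<noteq> 0" "b \<noteq> 0"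
proof -
  obtain a b where 1: "f = Fract a b" "b \<noteq> 0" by (cases f) auto
  with assms have "a \<noteq> 0" by (auto simp: fract_collapse)
  with 1 that show thesis by blast
qed

lemma rdeg_mult: "f \<noteq> 0 \<Longrightarrow> g \<noteq> 0 \<Longrightarrow> rdeg (f * g) = rdeg f + rdeg g"
  by (elim Fract_cases_nonzero) (simp add: rdeg_Fract degree_mult_eq)

text \<open>The function 0 counts as having degree minus infinity; \<open>rdeg\<close> itself
  carries no information at 0.\<close>

definition rdeg_le :: "'a::field poly fract \<Rightarrow> int \<Rightarrow> bool" where
  "rdeg_le f k \<longleftrightarrow> f = 0 \<or> rdeg f \<le> k"

lemma rdeg_le_add:
  assumes "rdeg_le f k" "rdeg_le g k"
  shows "rdeg_le (f + g) k"
proof (cases "f = 0 \<or> g = 0 \<or> f + g = 0")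
  case False
  then obtain a b c d where 1: "f = Fract a b" "a \<noteq> 0" "b \<noteq> 0" "g = Fract c d" "c \<noteq> 0" "d \<noteq> 0"
    by (metis Fract_cases_nonzero)
  then have s: "f + g = Fract (a * d + c * b) (b * d)" by simp
  have nz: "a * d + c * b \<noteq> 0" using False s by (auto simp: fract_collapse)
  have "degree (a * d + c * b) \<le> max (degree (a * d)) (degree (c * b))"
    by (rule degree_add_le_max)
  also have "\<dots> = max (degree a + degree d) (degree c + degree b)"
    using 1 by (simp add: degree_mult_eq)
  finally show ?thesis
    using assms False 1 s nz by (simp add: rdeg_le_def rdeg_Fract degree_mult_eq)
qed (use assms in \<open>auto simp: rdeg_le_def\<close>)

lemma rdeg_le_sum: "(\<And>x. x \<in> A \<Longrightarrow> rdeg_le (f x) k) \<Longrightarrow> rdeg_le (\<Sum>x\<in>A. f x) k"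
  by (induction A rule: infinite_finite_induct) (auto simp: rdeg_le_def[of 0] intro: rdeg_le_add)

lemma rdeg_uminus: "rdeg (- f) = rdeg f"
proof (cases "f = 0")
  case False
  then obtain a b where "f = Fract a b" "a \<noteq> 0" "b \<noteq> 0" by (rule Fract_cases_nonzero)
  then show ?thesis by (simp add: rdeg_Fract)
qed simp

text \<open>A summand of strictly larger degree cannot be cancelled. Both non-vanishing steps of the
  generation argument rest on this.\<close>

lemma rdeg_dominant:
  assumes "f \<noteq> 0" "rdeg_le g (rdeg f - 1)"
  shows "f + g \<noteq> 0" "rdeg (f + g) = rdeg f"
proof -
  show nz: "f + g \<noteq> 0"
  proof
    assume "f + g = 0"
    then have "g = - f" by (simp add: add_eq_0_iff)
    with assms show False by (simp add: rdeg_le_def rdeg_uminus)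
  qed
  have "rdeg_le (f + g) (rdeg f)"
    using assms by (intro rdeg_le_add) (auto simp: rdeg_le_def)
  moreover have "\<not> rdeg (f + g) \<le> rdeg f - 1"
  proof
    assume that: "rdeg (f + g) \<le> rdeg f - 1"
    have "rdeg_le (f + g + (- g)) (rdeg f - 1)"
      by (rule rdeg_le_add) (use that assms in \<open>auto simp: rdeg_le_def rdeg_uminus\<close>)
    then have "rdeg_le f (rdeg f - 1)" by simp
    then show False using assms(1) unfolding rdeg_le_def by linarith
  qed
  ultimately show "rdeg (f + g) = rdeg f" using nz unfolding rdeg_le_def by linarith
qed

section \<open>Values of powers of q and x and of quantum integers at the two places\<close>

lemma rat_x_nonzero: "rat_x \<noteq> 0"
  by (simp add: rat_x_def Zero_fract_def eq_fract)

lemma of_nat_fract: "of_nat k = Fract (of_nat k) (1 :: 'a::idom)"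
  by (induction k) (simp_all add: Zero_fract_def One_fract_def)

lemma of_int_fract: "of_int k = Fract (of_int k) (1 :: 'a::idom)"
  by (cases k) (simp_all add: of_nat_fract One_fract_def)

lemma of_int_ratx_nonzero: "k \<noteq> 0 \<Longrightarrow> of_int k \<noteq> (0 :: ratx)"
  by (simp add: of_int_fract eq_fract Zero_fract_def of_int_poly)

lemma rdeg_of_int: "k \<noteq> 0 \<Longrightarrow> rdeg (of_int k :: ratx) = 0"
  by (simp add: of_int_fract rdeg_Fract of_int_poly)

lemma rdeg_rat_x: "rdeg rat_x = 1"
  by (simp add: rat_x_def rdeg_Fract)

lemma rdeg_inverse_rat_x: "rdeg (inverse rat_x) = -1"
  by (simp add: rat_x_def rdeg_Fract)

lemma place_inverse_qq: "place \<tau> (inverse qq) \<tau>"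
  using placeI[of 1 \<tau> "[:0, 1:]"] by (simp add: qq_def)

lemma place_1_qq_powi: "place 1 (qq powi k) 1"
  using place_power_int[OF place_inverse[OF place_inverse_qq[of 1]], of k] by simp

lemma place_0_qq_powi:
  assumes "k \<le> 0"
  shows "place 0 (qq powi k) (of_bool (k = 0))"
proof -
  have "qq powi k = inverse qq ^ nat (- k)"
    using assms by (auto simp: power_int_def)
  moreover have "(0 :: ratx) ^ nat (- k) = of_bool (k = 0)"
    using assms by (simp add: power_0_left)
  ultimately show ?thesis
    using place_power[OF place_inverse_qq[of 0], of "nat (- k)"] by (simp only:)
qed

lemma place_xx: "place \<tau> xx rat_x"
  unfolding xx_def by (rule place_const)

lemma xx_nonzero: "xx \<noteq> 0"
  using place_nonzero[OF place_xx rat_x_nonzero] .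

lemma place_xx_powi: "place \<tau> (xx powi k) (rat_x powi k)"
  by (rule place_power_int[OF place_xx rat_x_nonzero])

lemma qq_diff_nonzero: "qq - inverse qq \<noteq> 0"
  using qint_1 by (auto simp: qint_def)

lemma qint_0: "qint 0 = 0"
  by (simp add: qint_def)

lemma qq_powi_add: "qq powi (a + b) = qq powi a * qq powi b"
  using qq_nonzero by (simp add: power_int_add)

text \<open>When E_i or F_i is computed letter by letter, the contributions of the first letter and
  of the tail add up by one of these recursions: the second one for E_i, the first one for
  F_i.\<close>

lemma qint_Suc: "qint (m + 1) = qq powi m + qq powi (-1) * qint m"
  and qint_Suc': "qint (m + 1) = qq powi (- m) + qq powi 1 * qint m"
proof -
  let ?a = "qq powi m" and ?b = "qq powi (- m)" and ?d = "qq - inverse qq"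
  have p: "qq powi (m + 1) = ?a * qq" "qq powi (- (m + 1)) = ?b * inverse qq"
    "qq powi (-1) = inverse qq" "qq powi 1 = qq"
    using qq_powi_add[of m 1] qq_powi_add[of "- m" "-1"] by (simp_all add: power_int_minus)
  have "?a * qq - ?b * inverse qq = ?a * ?d + inverse qq * (?a - ?b)"
    by (simp add: algebra_simps)
  then show "qint (m + 1) = qq powi m + qq powi (-1) * qint m"
    unfolding qint_def p using qq_diff_nonzero by (simp add: add_divide_distrib)
  have "?a * qq - ?b * inverse qq = ?b * ?d + qq * (?a - ?b)"
    by (simp add: algebra_simps)
  then show "qint (m + 1) = qq powi (- m) + qq powi 1 * qint m"
    unfolding qint_def p using qq_diff_nonzero by (simp add: add_divide_distrib)
qed

lemma place_1_qint: "m \<ge> 0 \<Longrightarrow> place 1 (qint m) (of_int m)"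
proof (induction m rule: int_ge_induct)
  case base
  then show ?case by (simp add: qint_0 place_0)
next
  case (step i)
  have "place 1 (qint (i + 1)) (1 + 1 * of_int i)"
    unfolding qint_Suc by (intro place_add place_mult place_1_qq_powi step.IH)
  then show ?case by (simp add: add.commute)
qed

text \<open>The quantum integer [m+1] = q^m + q^(m-2) + ... + q^(-m) is dominated by q^m.\<close>

lemma place_0_qint:
  assumes "m \<ge> 0"
  shows "place 0 (qq powi (- m) * qint (m + 1)) 1"
  using assms
proof (induction m rule: int_ge_induct)
  case base
  then show ?case using qint_1 place_1 by simp
next
  case (step i)
  have "qq powi (- (i + 1)) * qint (i + 1 + 1) =
      qq powi (- (i + 1)) * qq powi (i + 1) + qq powi (- (i + 1)) * (qq powi (-1) * qint (i + 1))"
    unfolding qint_Suc[of "i + 1"] by (rule distrib_left)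
  also have "qq powi (- (i + 1)) * qq powi (i + 1) = 1"
    unfolding qq_powi_add[symmetric] by simp
  also have "qq powi (- (i + 1)) * (qq powi (-1) * qint (i + 1)) = qq powi (-2) * (qq powi (- i) * qint (i + 1))"
    unfolding mult.assoc[symmetric] qq_powi_add[symmetric] by simp
  finally have "qq powi (- (i + 1)) * qint (i + 1 + 1) = 1 + qq powi (-2) * (qq powi (- i) * qint (i + 1))" .
  moreover have "place 0 (1 + qq powi (-2) * (qq powi (- i) * qint (i + 1))) (1 + of_bool ((-2::int) = 0) * 1)"
    by (intro place_add place_mult place_1 place_0_qq_powi step.IH) simp
  ultimately show ?case by simp
qed

lemma aff_w_powi: "aff_w n xx i = xx powi (of_bool (i mod int n = 0))"
  "aff_w n (inverse xx) i = xx powi (- of_bool (i mod int n = 0))"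
  by (auto simp: aff_w_def power_int_minus)

lemma evec_nonneg: "evec n i k \<ge> 0" "evec n i k \<le> 1"
  by (simp_all add: evec_def)

lemma comps_nonneg: "\<alpha> \<in> comps n s \<Longrightarrow> \<alpha> i \<ge> 0"
  by (simp add: comps_def)

lemma comps_mod: "\<alpha> \<in> comps n s \<Longrightarrow> i mod int n = j mod int n \<Longrightarrow> \<alpha> i = \<alpha> j"
  by (rule periodic_mod) (auto simp: comps_def)

lemma sum_periodic:
  fixes f :: "int \<Rightarrow> int"
  assumes per: "\<And>i. f (i + int n) = f i" and n: "n > 0"
  shows "sum f {a..<a + int n} = sum f {1..int n}"
proof -
  have step: "sum f {a..<a + int n} = sum f {a + 1..<a + 1 + int n}" for a
  proof -
    have "{a..<a + int n} = insert a {a + 1..<a + int n}"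
      "{a + 1..<a + 1 + int n} = insert (a + int n) {a + 1..<a + int n}" using n by auto
    then show ?thesis using per[of a] by simp
  qed
  have "sum f {a..<a + int n} = sum f {1..<1 + int n}" for a
  proof (induction a rule: int_induct[of _ 1])
    case (step1 i)
    then show ?case using step[of i] by simp
  next
    case (step2 i)
    then show ?case using step[of "i - 1"] by simp
  qed simp
  moreover have "{1..<1 + int n} = {1..int n}" by auto
  ultimately show ?thesis by simp
qed

lemma sum_periodic_shift:
  fixes f :: "int \<Rightarrow> int"
  assumes per: "\<And>i. f (i + int n) = f i" and n: "n > 0"
  shows "(\<Sum>i=1..int n. f (i + d)) = sum f {1..int n}"
proof -
  have "(\<Sum>i=1..int n. f (i + d)) = sum f {1 + d..<1 + d + int n}"
    by (rule sum.reindex_bij_witness[of _ "\<lambda>i. i - d" "\<lambda>i. i + d"]) auto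
  then show ?thesis using sum_periodic[of f, OF per n] by simp
qed

lemma sum_mult_evec:
  assumes "j \<in> {a..<a + int n}"
  shows "(\<Sum>k\<in>{a..<a + int n}. f k * evec n j k) = f j"
proof -
  have "(k mod int n = j mod int n) = (k = j)" if "k \<in> {a..<a + int n}" for k
    using assms that mod_1_n_eq[of "k - a + 1" "int n" "j - a + 1"] by (auto simp: mod_eq_dvd_iff)
  then have "(\<Sum>k\<in>{a..<a + int n}. f k * evec n j k) = (\<Sum>k\<in>{a..<a + int n}. if k = j then f j else 0)"
    by (intro sum.cong) (auto simp: evec_def)
  then show ?thesis using assms by simp
qed

lemma sum_comps:
  assumes "\<alpha> \<in> comps n s" "n > 0"
  shows "sum \<alpha> {a..<a + int n} = int s"
  using sum_periodic[of \<alpha>] assms by (auto simp: comps_def)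

section \<open>Moves on compositions\<close>

text \<open>The first index receives the unit, the second one gives it up. The result may have a
  negative entry and then lies outside \<open>comps\<close>.\<close>

definition mv :: "nat \<Rightarrow> int \<Rightarrow> int \<Rightarrow> comp \<Rightarrow> comp" where
  "mv n i j \<alpha> = (\<lambda>k. \<alpha> k + evec n i k - evec n j k)"

lemma mv_comps_iff:
  assumes \<alpha>: "\<alpha> \<in> comps n s" and n: "n > 0"
  shows "mv n i j \<alpha> \<in> comps n s \<longleftrightarrow> \<alpha> j \<ge> 1 \<or> i mod int n = j mod int n"
proof (cases "i mod int n = j mod int n")
  case True
  then have "mv n i j \<alpha> = \<alpha>" using evec_eq_iff[of n i j] by (auto simp: mv_def)
  then show ?thesis using True \<alpha> by simp
next
  case False
  have per: "mv n i j \<alpha> (k + int n) = mv n i j \<alpha> k" for k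
    using \<alpha> by (simp add: mv_def evec_def comps_def)
  have "evec n i \<in> comps n 1" "evec n j \<in> comps n 1" using evec_in_comps[OF n] by auto
  then have sm: "(\<Sum>k=1..int n. mv n i j \<alpha> k) = int s"
    using \<alpha> by (simp add: mv_def comps_def sum.distrib sum_subtractf)
  show ?thesis
  proof
    assume "mv n i j \<alpha> \<in> comps n s"
    from comps_nonneg[OF this, of j] show "\<alpha> j \<ge> 1 \<or> i mod int n = j mod int n"
      using False by (simp add: mv_def evec_def)
  next
    assume "\<alpha> j \<ge> 1 \<or> i mod int n = j mod int n"
    with False have "\<alpha> j \<ge> 1" by simp
    then have "\<alpha> k \<ge> 1" if "k mod int n = j mod int n" for k using comps_mod[OF \<alpha> that] by simp
    then have "mv n i j \<alpha> k \<ge> 0" for k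
      using comps_nonneg[OF \<alpha>, of k] by (auto simp: mv_def evec_def)
    then show "mv n i j \<alpha> \<in> comps n s" using per sm by (simp add: comps_def)
  qed
qed

lemma mv_inverse: "mv n i j (mv n j i \<alpha>) = \<alpha>"
  by (simp add: mv_def)

lemma mv_cong: "i mod int n = i' mod int n \<Longrightarrow> j mod int n = j' mod int n \<Longrightarrow> mv n i j = mv n i' j'"
  using evec_eq_iff[of n i i'] evec_eq_iff[of n j j'] by (auto simp: mv_def fun_eq_iff)

lemma finite_comps:
  assumes n: "n > 0"
  shows "finite (comps n s)"
proof (rule finite_imageD)
  let ?r = "\<lambda>\<alpha>. restrict \<alpha> {1..int n}"
  have "?r ` comps n s \<subseteq> {1..int n} \<rightarrow>\<^sub>E {0..int s}"
  proof safe
    fix \<alpha> i assume \<alpha>: "\<alpha> \<in> comps n s" and i: "i \<in> {1..int n}"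
    then have "\<alpha> i \<le> (\<Sum>i=1..int n. \<alpha> i)" by (intro member_le_sum) (auto simp: comps_def)
    then show "?r \<alpha> i \<in> {0..int s}" using \<alpha> i by (auto simp: comps_def)
  qed auto
  then show "finite (?r ` comps n s)" by (rule finite_subset) (intro finite_PiE; simp)
  show "inj_on ?r (comps n s)"
  proof (rule inj_onI, rule ext)
    fix \<alpha> \<beta> k assume ab: "\<alpha> \<in> comps n s" "\<beta> \<in> comps n s" "?r \<alpha> = ?r \<beta>"
    have r: "(k - 1) mod int n + 1 \<in> {1..int n}" "((k - 1) mod int n + 1) mod int n = k mod int n"
      using rep_1_n[of "int n" k] n by simp_all
    from fun_cong[OF ab(3), of "(k - 1) mod int n + 1"] r(1)
    have "\<alpha> ((k - 1) mod int n + 1) = \<beta> ((k - 1) mod int n + 1)" by simp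
    then show "\<alpha> k = \<beta> k" using comps_mod[OF ab(1) r(2)] comps_mod[OF ab(2) r(2)] by simp
  qed
qed

definition conc :: "nat \<Rightarrow> nat \<Rightarrow> int \<Rightarrow> comp" where
  "conc n s i = (\<lambda>k. int s * evec n i k)"

lemma conc_comps: "n > 0 \<Longrightarrow> conc n s i \<in> comps n s"
  using evec_in_comps[of n i] by (auto simp: conc_def comps_def sum_distrib_left[symmetric])

text \<open>Here \<open>h\<close> is n' as an integer; i and i + h are opposite sites of the cycle
  of length n.\<close>

locale even_rank =
  fixes n :: nat and h :: int
  assumes n4: "n \<ge> 4" and nh: "int n = 2 * h"
begin

lemma n0: "n > 0" and h2: "h \<ge> 2" using n4 nh by auto

lemma shift_hh: "\<alpha> \<in> comps n s \<Longrightarrow> \<alpha> (i + h + h) = \<alpha> i"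
  using comps_mod[of \<alpha> n s "i + h + h" i] nh by (simp add: add.assoc mult_2[symmetric])

lemma not_dvd:
  assumes "k \<noteq> 0" "\<bar>k\<bar> < int n"
  shows "\<not> int n dvd k"
proof
  assume "int n dvd k"
  from dvd_imp_le_int[OF assms(1) this] assms(2) show False by simp
qed

text \<open>All units are brought to site i along edges, by induction on their total distance from
  i. Read forwards, an edge moves a unit from j to j + 1 if the entry at j exceeds the opposite one;
  read backwards (\<open>rev\<close>), it moves a unit from j + 1 to j if the entry at j is at least
  the opposite one. Units in i+1..i+h travel down to i, the others travel up to i + n. The point is
  that some unit can always make such a step.\<close>

lemma connected_conc:
  assumes edge: "\<And>\<alpha> i. \<alpha> \<in> comps n s \<Longrightarrow> \<alpha> i > \<alpha> (i + h) \<Longrightarrow> Q \<alpha> \<longleftrightarrow> Q (mv n (i + 1) i \<alpha>)"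
    and Qi: "Q (conc n s i)"
    and "\<eta> \<in> comps n s" "\<eta> i \<ge> \<eta> (i + h)"
  shows "Q \<eta>"
proof -
  have rev: "Q \<eta> \<longleftrightarrow> Q (mv n j (j + 1) \<eta>)"
    if "\<eta> \<in> comps n s" "\<eta> j \<ge> \<eta> (j + h)" "\<eta> (j + 1) \<ge> 1" for \<eta> j
  proof -
    have e: "evec n j j = 1" "evec n j (j + h) = 0" "evec n (j + 1) j = 0"
      using not_dvd[of h] not_dvd[of "-1"] h2 nh by (auto simp: evec_def mod_eq_dvd_iff)
    have "mv n j (j + 1) \<eta> \<in> comps n s" using that mv_comps_iff[OF that(1) n0] by blast
    moreover have "mv n j (j + 1) \<eta> j > mv n j (j + 1) \<eta> (j + h)"
      using that e evec_nonneg(1)[of n "j + 1" "j + h"] by (simp add: mv_def)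
    ultimately show ?thesis using edge[of "mv n j (j + 1) \<eta>" j] by (simp add: mv_inverse)
  qed
  \<comment> \<open>The distance from i on the cycle, for a site i + d with 0 \<le> d < n.\<close>
  define w where "w d = (if d \<le> h then d else int n - d)" for d
  define D where "D \<eta> = (\<Sum>k\<in>{i..<i + int n}. w (k - i) * \<eta> k)" for \<eta> :: comp
  have D_mv: "D (mv n a b \<eta>) = D \<eta> + w (a - i) - w (b - i)"
    if "a \<in> {i..<i + int n}" "b \<in> {i..<i + int n}" for a b \<eta>
    using sum_mult_evec[OF that(1), of "\<lambda>k. w (k - i)"] sum_mult_evec[OF that(2), of "\<lambda>k. w (k - i)"]
    by (simp add: D_def mv_def algebra_simps sum.distrib sum_subtractf)
  have D_nonneg: "D \<eta> \<ge> 0" if "\<eta> \<in> comps n s" for \<eta>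
    unfolding D_def using comps_nonneg[OF that] by (intro sum_nonneg) (auto simp: w_def)
  from assms(3,4) show ?thesis
  proof (induction "nat (D \<eta>)" arbitrary: \<eta> rule: less_induct)
    case less
    note \<eta> = less.prems(1) and \<eta>i = less.prems(2)
    have per: "\<eta> (k + int n) = \<eta> k" for k using \<eta> by (simp add: comps_def)
    \<comment> \<open>No unit is put on i + h and none is taken from i, so the hypothesis that the
      entry at i is at least the one at i + h survives the move.\<close>
    have IH: "Q (mv n a b \<eta>)" if "a \<in> {i..<i + int n}" "b \<in> {i..<i + int n}" "w (a - i) < w (b - i)"
      "\<eta> b \<ge> 1" "a \<noteq> i + h" for a b
    proof (rule less.hyps)
      have m: "mv n a b \<eta> \<in> comps n s" using that mv_comps_iff[OF \<eta> n0] by blast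
      then show "mv n a b \<eta> \<in> comps n s" .
      show "nat (D (mv n a b \<eta>)) < nat (D \<eta>)"
        using D_nonneg[OF m] D_mv[OF that(1,2), of \<eta>] that(3) by simp
      have "b \<noteq> i"
        using that nh h2 by (auto simp: w_def split: if_splits)
      then have "i - b \<noteq> 0" "\<bar>i - b\<bar> < int n" "i + h - a \<noteq> 0" "\<bar>i + h - a\<bar> < int n"
        using that nh h2 by auto
      then have "evec n a (i + h) = 0" "evec n b i = 0"
        using not_dvd[of "i + h - a"] not_dvd[of "i - b"] by (auto simp: evec_def mod_eq_dvd_iff)
      then show "mv n a b \<eta> (i + h) \<le> mv n a b \<eta> i"
        using \<eta>i evec_nonneg(1)[of n a i] evec_nonneg(1)[of n b "i + h"] by (simp add: mv_def)
    qed
    have left: "Q \<eta>" if "j \<in> {i<..i + h}" "\<eta> j \<ge> 1" "\<eta> (j - 1) \<ge> \<eta> (j - 1 + h)" for j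
    proof -
      have "Q (mv n (j - 1) j \<eta>)"
        using that nh h2 by (intro IH) (auto simp: w_def)
      then show ?thesis using rev[OF \<eta>, of "j - 1"] that by simp
    qed
    have right: "Q \<eta>" if "k \<in> {i + h<..<i + int n}" "\<eta> k \<ge> 1" "\<eta> (k - h) = 0" for k
    proof -
      have "\<eta> (k + h) = \<eta> (k - h)"
        using per[of "k - h"] nh by (simp add: algebra_simps)
      then have e: "Q \<eta> \<longleftrightarrow> Q (mv n (k + 1) k \<eta>)" using edge[OF \<eta>, of k] that by simp
      have "Q (mv n (if k + 1 = i + int n then i else k + 1) k \<eta>)"
        using that nh h2 by (intro IH) (auto simp: w_def)
      moreover have "mv n (k + 1) k = mv n (if k + 1 = i + int n then i else k + 1) k"
        by (rule mv_cong) auto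
      ultimately show ?thesis using e by simp
    qed
    show ?case
    proof (cases "\<exists>j\<in>{i<..i + h}. \<eta> j \<ge> 1")
      case True

      \<comment> \<open>The occupied site j closest to i in i+1..i+h is selected. If its unit cannot
        step down because the site opposite to the empty j - 1 is occupied, then a unit of that
        opposite site can step up instead. For j = i + 1 the hypothesis on the entries at i and i +
        h allows the step down.\<close>
      define P where "P d \<longleftrightarrow> int d \<in> {1..h} \<and> \<eta> (i + int d) \<ge> 1" for d
      from True obtain j0 where j0: "j0 \<in> {i<..i + h}" "\<eta> j0 \<ge> 1" by blast
      then have "P (nat (j0 - i))" by (simp add: P_def)
      then obtain d where d: "P d" "\<And>d'. d' < d \<Longrightarrow> \<not> P d'"
        by (metis LeastI not_less_Least)
      define j where "j = i + int d"
      have j: "j \<in> {i<..i + h}" "\<eta> j \<ge> 1" using d(1) by (auto simp: P_def j_def)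
      show ?thesis
      proof (cases "d = 1")
        case True
        then show ?thesis using left[OF j] \<eta>i by (simp add: j_def)
      next
        case False
        have d1: "d \<ge> 1" "int d \<le> h" using d(1) by (auto simp: P_def)
        have "\<not> P (d - 1)" using d(2)[of "d - 1"] d1 by simp
        moreover have "int (d - 1) \<in> {1..h}" "i + int (d - 1) = j - 1"
          using d1 False by (auto simp: j_def of_nat_diff)
        ultimately have "\<not> \<eta> (j - 1) \<ge> 1" unfolding P_def by metis
        then have z: "\<eta> (j - 1) = 0" using comps_nonneg[OF \<eta>, of "j - 1"] by linarith
        show ?thesis
        proof (cases "\<eta> (j - 1 + h) = 0")
          case True
          then show ?thesis using left[OF j] z by simp
        next
          case False2: False
          then have "\<eta> (j - 1 + h) \<ge> 1" using comps_nonneg[OF \<eta>, of "j - 1 + h"] by simp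
          moreover have "j - 1 + h \<in> {i + h<..<i + int n}"
            using j False nh d(1) by (auto simp: j_def P_def)
          ultimately show ?thesis using right[of "j - 1 + h"] z by simp
        qed
      qed
    next
      case False
      have z: "\<eta> j = 0" if "j \<in> {i<..i + h}" for j
      proof -
        have "\<not> \<eta> j \<ge> 1" using that False by blast
        then show ?thesis using comps_nonneg[OF \<eta>, of j] by linarith
      qed
      show ?thesis
      proof (cases "\<exists>k\<in>{i + h<..<i + int n}. \<eta> k \<ge> 1")
        case True
        then obtain k where k: "k \<in> {i + h<..<i + int n}" "\<eta> k \<ge> 1" by blast
        then show ?thesis using right[OF k] z[of "k - h"] nh by simp
      next
        case False
        have z': "\<eta> j = 0" if "j \<in> {i<..<i + int n}" for j
        proof (cases "j \<le> i + h")
          case True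
          then show ?thesis using that z by simp
        next
          case F: False
          then have "\<not> \<eta> j \<ge> 1" using that False by (metis greaterThanLessThan_iff not_le)
          then show ?thesis using comps_nonneg[OF \<eta>, of j] by linarith
        qed
        have "{i..<i + int n} = insert i {i<..<i + int n}" using n0 by auto
        then have "\<eta> i = int s" using sum_comps[OF \<eta> n0, of i] z' by simp
        have "\<eta> = conc n s i"
        proof
          fix k
          define r where "r = (k - i) mod int n + i"
          have r: "r \<in> {i..<i + int n}" "r mod int n = k mod int n"
            using n0 by (auto simp: r_def mod_simps)
          have "\<eta> r = conc n s i r"
          proof (cases "r = i")
            case True
            then show ?thesis using \<open>\<eta> i = int s\<close> by (simp add: conc_def evec_def)
          next
            case False
            then have "r \<in> {i<..<i + int n}" using r by auto
            moreover from this have "evec n i r = 0"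
              using not_dvd[of "r - i"] by (auto simp: evec_def mod_eq_dvd_iff)
            ultimately show ?thesis using z' by (simp add: conc_def)
          qed
          then show "\<eta> k = conc n s i k"
            using comps_mod[OF \<eta> r(2)] comps_mod[OF conc_comps[OF n0, of s i] r(2)] by simp
        qed
        then show ?thesis using Qi by simp
      qed
    qed
  qed
qed

text \<open>A composition whose entry at 1 is at least that at 1 + h reduces to the one concentrated
  at 1, any other to the one concentrated at 1 + h. These two are linked through site 2: since h
  \<ge> 2, the composition concentrated at 2 vanishes at 1 and 1 + h, and the one concentrated at 1
  + h vanishes at 2 and 2 + h.\<close>

lemma connected:
  assumes edge: "\<And>\<alpha> i. \<alpha> \<in> comps n s \<Longrightarrow> \<alpha> i > \<alpha> (i + h) \<Longrightarrow> Q \<alpha> \<longleftrightarrow> Q (mv n (i + 1) i \<alpha>)"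
    and Q1: "Q (conc n s 1)" and \<eta>: "\<eta> \<in> comps n s"
  shows "Q \<eta>"
proof -
  note cc = connected_conc[where Q = Q, OF edge]
  have z: "conc n s i j = 0" if "i \<noteq> j" "\<bar>j - i\<bar> < int n" for i j
    using that not_dvd[of "j - i"] by (auto simp: conc_def evec_def mod_eq_dvd_iff)
  have Q2: "Q (conc n s 2)"
    by (rule cc[OF _ _ Q1 conc_comps[OF n0]]) (use z[of 2 1] z[of 2 "1 + h"] h2 nh in auto)
  have Qh: "Q (conc n s (1 + h))"
    by (rule cc[OF _ _ Q2 conc_comps[OF n0]]) (use z[of "1 + h" 2] z[of "1 + h" "2 + h"] h2 nh in auto)
  show ?thesis
  proof (cases "\<eta> 1 \<ge> \<eta> (1 + h)")
    case True
    show ?thesis by (rule cc[OF _ _ Q1 \<eta> True])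
  next
    case False
    show ?thesis by (rule cc[OF _ _ Qh \<eta>]) (use False shift_hh[OF \<eta>, of 1] in auto)
  qed
qed

section \<open>The map from \<alpha> to \<alpha>', its inverse, and its behaviour along
  edges\<close>

definition mm :: "comp \<Rightarrow> int \<Rightarrow> int" where
  "mm \<alpha> i = min (\<alpha> i) (\<alpha> (i + h))"

text \<open>\<open>pm \<alpha>\<close> is the composition \<open>\<alpha>'\<close>, rewritten with \<open>max a b - b = max 0 (a - b)\<close> and
  \<open>a + b - max a b = min a b\<close>.\<close>

definition pm :: "comp \<Rightarrow> comp" where
  "pm \<alpha> = (\<lambda>i. mm \<alpha> (i + 1) + max 0 (\<alpha> (i + h) - \<alpha> i))"

definition pm_inv :: "comp \<Rightarrow> comp" where
  "pm_inv \<beta> = (\<lambda>i. mm \<beta> (i - 1) + max 0 (\<beta> (i + h) - \<beta> i))"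

lemma periodic_shift: "\<alpha> \<in> comps n s \<Longrightarrow> \<alpha> (i + int n + d) = \<alpha> (i + d)"
  by (rule comps_mod[of \<alpha> n s]) (auto simp: algebra_simps mod_eq_dvd_iff)

lemma mm_shift:
  assumes "\<alpha> \<in> comps n s"
  shows "mm \<alpha> (i + h) = mm \<alpha> i"
  using shift_hh[OF assms] by (simp add: mm_def)

lemma mm_periodic:
  assumes "\<alpha> \<in> comps n s"
  shows "mm \<alpha> (i + int n) = mm \<alpha> i"
  using periodic_shift[OF assms, of i 0] periodic_shift[OF assms, of i h] by (simp add: mm_def)

lemma sum_comps': "\<alpha> \<in> comps n s \<Longrightarrow> (\<Sum>i=1..int n. \<alpha> (i + d)) = int s"
  using sum_periodic_shift[OF _ n0, of \<alpha> d] by (simp add: comps_def)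

lemma sum_mm:
  assumes "\<alpha> \<in> comps n s"
  shows "(\<Sum>i=1..int n. mm \<alpha> (i + d)) = (\<Sum>i=1..int n. mm \<alpha> i)"
  using sum_periodic_shift[where f = "mm \<alpha>" and n = n and d = d] mm_periodic[OF assms] n0 by simp

text \<open>After a shift of the index in the sum of the minima, each summand has the form min a b +
  max 0 (b - a) = b with b the opposite entry.\<close>

lemma pm_comps:
  assumes \<alpha>: "\<alpha> \<in> comps n s"
  shows "pm \<alpha> \<in> comps n s"
proof -
  have "(\<Sum>i=1..int n. pm \<alpha> i) =
      (\<Sum>i=1..int n. mm \<alpha> (i + 1)) + (\<Sum>i=1..int n. max 0 (\<alpha> (i + h) - \<alpha> i))"
    by (simp add: pm_def sum.distrib)
  also have "\<dots> = (\<Sum>i=1..int n. mm \<alpha> i + max 0 (\<alpha> (i + h) - \<alpha> i))"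
    unfolding sum_mm[OF \<alpha>] by (simp add: sum.distrib)
  also have "\<dots> = (\<Sum>i=1..int n. \<alpha> (i + h))"
    by (intro sum.cong) (auto simp: mm_def)
  also have "\<dots> = int s" by (rule sum_comps'[OF \<alpha>])
  finally show ?thesis
    using comps_nonneg[OF \<alpha>] periodic_shift[OF \<alpha>, of _ 0] periodic_shift[OF \<alpha>, of _ h]
      mm_periodic[OF \<alpha>, of "_ + 1"]
    by (auto simp: comps_def pm_def mm_def algebra_simps intro!: add_nonneg_nonneg)
qed

lemma pm_inv_comps:
  assumes \<alpha>: "\<alpha> \<in> comps n s"
  shows "pm_inv \<alpha> \<in> comps n s"
proof -
  have "(\<Sum>i=1..int n. pm_inv \<alpha> i) =
      (\<Sum>i=1..int n. mm \<alpha> (i + (-1))) + (\<Sum>i=1..int n. max 0 (\<alpha> (i + h) - \<alpha> i))"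
    by (simp add: pm_inv_def sum.distrib)
  also have "\<dots> = (\<Sum>i=1..int n. mm \<alpha> i + max 0 (\<alpha> (i + h) - \<alpha> i))"
    unfolding sum_mm[OF \<alpha>] by (simp add: sum.distrib)
  also have "\<dots> = (\<Sum>i=1..int n. \<alpha> (i + h))"
    by (intro sum.cong) (auto simp: mm_def)
  also have "\<dots> = int s" by (rule sum_comps'[OF \<alpha>])
  finally show ?thesis
    using comps_nonneg[OF \<alpha>] periodic_shift[OF \<alpha>, of _ 0] periodic_shift[OF \<alpha>, of _ h]
      mm_periodic[OF \<alpha>, of "_ - 1"]
    by (auto simp: comps_def pm_inv_def mm_def algebra_simps intro!: add_nonneg_nonneg)
qed

text \<open>A composition is determined by the minima \<open>mm\<close> of its opposite pairs and by
  the differences of opposite entries. \<open>pm\<close> shifts the minima by one site and negates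
  the differences; \<open>pm_inv\<close> negates the differences and shifts the minima the other
  way, hence inverts it.\<close>

lemma mm_pm:
  assumes "\<alpha> \<in> comps n s"
  shows "mm (pm \<alpha>) i = mm \<alpha> (i + 1)"
  using mm_shift[OF assms, of "i + 1"] shift_hh[OF assms, of i]
  unfolding mm_def[of "pm \<alpha>"] by (auto simp: pm_def algebra_simps)

lemma mm_pm_inv:
  assumes "\<alpha> \<in> comps n s"
  shows "mm (pm_inv \<alpha>) i = mm \<alpha> (i - 1)"
  using mm_shift[OF assms, of "i - 1"] shift_hh[OF assms, of i]
  unfolding mm_def[of "pm_inv \<alpha>"] by (auto simp: pm_inv_def algebra_simps)

lemma pm_diff:
  assumes "\<alpha> \<in> comps n s"
  shows "pm \<alpha> (i + h) - pm \<alpha> i = \<alpha> i - \<alpha> (i + h)"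
  using mm_shift[OF assms, of "i + 1"] shift_hh[OF assms, of i]
  by (auto simp: pm_def algebra_simps)

lemma pm_inv_diff:
  assumes "\<alpha> \<in> comps n s"
  shows "pm_inv \<alpha> (i + h) - pm_inv \<alpha> i = \<alpha> i - \<alpha> (i + h)"
  using mm_shift[OF assms, of "i - 1"] shift_hh[OF assms, of i]
  by (auto simp: pm_inv_def algebra_simps)

lemma pm_inv_pm: "\<alpha> \<in> comps n s \<Longrightarrow> pm_inv (pm \<alpha>) = \<alpha>"
  by (rule ext) (auto simp: pm_inv_def mm_pm pm_diff, auto simp: mm_def)

lemma pm_pm_inv: "\<alpha> \<in> comps n s \<Longrightarrow> pm (pm_inv \<alpha>) = \<alpha>"
  by (rule ext) (auto simp: pm_def mm_pm_inv pm_inv_diff, auto simp: mm_def)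

lemma bij_pm: "bij_betw pm (comps n s) (comps n s)"
  by (rule bij_betw_byWitness[of _ pm_inv]) (auto simp: pm_inv_pm pm_pm_inv pm_comps pm_inv_comps)

text \<open>Because min a b = (a + b - |a - b|) / 2, the total of the minima depends only on s and
  on the absolute differences of opposite entries, on which \<gamma> and \<eta> agree. The
  inequalities give \<open>mm \<eta> (i + 1) \<le> mm \<gamma> i\<close> at every site, and equal
  totals force equality throughout.\<close>

lemma eq_pmI:
  assumes \<gamma>: "\<gamma> \<in> comps n s" and \<eta>: "\<eta> \<in> comps n s"
    and wt: "\<And>i. \<gamma> i - \<gamma> (i + h) = \<eta> (i + h) - \<eta> i"
    and ge: "\<And>i. \<eta> i \<ge> \<eta> (i + h) \<Longrightarrow> \<gamma> i \<ge> mm \<eta> (i + 1)"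
  shows "\<gamma> = pm \<eta>"
proof -
  have le: "mm \<eta> (i + 1) \<le> mm \<gamma> i" for i
  proof (cases "\<eta> i \<ge> \<eta> (i + h)")
    case True
    then show ?thesis using ge[OF True] wt[of i] by (simp add: mm_def)
  next
    case False
    then have "\<gamma> (i + h) \<ge> mm \<eta> (i + h + 1)" using ge[of "i + h"] shift_hh[OF \<eta>, of i] by simp
    moreover have "mm \<eta> (i + h + 1) = mm \<eta> (i + 1)" using mm_shift[OF \<eta>, of "i + 1"] by (simp add: algebra_simps)
    ultimately show ?thesis using False wt[of i] by (simp add: mm_def)
  qed
  have two: "2 * (\<Sum>i=1..int n. mm \<alpha> i) = 2 * int s - (\<Sum>i=1..int n. \<bar>\<alpha> i - \<alpha> (i + h)\<bar>)"
    if "\<alpha> \<in> comps n s" for \<alpha>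
  proof -
    have "2 * (\<Sum>i=1..int n. mm \<alpha> i) = (\<Sum>i=1..int n. \<alpha> (i + 0) + \<alpha> (i + h) - \<bar>\<alpha> i - \<alpha> (i + h)\<bar>)"
      unfolding sum_distrib_left by (intro sum.cong) (auto simp: mm_def)
    then show ?thesis unfolding sum_subtractf sum.distrib sum_comps'[OF that] by simp
  qed
  have "(\<Sum>i=1..int n. \<bar>\<gamma> i - \<gamma> (i + h)\<bar>) = (\<Sum>i=1..int n. \<bar>\<eta> i - \<eta> (i + h)\<bar>)"
    by (intro sum.cong) (auto simp: wt)
  then have "(\<Sum>i=1..int n. mm \<gamma> i) = (\<Sum>i=1..int n. mm \<eta> (i + 1))"
    using two[OF \<gamma>] two[OF \<eta>] sum_mm[OF \<eta>, of 1] by simp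
  then have s0: "(\<Sum>i=1..int n. mm \<gamma> i - mm \<eta> (i + 1)) = 0" by (simp add: sum_subtractf)
  have eq1: "mm \<gamma> i = mm \<eta> (i + 1)" if "i \<in> {1..int n}" for i
  proof -
    have "mm \<gamma> i - mm \<eta> (i + 1) = 0"
      using s0 le that by (subst (asm) sum_nonneg_eq_0_iff) auto
    then show ?thesis by simp
  qed
  have eq: "mm \<gamma> i = mm \<eta> (i + 1)" for i
  proof -
    define r where "r = (i - 1) mod int n + 1"
    have r: "r \<in> {1..int n}" "r mod int n = i mod int n"
      using rep_1_n[of "int n" i] n0 by (simp_all add: r_def)
    have a: "(r + d) mod int n = (i + d) mod int n" for d using r(2) by (metis mod_add_left_eq)
    have "mm \<gamma> i = mm \<gamma> r" "mm \<eta> (i + 1) = mm \<eta> (r + 1)"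
      unfolding mm_def using comps_mod[OF \<gamma> r(2)] comps_mod[OF \<gamma> a[of h]]
        comps_mod[OF \<eta> a[of 1]] comps_mod[OF \<eta> a[of "1 + h"]] by (simp_all add: add.assoc)
    then show ?thesis using eq1[OF r(1)] by simp
  qed
  show ?thesis
  proof
    fix i
    show "\<gamma> i = pm \<eta> i"
      using eq[of i] wt[of i] by (simp add: pm_def) (simp add: mm_def)
  qed
qed

text \<open>The minimum of the pair at i does not change, as the unit is taken from the strictly
  larger entry. The minimum of the pair at i + 1 grows by one exactly if the entry at i + 1 is the
  smaller one. In that case this growth cancels the loss in the positive part at i + h, and
  \<open>pm\<close> changes only at i and i + 1; otherwise only the positive parts at i + h and i +
  h + 1 change.\<close>

lemma pm_mv:
  assumes \<alpha>: "\<alpha> \<in> comps n s" and gt: "\<alpha> i > \<alpha> (i + h)"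
  defines "\<eta> \<equiv> mv n (i + 1) i \<alpha>"
  shows "pm \<alpha> = (if \<alpha> (i + 1) < \<alpha> (i + 1 + h) then mv n (i + 1) i (pm \<eta>)
                 else mv n (i + h) (i + h + 1) (pm \<eta>))"
proof
  fix k
  let ?e = "\<lambda>d. of_bool ((k + d) mod int n = i mod int n) :: int"
  have sh: "of_bool ((k + d) mod int n = (i + d') mod int n) = ?e (d - d')" for d d'
    by (simp add: mod_eq_dvd_iff algebra_simps)
  have ev: "evec n i (k + d) = ?e d" "evec n (i + d') (k + d) = ?e (d - d')" for d d'
    using sh[of d d'] by (simp_all add: evec_def)
  have ev0: "evec n (i + d') k = ?e (- d')" "evec n i k = ?e 0" for d'
    using sh[of 0 d'] by (simp_all add: evec_def)
  have md: "(k + d) mod int n \<noteq> i mod int n"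
    if "(k + c) mod int n = i mod int n" "d \<noteq> c" "\<bar>d - c\<bar> < int n" for c d
  proof
    assume "(k + d) mod int n = i mod int n"
    with that(1) have "(k + d) mod int n = (k + c) mod int n" by simp
    then have "int n dvd (d - c)" by (simp add: mod_eq_dvd_iff)
    then show False using not_dvd[of "d - c"] that by simp
  qed
  have val: "\<alpha> (k + d) = \<alpha> (i + (d - c))" if "(k + c) mod int n = i mod int n" for c d
    using that by (intro comps_mod[OF \<alpha>]) (simp add: mod_eq_dvd_iff algebra_simps)

  have eh: "?e (- h + d) = ?e (h + d)" for d
  proof -
    have "(k + (- h + d)) mod int n = (k + (h + d)) mod int n"
      using nh by (simp add: mod_eq_dvd_iff)
    then show ?thesis by simp
  qed
  have eh': "?e (- h) = ?e h" "?e (- h - 1) = ?e (h - 1)" using eh[of 0] eh[of "-1"] by simp_all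
  have \<eta>: "\<eta> (k + d) = \<alpha> (k + d) + ?e (d - 1) - ?e d" "\<eta> k = \<alpha> k + ?e (-1) - ?e 0" for d
    using ev ev0(1)[of 1] ev0(2) by (simp_all add: \<eta>_def mv_def evec_def)
  have \<alpha>h: "\<alpha> (i + (d + h)) = \<alpha> (i + (d - h))" for d
    using nh by (intro comps_mod[OF \<alpha>]) (simp add: mod_eq_dvd_iff)
  show "pm \<alpha> k = (if \<alpha> (i + 1) < \<alpha> (i + 1 + h) then mv n (i + 1) i (pm \<eta>)
                 else mv n (i + h) (i + h + 1) (pm \<eta>)) k"
  proof -
    have L: "pm \<alpha> k = min (\<alpha> (k + 1)) (\<alpha> (k + (1 + h))) + max 0 (\<alpha> (k + h) - \<alpha> k)"
      by (simp add: pm_def mm_def add.assoc)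
    have E: "pm \<eta> k = min (\<alpha> (k + 1) + ?e 0 - ?e 1) (\<alpha> (k + (1 + h)) + ?e h - ?e (1 + h)) +
        max 0 (\<alpha> (k + h) + ?e (h - 1) - ?e h - (\<alpha> k + ?e (-1) - ?e 0))"
      unfolding pm_def mm_def add.assoc \<eta> by simp
    have R: "(if \<alpha> (i + 1) < \<alpha> (i + 1 + h) then mv n (i + 1) i (pm \<eta>)
                 else mv n (i + h) (i + h + 1) (pm \<eta>)) k =
      pm \<eta> k + (if \<alpha> (i + 1) < \<alpha> (i + 1 + h) then ?e (-1) - ?e 0 else ?e h - ?e (h - 1))"
      using ev0(1)[of 1] ev0(1)[of h] ev0(1)[of "h + 1"] eh' ev0(2)
      by (simp add: mv_def add.assoc)
    \<comment> \<open>The site k is congruent to i, i + 1, i + h, i + h + 1, or to none of these. In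
      the last case at most the minimum of the pair at i is involved, which is unaffected.\<close>
    consider (a) "?e 0 = 1" | (b) "?e (-1) = 1" | (c) "?e h = 1" | (d) "?e (h - 1) = 1"
      | (e) "?e 0 = 0" "?e (-1) = 0" "?e h = 0" "?e (h - 1) = 0" by fastforce
    then show ?thesis
    proof cases
      case a
      then have a': "(k + 0) mod int n = i mod int n" by (simp split: if_splits)
      have "?e 1 = 0" "?e (-1) = 0" "?e h = 0" "?e (h - 1) = 0" "?e (1 + h) = 0"
        using md[OF a', of 1] md[OF a', of "-1"] md[OF a', of h] md[OF a', of "h - 1"]
          md[OF a', of "1 + h"] h2 nh by auto
      then show ?thesis unfolding L E R a
        using val[OF a', of 0] val[OF a', of 1] val[OF a', of h] val[OF a', of "1 + h"] gt
        by (auto simp: add.assoc)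
    next
      case b
      then have a': "(k + (- 1)) mod int n = i mod int n" by (simp split: if_splits)
      have "?e 1 = 0" "?e 0 = 0" "?e h = 0" "?e (h - 1) = 0"
        using md[OF a', of 1] md[OF a', of "0"] md[OF a', of h] md[OF a', of "h - 1"] h2 nh by auto
      \<comment> \<open>This indicator is nonzero only for n = 4, where the site after i + 1 is
        opposite to i.\<close>
      moreover have "?e (1 + h) = 1 \<Longrightarrow> \<alpha> (k + (1 + h)) = \<alpha> i \<and> \<alpha> (k + 1) = \<alpha> (i + h)"
        using val[of "1 + h" "1 + h"] val[of "1 + h" 1] \<alpha>h[of 0] by (auto split: if_splits)
      ultimately show ?thesis unfolding L E R b
        using val[OF a', of 0] val[OF a', of h] gt add.commute[of h 1]
        by (auto simp: add.assoc)
    next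
      case c
      then have a': "(k + h) mod int n = i mod int n" by (simp split: if_splits)
      have "?e 1 = 0" "?e 0 = 0" "?e (-1) = 0" "?e (h - 1) = 0" "?e (1 + h) = 0"
        using md[OF a', of 1] md[OF a', of "0"] md[OF a', of "-1"] md[OF a', of "h - 1"]
         md[OF a', of "1 + h"] h2 nh by auto
      then show ?thesis unfolding L E R c
        using val[OF a', of 0] val[OF a', of h] val[OF a', of 1] val[OF a', of "1 + h"] gt
         \<alpha>h[of 0] \<alpha>h[of 1]
        by (auto simp: add.assoc)
    next
      case d
      then have a': "(k + (h - 1)) mod int n = i mod int n" by (simp split: if_splits)
      have "?e (1 + h) = 0" "?e 0 = 0" "?e (-1) = 0" "?e h = 0"
        using md[OF a', of h] md[OF a', of "0"] md[OF a', of "-1"]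
         md[OF a', of "1 + h"] h2 nh by auto
      moreover have "?e 1 = 1 \<Longrightarrow> \<alpha> (k + 1) = \<alpha> i \<and> \<alpha> (k + (1 + h)) = \<alpha> (i + h)"
        using val[of 1 1] val[of 1 "1 + h"] by (auto split: if_splits)
      ultimately show ?thesis unfolding L E R d
        using val[OF a', of 0] val[OF a', of h] gt \<alpha>h[of 1]
        by (auto simp: add.assoc algebra_simps)
    next
      case e
      have "?e 1 = 1 \<Longrightarrow> \<alpha> (k + 1) = \<alpha> i \<and> \<alpha> (k + (1 + h)) = \<alpha> (i + h)"
        using val[of 1 1] val[of 1 "1 + h"] by (auto split: if_splits)
      moreover have "?e (1 + h) = 1 \<Longrightarrow> \<alpha> (k + (1 + h)) = \<alpha> i \<and> \<alpha> (k + 1) = \<alpha> (i + h)"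
        using val[of "1 + h" "1 + h"] val[of "1 + h" 1] \<alpha>h[of 0] by (auto split: if_splits)
      moreover have "?e 1 = 0 \<or> ?e (1 + h) = 0"
        using md[of 1 "1 + h"] h2 nh by auto
      ultimately show ?thesis unfolding L E R e using gt by (auto split: if_splits)
    qed
  qed
qed

section \<open>The exponent of x and its change along edges\<close>

definition II :: "comp \<Rightarrow> int" where
  "II \<alpha> = mm \<alpha> 1 - (\<Sum>j=h+1..int n. \<alpha> j)"

lemma sum_evec_telescope:
  "(\<Sum>j=h+1..int n. evec n (i + 1) j) - (\<Sum>j=h+1..int n. evec n i j) = evec n i h - evec n i (int n)"
proof -
  have "evec n (i + 1) j = evec n i (j - 1)" for j
    by (simp add: evec_def mod_eq_dvd_iff algebra_simps)
  moreover have "(\<Sum>j=h+1..h + int k. f (j - 1)) - (\<Sum>j=h+1..h + int k. f j) = f h - f (h + int k)" for k and f :: "int \<Rightarrow> int"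
  proof (induction k)
    case (Suc k)
    have "{h + 1..h + int (Suc k)} = insert (h + int (Suc k)) {h + 1..h + int k}" by auto
    then show ?case using Suc by simp
  qed simp
  from this[of "evec n i" "nat h"] have "(\<Sum>j=h+1..int n. evec n i (j - 1)) - (\<Sum>j=h+1..int n. evec n i j) = evec n i h - evec n i (int n)"
    using h2 nh by simp
  ultimately show ?thesis by simp
qed

text \<open>The sum over h+1..n changes only if the unit crosses an end of this block: it leaves for
  i congruent to 0 and enters for i congruent to h. In exactly these cases the pair {1, 1 + h}
  receives the unit, and its minimum grows by \<open>up\<close>. If that pair loses the unit, it
  loses it from its larger entry, so the minimum stays.\<close>

lemma II_mv:
  assumes \<alpha>: "\<alpha> \<in> comps n s" and gt: "\<alpha> i > \<alpha> (i + h)"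
  defines "up \<equiv> of_bool (\<alpha> (i + 1) < \<alpha> (i + 1 + h))"
  shows "II (mv n (i + 1) i \<alpha>) = II \<alpha> + of_bool (i mod int n = 0) * (1 + up) -
    of_bool ((i + h) mod int n = 0) * (1 - up)"
proof -
  let ?\<eta> = "mv n (i + 1) i \<alpha>"
  let ?z = "\<lambda>d. of_bool ((i + d) mod int n = 0) :: int"
  have md: "(i + d) mod int n \<noteq> 0"
    if "(i + c) mod int n = 0" "d \<noteq> c" "\<bar>d - c\<bar> < int n" for c d
  proof
    assume "(i + d) mod int n = 0"
    with that(1) have "(i + d) mod int n = (i + c) mod int n" by simp
    then have "int n dvd (d - c)" by (simp add: mod_eq_dvd_iff)
    then show False using not_dvd[of "d - c"] that by simp
  qed
  have ev: "evec n (i + c) d = of_bool ((i + (c - d)) mod int n = 0)"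
     "evec n i d = of_bool ((i + (- d)) mod int n = 0)" for c d
  proof -
    have z: "(d mod int n = e mod int n) \<longleftrightarrow> (e - d) mod int n = 0" for e
      by (metis mod_eq_dvd_iff dvd_eq_mod_eq_0)
    show "evec n (i + c) d = of_bool ((i + (c - d)) mod int n = 0)"
     "evec n i d = of_bool ((i + (- d)) mod int n = 0)"
     unfolding evec_def z by (simp_all add: algebra_simps)
  qed
  have eh: "?z (- h) = ?z h"
  proof -
    have "(i + (- h)) mod int n = (i + h) mod int n" using nh by (simp add: mod_eq_dvd_iff)
    then show ?thesis by simp
  qed
  have eh1: "?z (- 1 - h) = ?z (h - 1)"
  proof -
    have "(i + (- 1 - h)) mod int n = (i + (h - 1)) mod int n" using nh by (simp add: mod_eq_dvd_iff)
    then show ?thesis by simp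
  qed
  have en: "evec n i (int n) = ?z 0" by (simp add: evec_def)
  have val: "\<alpha> d = \<alpha> (i + d + c)" if "(i + c) mod int n = 0" for c d
    using that by (intro comps_mod[OF \<alpha>]) (metis add.assoc add.commute add.right_neutral mod_add_right_eq)
  have S: "(\<Sum>j=h+1..int n. ?\<eta> j) = (\<Sum>j=h+1..int n. \<alpha> j) + ?z h - ?z 0"
    using sum_evec_telescope[of i] ev(2)[of h] eh en
    by (simp add: mv_def sum.distrib sum_subtractf)
  have M: "mm ?\<eta> 1 = min (\<alpha> 1 + ?z 0 - ?z (- 1)) (\<alpha> (1 + h) + ?z (- h) - ?z (- 1 - h))"
    using ev(1)[of 1 1] ev(1)[of 1 "1 + h"] ev(2)[of 1] ev(2)[of "1 + h"]
    by (simp add: mm_def mv_def)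
  have "mm ?\<eta> 1 = mm \<alpha> 1 + (?z 0 + ?z h) * up"
  proof -
    consider (a) "?z 0 = 1" | (b) "?z h = 1" | (c) "?z 0 = 0" "?z h = 0" by fastforce
    then show ?thesis
    proof cases
      case a
      then have a': "(i + 0) mod int n = 0" by (simp split: if_splits)
      have "?z (-1) = 0" "?z h = 0" "?z (- 1 - h) = 0"
        using md[OF a', of "-1"] md[OF a', of h] md[OF a', of "- 1 - h"] h2 nh by auto
      then show ?thesis using a val[OF a', of 1] val[OF a', of "1 + h"] unfolding M eh
        by (auto simp: mm_def up_def add.assoc)
    next
      case b
      then have a': "(i + h) mod int n = 0" by (simp split: if_splits)
      have "?z (-1) = 0" "?z 0 = 0" "?z (- 1 - h) = 0"
        using md[OF a', of "-1"] md[OF a', of 0] md[OF a', of "h - 1"] h2 nh unfolding eh1 by auto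
      then show ?thesis using b val[OF a', of 1] val[OF a', of "1 + h"] shift_hh[OF \<alpha>, of "i + 1"] unfolding M eh
        by (auto simp: mm_def up_def algebra_simps)
    next
      case c
      have p: "?z (- 1) = 1 \<Longrightarrow> \<alpha> 1 = \<alpha> i \<and> \<alpha> (1 + h) = \<alpha> (i + h)"
        using val[of "-1" 1] val[of "-1" "1 + h"] by (auto simp: algebra_simps split: if_splits)
      have p': "?z (- 1 - h) = 1 \<Longrightarrow> \<alpha> 1 = \<alpha> (i + h) \<and> \<alpha> (1 + h) = \<alpha> i"
        using val[of "- 1 - h" 1] val[of "- 1 - h" "1 + h"] shift_hh[OF \<alpha>, of "i - h"]
        by (auto simp: algebra_simps split: if_splits)
      have "?z (-1) = 0 \<or> ?z (- 1 - h) = 0"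
        using md[of "-1" "- 1 - h"] h2 nh by auto
      then show ?thesis using c p p' gt unfolding M eh by (auto simp: mm_def split: if_splits)
    qed
  qed
  then show ?thesis using S by (simp add: II_def algebra_simps)
qed

end

section \<open>Tensor products of fundamental modules in terms of words\<close>

text \<open>A factor \<open>(b, z)\<close> stands for the dual module if \<open>b\<close> holds and for the primal one otherwise, with
  spectral parameter \<open>z\<close>. A vector of a tensor product is a function on words in the letters \<open>1..n\<close>, and
  \<open>Ea\<close>, \<open>Fa\<close>, \<open>kX\<close> are the iterated coproducts.\<close>

type_synonym factor = "bool \<times> scalar"

context even_rank
begin

definition sc :: "int \<Rightarrow> int" where "sc c = (if c = int n then 1 else c + 1)"
definition pr :: "int \<Rightarrow> int" where "pr c = (if c = 1 then int n else c - 1)"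
definition refl_letter :: "int \<Rightarrow> int" where "refl_letter c = int n + 1 - c"

definition wds :: "nat \<Rightarrow> int list set" where
  "wds s = {w. length w = s \<and> set w \<subseteq> {1..int n}}"

definition kx :: "bool \<Rightarrow> int \<Rightarrow> int \<Rightarrow> int" where
  "kx b i c = (if b then - 1 else 1) * (evec n c i - evec n c (i + 1))"

text \<open>Generators act here on coefficient functions, that is, by rows: a coefficient is
  attached to the letter c that is produced. The letter that E_i or F_i turns into c is
  \<open>eS b c\<close> or \<open>fS b c\<close>.\<close>

definition eC :: "bool \<Rightarrow> scalar \<Rightarrow> int \<Rightarrow> int \<Rightarrow> scalar" where
  "eC b z i c = of_bool (c mod int n = (if b then i + 1 else i) mod int n) * aff_w n z i"

definition fC :: "bool \<Rightarrow> scalar \<Rightarrow> int \<Rightarrow> int \<Rightarrow> scalar" where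
  "fC b z i c = of_bool (c mod int n = (if b then i else i + 1) mod int n) * aff_w n (inverse z) i"

definition eS :: "bool \<Rightarrow> int \<Rightarrow> int" where "eS b = (if b then pr else sc)"
definition fS :: "bool \<Rightarrow> int \<Rightarrow> int" where "fS b = (if b then sc else pr)"

fun kX :: "factor list \<Rightarrow> int \<Rightarrow> int list \<Rightarrow> int" where
  "kX ((b, z) # ms) i (c # w) = kx b i c + kX ms i w"
| "kX _ i _ = 0"

fun Ea :: "factor list \<Rightarrow> int \<Rightarrow> (int list \<Rightarrow> scalar) \<Rightarrow> int list \<Rightarrow> scalar" where
  "Ea ((b, z) # ms) i \<phi> (c # w) =
     eC b z i c * \<phi> (eS b c # w) + qq powi (kx b i c) * Ea ms i (\<lambda>u. \<phi> (c # u)) w"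
| "Ea _ i \<phi> _ = 0"

fun Fa :: "factor list \<Rightarrow> int \<Rightarrow> (int list \<Rightarrow> scalar) \<Rightarrow> int list \<Rightarrow> scalar" where
  "Fa ((b, z) # ms) i \<phi> (c # w) =
     fC b z i c * qq powi (- kX ms i w) * \<phi> (fS b c # w) + Fa ms i (\<lambda>u. \<phi> (c # u)) w"
| "Fa _ i \<phi> _ = 0"

text \<open>The weight of K_i^-1 stands inside the argument of \<open>Ea\<close> because K_i^-1 acts
  before E_{i+n'}.\<close>

definition Ba :: "factor list \<Rightarrow> int \<Rightarrow> (int list \<Rightarrow> scalar) \<Rightarrow> int list \<Rightarrow> scalar" where
  "Ba ms i \<phi> w = Fa ms i \<phi> w + Ea ms (i + h) (\<lambda>u. qq powi (- kX ms i u) * \<phi> u) w"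

text \<open>With y = q^(1-s) z the spectral parameters are q^(1-s) z, q^(3-s) z, ..., q^(s-1) z, as
  required by the embedding of W_s(z).\<close>

fun pms :: "bool \<Rightarrow> scalar \<Rightarrow> nat \<Rightarrow> factor list" where
  "pms b y 0 = []"
| "pms b y (Suc s) = (b, y) # pms b (qq powi 2 * y) s"

fun cont :: "int list \<Rightarrow> comp" where
  "cont [] = (\<lambda>k. 0)"
| "cont (c # w) = (\<lambda>k. evec n c k + cont w k)"

text \<open>The number of inversions, in a form that recurses along the word and sees the tail of a
  letter only through its content; \<open>descs_dsc\<close> identifies it with
  \<open>descs\<close>.\<close>

fun dsc :: "int list \<Rightarrow> int" where
  "dsc [] = 0"
| "dsc (c # w) = (\<Sum>j\<in>{1..<c}. cont w j) + dsc w"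

definition emb :: "(comp \<Rightarrow> scalar) \<Rightarrow> int list \<Rightarrow> scalar" where
  "emb f w = qq powi (- dsc w) * f (cont w)"

lemma length_pms [simp]: "length (pms b y s) = s"
  by (induction s arbitrary: y) auto

lemma step_range: "c \<in> {1..int n} \<Longrightarrow> eS b c \<in> {1..int n}" "c \<in> {1..int n} \<Longrightarrow> fS b c \<in> {1..int n}"
  using n4 by (auto simp: eS_def fS_def sc_def pr_def)

lemma wds_Cons: "c # w \<in> wds (Suc s) \<longleftrightarrow> c \<in> {1..int n} \<and> w \<in> wds s"
  by (auto simp: wds_def)

lemma wds_Suc: "w \<in> wds (Suc s) \<longleftrightarrow> (\<exists>c u. w = c # u \<and> c \<in> {1..int n} \<and> u \<in> wds s)"
  by (cases w) (auto simp: wds_def)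

lemma wds_0: "w \<in> wds 0 \<longleftrightarrow> w = []"
  by (auto simp: wds_def)

lemma EaFa_cong:
  assumes "w \<in> wds (length ms)" "\<And>u. u \<in> wds (length ms) \<Longrightarrow> \<phi> u = \<psi> u"
  shows "Ea ms i \<phi> w = Ea ms i \<psi> w" "Fa ms i \<phi> w = Fa ms i \<psi> w"
proof -
  have "Ea ms i \<phi> w = Ea ms i \<psi> w \<and> Fa ms i \<phi> w = Fa ms i \<psi> w"
    using assms
  proof (induction ms arbitrary: w \<phi> \<psi>)
    case (Cons m ms)
    obtain b z where m: "m = (b, z)" by force
    obtain c u where w: "w = c # u" "c \<in> {1..int n}" "u \<in> wds (length ms)"
      using Cons.prems(1) wds_Suc by auto
    have "\<phi> (c # v) = \<psi> (c # v)" if "v \<in> wds (length ms)" for v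
      using Cons.prems(2) w that by (simp add: wds_Cons)
    moreover have "\<phi> (eS b c # u) = \<psi> (eS b c # u)" "\<phi> (fS b c # u) = \<psi> (fS b c # u)"
      using Cons.prems(2) w step_range by (simp_all add: wds_Cons)
    moreover have "Ea ms i (\<lambda>v. \<phi> (c # v)) u = Ea ms i (\<lambda>v. \<psi> (c # v)) u \<and>
        Fa ms i (\<lambda>v. \<phi> (c # v)) u = Fa ms i (\<lambda>v. \<psi> (c # v)) u"
      by (rule Cons.IH[OF w(3)]) (use Cons.prems(2) w in \<open>simp add: wds_Cons\<close>)
    ultimately show ?case unfolding m w(1) Ea.simps Fa.simps by (simp only:)
  qed simp
  then show "Ea ms i \<phi> w = Ea ms i \<psi> w" "Fa ms i \<phi> w = Fa ms i \<psi> w" by auto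
qed

lemma Ba_cong:
  assumes "w \<in> wds (length ms)" "\<And>u. u \<in> wds (length ms) \<Longrightarrow> \<phi> u = \<psi> u"
  shows "Ba ms i \<phi> w = Ba ms i \<psi> w"
  unfolding Ba_def using EaFa_cong(2)[OF assms] assms(2)
  by (intro arg_cong2[where f = "(+)"] EaFa_cong(1)[OF assms(1)]) auto

lemma evec_index_cong: "i mod int n = j mod int n \<Longrightarrow> evec n c i = evec n c j"
  by (simp add: evec_def)

lemma Suc_mod_cong: "(i::int) mod int n = j mod int n \<Longrightarrow> (i + d) mod int n = (j + d) mod int n"
  by (metis mod_add_left_eq)

lemma kx_index_cong: "i mod int n = j mod int n \<Longrightarrow> kx b i c = kx b j c"
  using evec_index_cong[of i j] evec_index_cong[of "i + 1" "j + 1"] Suc_mod_cong[of i j 1]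
  by (simp add: kx_def)

lemma kX_index_cong:
  assumes eq: "i mod int n = j mod int n"
  shows "kX ms i w = kX ms j w"
proof (induction ms arbitrary: w)
  case (Cons m ms)
  then show ?case using kx_index_cong[OF eq] by (cases m; cases w) simp_all
qed simp

lemma EaFa_index_cong:
  assumes eq: "i mod int n = j mod int n"
  shows "Ea ms i \<phi> w = Ea ms j \<phi> w" "Fa ms i \<phi> w = Fa ms j \<phi> w"
proof -
  have c: "eC b z i c = eC b z j c" "fC b z i c = fC b z j c" for b z c
    using Suc_mod_cong[OF eq, of 1] eq by (cases b; simp add: eC_def fC_def aff_w_def)+
  have "Ea ms i \<phi> w = Ea ms j \<phi> w \<and> Fa ms i \<phi> w = Fa ms j \<phi> w"
  proof (induction ms arbitrary: w \<phi>)
    case (Cons m ms)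
    then show ?case by (cases m; cases w) (simp_all add: c kx_index_cong[OF eq] kX_index_cong[OF eq])
  qed simp
  then show "Ea ms i \<phi> w = Ea ms j \<phi> w" "Fa ms i \<phi> w = Fa ms j \<phi> w" by auto
qed

section \<open>Action of E_i and F_i on the embedded primal module\<close>

lemma cont_comps: "w \<in> wds s \<Longrightarrow> cont w \<in> comps n s"
proof (induction w arbitrary: s)
  case Nil
  then show ?case by (auto simp: wds_def comps_def)
next
  case (Cons c w)
  then obtain s' where s: "s = Suc s'" "w \<in> wds s'" by (auto simp: wds_def)
  show ?case using Cons.IH[OF s(2)] evec_in_comps[OF n0, of c] s(1)
    by (auto simp: comps_def sum.distrib)
qed

lemma sum_evec_below:
  assumes "a \<in> {1..int n}" "c \<in> {1..int n + 1}"
  shows "(\<Sum>j\<in>{1..<c}. evec n a j) = of_bool (a < c)"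
proof -
  have "(\<Sum>j\<in>{1..<c}. evec n a j) = (\<Sum>j\<in>{1..<c}. of_bool (j = a))"
    using mod_1_n_eq[of _ "int n" a] assms by (intro sum.cong) (auto simp: evec_def)
  then show ?thesis using assms by (auto simp: sum.delta of_bool_def)
qed

lemma sum_mv_below:
  assumes "a \<in> {1..int n}" "b \<in> {1..int n}" "c \<in> {1..int n + 1}"
  shows "(\<Sum>j\<in>{1..<c}. mv n a b \<beta> j) = (\<Sum>j\<in>{1..<c}. \<beta> j) + of_bool (a < c) - of_bool (b < c)"
  using sum_evec_below[OF assms(1,3)] sum_evec_below[OF assms(2,3)]
  by (simp add: mv_def sum.distrib sum_subtractf)

lemma sum_cont: "w \<in> wds s \<Longrightarrow> (\<Sum>j\<in>{1..<int n}. cont w j) + cont w (int n) = int s"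
proof -
  assume "w \<in> wds s"
  from cont_comps[OF this] have "(\<Sum>j=1..int n. cont w j) = int s" by (simp add: comps_def)
  moreover have "{1..int n} = insert (int n) {1..<int n}" using n0 by auto
  ultimately show ?thesis by simp
qed

lemma mv_sc: "mv n (i + 1) i = mv n (sc i) i" "mv n i (i + 1) = mv n i (sc i)"
  by (rule mv_cong; simp add: sc_def)+

lemma evec_letter: "a \<in> {1..int n} \<Longrightarrow> b \<in> {1..int n} \<Longrightarrow> evec n a b = of_bool (a = b)"
  using mod_1_n_eq[of a "int n" b] by (auto simp: evec_def)

lemma sc_mod: "sc c mod int n = (c + 1) mod int n" by (simp add: sc_def)

lemma qq_powi_mult: "qq powi a * (qq powi b * y) = qq powi (a + b) * y"
  by (simp add: qq_powi_add)

lemma emb_Cons: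
  "(\<lambda>u. emb f (c # u)) = emb (\<lambda>\<beta>. qq powi (- (\<Sum>j\<in>{1..<c}. \<beta> j)) * f (\<lambda>k. evec n c k + \<beta> k))"
  by (rule ext) (simp add: emb_def qq_powi_mult algebra_simps)

lemma kX_pms: "length w = s \<Longrightarrow> kX (pms b y s) i w = (if b then -1 else 1) * (cont w i - cont w (i + 1))"
  by (induction w arbitrary: s y) (auto simp: kx_def algebra_simps)

lemma aff_w_letter:
  assumes "i \<in> {1..int n}"
  shows "aff_w n (qq powi k * y) i = qq powi (of_bool (i = int n) * k) * aff_w n y i" (is ?t1)
    "aff_w n (inverse (qq powi k * y)) i = qq powi (- of_bool (i = int n) * k) * aff_w n (inverse y) i" (is ?t2)
proof -
  have "i mod int n = 0 \<longleftrightarrow> i = int n" using assms mod_1_n_eq[of i "int n" "int n"] by auto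
  then show ?t1 ?t2
    by (auto simp: aff_w_def power_int_minus)
qed

lemma S_sc:
  assumes "i \<in> {1..int n}" "w \<in> wds s"
  shows "(\<Sum>j\<in>{1..<sc i}. cont w j) = (\<Sum>j\<in>{1..<i}. cont w j) + cont w i - of_bool (i = int n) * int s"
proof (cases "i = int n")
  case True
  then show ?thesis using sum_cont[OF assms(2)] by (simp add: sc_def)
next
  case False
  have "{1..<i + 1} = insert i {1..<i}" using assms by auto
  then show ?thesis using False by (simp add: sc_def)
qed

text \<open>Induction along the word. The induction hypothesis is applied to the tail with the
  function of \<open>emb_Cons\<close>, which absorbs the inversions caused by the first letter. If
  the first letter is i and the tail contains m more letters i, the term of the first letter and
  that of the tail combine by [m+1] = q^(-m) + q [m]. If the first letter is not i, only the tail
  contributes.\<close>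

lemma Ea_emb_letter:
  assumes i: "i \<in> {1..int n}" and w: "w \<in> wds s"
  shows "Ea (pms False y s) i (emb f) w =
    aff_w n (qq powi (int s - 1) * y) i * qint (cont w i) * qq powi (- dsc w) * f (mv n (i + 1) i (cont w))"
  using w
proof (induction w arbitrary: s y f)
  case Nil
  then have "s = 0" by (simp add: wds_def)
  then show ?case by (simp add: qint_0)
next
  case (Cons c w)
  then obtain s' where s: "s = Suc s'" and w: "w \<in> wds s'" and c: "c \<in> {1..int n}"
    by (cases s) (auto simp: wds_Cons wds_def)
  define S where "S c = (\<Sum>j\<in>{1..<c}. cont w j)" for c
  define X where "X = f (mv n (i + 1) i (cont (c # w)))"
  define D where "D = dsc w"
  define m where "m = cont w i"
  define A where "A = aff_w n y i"
  \<comment> \<open>At the affine node i = n the letter 1 is changed to n, which shifts inversion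
    counts by the length of the tail. The progression of the spectral parameters by q^2 compensates
    for this shift; \<open>\<delta>\<close> switches both effects on.\<close>
  define \<delta> :: int where "\<delta> = of_bool (i = int n)"
  have si: "sc i \<in> {1..int n}" using i n4 by (auto simp: sc_def)
  have tail: "Ea (pms False (qq powi 2 * y) s') i (\<lambda>u. emb f (c # u)) w =
     aff_w n (qq powi (int s' - 1) * (qq powi 2 * y)) i * qint m * qq powi (- D) *
     (qq powi (- (S c + of_bool (sc i < c) - of_bool (i < c))) * X)"
  proof -
    have x: "(\<lambda>k. evec n c k + mv n (i + 1) i (cont w) k) = mv n (i + 1) i (cont (c # w))"
      by (auto simp: mv_def)
    have sm: "(\<Sum>j\<in>{1..<c}. mv n (i + 1) i (cont w) j) = S c + of_bool (sc i < c) - of_bool (i < c)"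
      unfolding mv_sc S_def using sum_mv_below[OF si i] c by simp
    show ?thesis unfolding emb_Cons Cons.IH[OF w] m_def D_def X_def x sm ..
  qed
  have k: "kx False i c = of_bool (c = i) - of_bool (c = sc i)"
    using evec_letter[OF c i] evec_letter[OF c si] evec_index_cong[OF sc_mod[of i]] by (simp add: kx_def)
  have e: "eC False y i c = of_bool (c = i) * A"
    using evec_letter[OF c i] by (auto simp: eC_def evec_def A_def)
  have ci: "cont (c # w) i = of_bool (c = i) + m"
    using evec_letter[OF c i] by (simp add: m_def)
  have head: "of_bool (c = i) * A * emb f (eS False c # w) =
      of_bool (c = i) * (qq powi (- (S i + m - \<delta> * int s') - D) * (A * X))"
  proof (cases "c = i")
    case True
    have "cont (sc i # w) = mv n (i + 1) i (cont (c # w))"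
      using True evec_eq_iff[of n "sc i" "i + 1"] sc_mod[of i] by (auto simp: mv_def)
    then show ?thesis using True S_sc[OF i w]
      by (simp add: emb_def eS_def S_def D_def X_def m_def \<delta>_def mult_ac)
  qed simp
  have ee: "int s' - 1 + 2 = int s' + 1" by simp
  have "Ea (pms False y s) i (emb f) (c # w) =
      of_bool (c = i) * (qq powi (- (S i + m - \<delta> * int s') - D) * (A * X)) +
      qq powi (of_bool (c = i) - of_bool (c = sc i)) *
       (qq powi (\<delta> * (int s' + 1)) * A * qint m * qq powi (- D) *
       (qq powi (- (S c + of_bool (sc i < c) - of_bool (i < c))) * X))"
    unfolding s pms.simps Ea.simps k e tail head qq_powi_mult aff_w_letter(1)[OF i] A_def[symmetric] \<delta>_def ee
    by simp
  also have "\<dots> = of_bool (c = i) * (qq powi (- (S i + m - \<delta> * int s') - D) * (A * X)) +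
      qq powi ((of_bool (c = i) - of_bool (c = sc i)) + (\<delta> * (int s' + 1)) + (- D) +
        (- (S c + of_bool (sc i < c) - of_bool (i < c)))) * (A * qint m * X)"
    by (simp only: qq_powi_add mult_ac)
  also have "\<dots> = qq powi (\<delta> * int s' - S c - D) * (A * qint (of_bool (c = i) + m) * X)"
  proof (cases "c = i")
    case True
    have 1: "(of_bool (c = i) - of_bool (c = sc i)) + (\<delta> * (int s' + 1)) + (- D) +
        (- (S c + of_bool (sc i < c) - of_bool (i < c))) = (\<delta> * int s' - S c - D) + 1"
      using True n4 i by (auto simp: sc_def \<delta>_def algebra_simps)
    have 2: "- (S i + m - \<delta> * int s') - D = (\<delta> * int s' - S c - D) + (- m)"
      using True by simp
    have 3: "of_bool (c = i) + m = m + 1" using True by simp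
    show ?thesis unfolding 1 2 3 qint_Suc' qq_powi_add[of _ "1"] qq_powi_add[of _ "- m"]
      using True by (simp add: algebra_simps)
  next
    case False
    have 1: "(of_bool (c = i) - of_bool (c = sc i)) + (\<delta> * (int s' + 1)) + (- D) +
        (- (S c + of_bool (sc i < c) - of_bool (i < c))) = \<delta> * int s' - S c - D"
      using False n4 i c by (auto simp: sc_def \<delta>_def algebra_simps)
    show ?thesis unfolding 1 using False by simp
  qed
  also have "\<dots> = aff_w n (qq powi (int s - 1) * y) i * qint (cont (c # w) i) * qq powi (- dsc (c # w)) * X"
  proof -
    have "\<delta> * int s' - S c - D = \<delta> * int s' + - dsc (c # w)" by (simp add: S_def D_def)
    then show ?thesis unfolding ci aff_w_letter(1)[OF i] A_def[symmetric]
      by (simp only: qq_powi_add) (simp add: s \<delta>_def mult_ac)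
  qed
  finally show ?case unfolding X_def .
qed

lemma Fa_emb_letter:
  assumes i: "i \<in> {1..int n}" and w: "w \<in> wds s"
  shows "Fa (pms False y s) i (emb f) w =
    aff_w n (inverse (qq powi (int s - 1) * y)) i * qint (cont w (i + 1)) * qq powi (- dsc w) *
      f (mv n i (i + 1) (cont w))"
  using w
proof (induction w arbitrary: s y f)
  case Nil
  then have "s = 0" by (simp add: wds_def)
  then show ?case by (simp add: qint_0)
next
  case (Cons c w)
  then obtain s' where s: "s = Suc s'" and w: "w \<in> wds s'" and c: "c \<in> {1..int n}"
    by (cases s) (auto simp: wds_Cons wds_def)
  define S where "S c = (\<Sum>j\<in>{1..<c}. cont w j)" for c
  define X where "X = f (mv n i (i + 1) (cont (c # w)))"
  define D where "D = dsc w"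
  define m where "m = cont w i"
  define m' where "m' = cont w (sc i)"
  define A where "A = aff_w n (inverse y) i"
  define \<delta> :: int where "\<delta> = of_bool (i = int n)"
  have si: "sc i \<in> {1..int n}" using i n4 by (auto simp: sc_def)
  have m'_eq: "cont w (i + 1) = m'"
    unfolding m'_def using comps_mod[OF cont_comps[OF w] sc_mod[of i]] by simp
  have tail: "Fa (pms False (qq powi 2 * y) s') i (\<lambda>u. emb f (c # u)) w =
     aff_w n (inverse (qq powi (int s' - 1) * (qq powi 2 * y))) i * qint m' * qq powi (- D) *
     (qq powi (- (S c + of_bool (i < c) - of_bool (sc i < c))) * X)"
  proof -
    have x: "(\<lambda>k. evec n c k + mv n i (i + 1) (cont w) k) = mv n i (i + 1) (cont (c # w))"
      by (auto simp: mv_def)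
    have sm: "(\<Sum>j\<in>{1..<c}. mv n i (i + 1) (cont w) j) = S c + of_bool (i < c) - of_bool (sc i < c)"
      unfolding mv_sc S_def using sum_mv_below[OF i si] c by simp
    show ?thesis unfolding emb_Cons Cons.IH[OF w] m'_eq[symmetric] D_def X_def x sm ..
  qed
  have e: "fC False y i c = of_bool (c = sc i) * A"
    using evec_letter[OF c si] sc_mod[of i] by (auto simp: fC_def evec_def A_def)
  have ci: "cont (c # w) (i + 1) = of_bool (c = sc i) + m'"
    using evec_letter[OF c si] evec_index_cong[OF sc_mod[of i]] m'_eq by (simp)
  have head: "of_bool (c = sc i) * A * qq powi (- kX (pms False (qq powi 2 * y) s') i w) * emb f (fS False c # w) =
      of_bool (c = sc i) * (qq powi (m' - S (sc i) - \<delta> * int s' - D) * (A * X))"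
  proof (cases "c = sc i")
    case True
    have "fS False c = i" using True i n4 by (auto simp: fS_def pr_def sc_def split: if_splits)
    moreover have "cont (i # w) = mv n i (i + 1) (cont (c # w))"
      using True evec_eq_iff[of n "sc i" "i + 1"] sc_mod[of i] by (auto simp: mv_def)
    moreover have "kX (pms False (qq powi 2 * y) s') i w = m - m'"
      using kX_pms[of w s' False] w m'_eq by (simp add: wds_def m_def)
    moreover have ex: "m' - S (sc i) - \<delta> * int s' - D = - (m - m') + - (S i + D)"
      using S_sc[OF i w] by (simp add: S_def m_def \<delta>_def)
    moreover have "emb f (i # w) = qq powi (- (S i + D)) * X"
      using calculation(2) by (simp add: emb_def S_def D_def X_def)
    ultimately show ?thesis
      unfolding ex qq_powi_add by (simp only: mult_ac)
  qed simp
  have ee: "int s' - 1 + 2 = int s' + 1" by simp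
  have "Fa (pms False y s) i (emb f) (c # w) =
      of_bool (c = sc i) * (qq powi (m' - S (sc i) - \<delta> * int s' - D) * (A * X)) +
       qq powi (- \<delta> * (int s' + 1)) * A * qint m' * qq powi (- D) *
       (qq powi (- (S c + of_bool (i < c) - of_bool (sc i < c))) * X)"
    unfolding s pms.simps Fa.simps e tail head qq_powi_mult aff_w_letter(2)[OF i] A_def[symmetric] \<delta>_def ee
    by simp
  also have "\<dots> = of_bool (c = sc i) * (qq powi (m' - S (sc i) - \<delta> * int s' - D) * (A * X)) +
      qq powi ((- \<delta> * (int s' + 1)) + (- D) +
        (- (S c + of_bool (i < c) - of_bool (sc i < c)))) * (A * qint m' * X)"
    by (simp only: qq_powi_add mult_ac)
  also have "\<dots> = qq powi (- \<delta> * int s' - S c - D) * (A * qint (of_bool (c = sc i) + m') * X)"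
  proof (cases "c = sc i")
    case True
    have 1: "(- \<delta> * (int s' + 1)) + (- D) +
        (- (S c + of_bool (i < c) - of_bool (sc i < c))) = (- \<delta> * int s' - S c - D) + - 1"
      using True n4 i by (auto simp: sc_def \<delta>_def algebra_simps)
    have 2: "m' - S (sc i) - \<delta> * int s' - D = (- \<delta> * int s' - S c - D) + m'"
      using True by simp
    have 3: "of_bool (c = sc i) + m' = m' + 1" using True by simp
    show ?thesis unfolding 1 2 3 qint_Suc qq_powi_add[of _ "- 1"] qq_powi_add[of _ "m'"]
      using True by (simp add: algebra_simps)
  next
    case False
    have 1: "(- \<delta> * (int s' + 1)) + (- D) +
        (- (S c + of_bool (i < c) - of_bool (sc i < c))) = - \<delta> * int s' - S c - D"
      using False n4 i c by (auto simp: sc_def \<delta>_def algebra_simps)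
    show ?thesis unfolding 1 using False by simp
  qed
  also have "\<dots> = aff_w n (inverse (qq powi (int s - 1) * y)) i * qint (cont (c # w) (i + 1)) * qq powi (- dsc (c # w)) * X"
  proof -
    have "- \<delta> * int s' - S c - D = - \<delta> * int s' + - dsc (c # w)" by (simp add: S_def D_def)
    then show ?thesis unfolding ci aff_w_letter(2)[OF i] A_def[symmetric]
      by (simp only: qq_powi_add) (simp add: s \<delta>_def mult_ac)
  qed
  finally show ?case unfolding X_def .
qed

section \<open>The action in coordinates, and dual factors by reflection of letters\<close>

definition sg :: "bool \<Rightarrow> int" where "sg b = (if b then - 1 else 1)"

text \<open>The coefficient at \<gamma> of E_i applied to the vector f of the Kirillov-Reshetikhin
  module. It comes from the one neighbour that E_i moves to \<gamma>, so the factor [\<alpha>_i + 1]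
  of the module formula, read at the target, becomes [\<gamma>_i].\<close>

definition EW :: "bool \<Rightarrow> scalar \<Rightarrow> int \<Rightarrow> (comp \<Rightarrow> scalar) \<Rightarrow> comp \<Rightarrow> scalar" where
  "EW b z i f \<gamma> = aff_w n z i *
     (if b then qint (\<gamma> (i + 1)) * f (mv n i (i + 1) \<gamma>) else qint (\<gamma> i) * f (mv n (i + 1) i \<gamma>))"

definition FW :: "bool \<Rightarrow> scalar \<Rightarrow> int \<Rightarrow> (comp \<Rightarrow> scalar) \<Rightarrow> comp \<Rightarrow> scalar" where
  "FW b z i f \<gamma> = aff_w n (inverse z) i *
     (if b then qint (\<gamma> i) * f (mv n (i + 1) i \<gamma>) else qint (\<gamma> (i + 1)) * f (mv n i (i + 1) \<gamma>))"

definition BW :: "bool \<Rightarrow> scalar \<Rightarrow> int \<Rightarrow> (comp \<Rightarrow> scalar) \<Rightarrow> comp \<Rightarrow> scalar" where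
  "BW b z i f \<gamma> = FW b z i f \<gamma> +
     EW b z (i + h) (\<lambda>\<beta>. qq powi (- sg b * (\<beta> i - \<beta> (i + 1))) * f \<beta>) \<gamma>"

text \<open>The dual embedding counts ascents; these are the inversions of the word reflected by c
  to n + 1 - c, so one inversion count serves both embeddings.\<close>

definition embb :: "bool \<Rightarrow> (comp \<Rightarrow> scalar) \<Rightarrow> int list \<Rightarrow> scalar" where
  "embb b f w = qq powi (- dsc (if b then map refl_letter w else w)) * f (cont w)"

lemma refl_refl [simp]: "refl_letter (refl_letter c) = c"
  by (simp add: refl_letter_def)

lemma refl_o_refl [simp]: "refl_letter \<circ> refl_letter = id"
  by (simp add: fun_eq_iff)

lemma refl_range: "c \<in> {1..int n} \<Longrightarrow> refl_letter c \<in> {1..int n}"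
  by (auto simp: refl_letter_def)

lemma wds_refl: "w \<in> wds s \<Longrightarrow> map refl_letter w \<in> wds s"
  by (auto simp: wds_def refl_letter_def)

lemma cont_refl: "cont (map refl_letter w) k = cont w (1 - k)"
proof (induction w)
  case (Cons c w)
  have "k mod int n = (int n + 1 - c) mod int n \<longleftrightarrow> (1 - k) mod int n = c mod int n"
  proof -
    have "k - (int n + 1 - c) = - ((1 - k) - c) - int n" by simp
    then have "int n dvd k - (int n + 1 - c) \<longleftrightarrow> int n dvd (1 - k) - c"
      by (metis dvd_minus_iff dvd_diff_left_iff dvd_refl)
    then show ?thesis unfolding mod_eq_dvd_iff .
  qed
  then show ?case using Cons by (simp add: refl_letter_def evec_def)
qed simp

lemma letter_mod_refl:
  "(refl_letter c) mod int n = j mod int n \<longleftrightarrow> c mod int n = (1 - j) mod int n"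
proof -
  have "refl_letter c - j = int n - (c - (1 - j))" by (simp add: refl_letter_def)
  then have "int n dvd refl_letter c - j \<longleftrightarrow> int n dvd c - (1 - j)"
    by (metis dvd_diff_right_iff dvd_refl)
  then show ?thesis unfolding mod_eq_dvd_iff .
qed

lemma aff_w_neg: "aff_w n z (- i) = aff_w n z i"
  by (simp add: aff_w_def mod_eq_0_iff_dvd)

lemma kx_refl: "kx True i c = kx False (- i) (refl_letter c)"
proof -
  have "evec n (refl_letter c) j = evec n c (1 - j)" for j
  proof -
    have "j mod int n = refl_letter c mod int n \<longleftrightarrow> (1 - j) mod int n = c mod int n"
      using letter_mod_refl[of c j]
      by (simp only: eq_commute[of "j mod int n"] eq_commute[of "(1 - j) mod int n"])
    then show ?thesis unfolding evec_def by (rule arg_cong)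
  qed
  note r = this[of "- i"] this[of "- i + 1"]
  have e: "1 - - i = i + 1" "1 - (- i + 1) = i" by simp_all
  show ?thesis unfolding kx_def r e by simp
qed

lemma coeff_refl:
  "eC True z i c = eC False z (- i) (refl_letter c)" "fC True z i c = fC False z (- i) (refl_letter c)"
proof -
  have e: "1 - - i = i + 1" "1 - (- i + 1) = i" by simp_all
  note r = letter_mod_refl[of c "- i", unfolded e] letter_mod_refl[of c "- i + 1", unfolded e]
  show "eC True z i c = eC False z (- i) (refl_letter c)" "fC True z i c = fC False z (- i) (refl_letter c)"
    unfolding eC_def fC_def aff_w_neg if_True simp_thms if_False r by simp_all
qed

lemma step_refl:
  "c \<in> {1..int n} \<Longrightarrow> eS True c = refl_letter (eS False (refl_letter c))"
  "c \<in> {1..int n} \<Longrightarrow> fS True c = refl_letter (fS False (refl_letter c))"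
  by (auto simp: eS_def fS_def sc_def pr_def refl_letter_def)

lemma kX_refl: "length w = s \<Longrightarrow> kX (pms True y s) i w = kX (pms False y s) (- i) (map refl_letter w)"
  by (induction s arbitrary: w y) (auto simp: length_Suc_conv kx_refl)

text \<open>On the dual fundamental module E_i turns i into i + 1. The reflection sends these
  letters to -i + 1 and -i modulo n, and turning the former into the latter is the action of E_{-i}
  on the primal module. All dual formulas thus follow from primal ones at the node -i.\<close>

lemma EaFa_refl:
  assumes "w \<in> wds s"
  shows "Ea (pms True y s) i \<phi> w = Ea (pms False y s) (- i) (\<lambda>u. \<phi> (map refl_letter u)) (map refl_letter w)" (is ?t1)
    "Fa (pms True y s) i \<phi> w = Fa (pms False y s) (- i) (\<lambda>u. \<phi> (map refl_letter u)) (map refl_letter w)" (is ?t2)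
proof -
  have "?t1 \<and> ?t2"
    using assms
  proof (induction s arbitrary: w y \<phi>)
    case (Suc s)
    then obtain c u where w: "w = c # u" "c \<in> {1..int n}" "u \<in> wds s" using wds_Suc by auto
    have k: "kX (pms True (qq powi 2 * y) s) i u = kX (pms False (qq powi 2 * y) s) (- i) (map refl_letter u)"
      using w(3) by (intro kX_refl) (simp add: wds_def)
    note IH = Suc.IH[OF w(3), of "qq powi 2 * y" "\<lambda>v. \<phi> (c # v)"]
    show ?case
      unfolding w(1) pms.simps Ea.simps Fa.simps list.map kx_refl[of i c] coeff_refl[of _ i c]
        step_refl(1)[OF w(2)] step_refl(2)[OF w(2)] k conjunct1[OF IH] conjunct2[OF IH]
      by simp
  qed simp
  then show ?t1 ?t2
    by blast+
qed

lemma aff_w_cong: "i mod int n = j mod int n \<Longrightarrow> aff_w n z i = aff_w n z j"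
  by (simp add: aff_w_def)

lemma EaFa_emb:
  assumes w: "w \<in> wds s"
  shows "Ea (pms False (qq powi (1 - int s) * z) s) i (emb f) w =
      aff_w n z i * qint (cont w i) * qq powi (- dsc w) * f (mv n (i + 1) i (cont w))" (is ?t1)
    "Fa (pms False (qq powi (1 - int s) * z) s) i (emb f) w =
      aff_w n (inverse z) i * qint (cont w (i + 1)) * qq powi (- dsc w) * f (mv n i (i + 1) (cont w))" (is ?t2)
proof -
  define r where "r = (i - 1) mod int n + 1"
  have r: "r \<in> {1..int n}" "r mod int n = i mod int n"
    using rep_1_n[of "int n" i] n0 by (simp_all add: r_def)
  note r1 = Suc_mod_cong[OF r(2), of 1]
  have y: "qq powi (int s - 1) * (qq powi (1 - int s) * z) = z"
    unfolding qq_powi_mult by simp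
  note c = comps_mod[OF cont_comps[OF w] r(2)] comps_mod[OF cont_comps[OF w] r1]
  show ?t1
    using Ea_emb_letter[OF r(1) w, of "qq powi (1 - int s) * z" f]
    unfolding y c aff_w_cong[OF r(2)] mv_cong[OF r1 r(2)] EaFa_index_cong(1)[OF r(2)] .
  show ?t2
    using Fa_emb_letter[OF r(1) w, of "qq powi (1 - int s) * z" f]
    unfolding y c aff_w_cong[OF r(2)] mv_cong[OF r(2) r1] EaFa_index_cong(2)[OF r(2)] .
qed

lemma embb_False: "embb False f = emb f"
  by (rule ext) (simp add: embb_def emb_def)

lemma embb_True: "(\<lambda>u. embb True f (map refl_letter u)) = emb (\<lambda>\<beta>. f (\<lambda>k. \<beta> (1 - k)))"
proof -
  have "cont (map refl_letter u) = (\<lambda>k. cont u (1 - k))" for u by (rule ext) (rule cont_refl)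
  then show ?thesis by (intro ext) (simp add: embb_def emb_def)
qed

text \<open>The embedded vectors are stable under the generators and carry the Kirillov-Reshetikhin
  action. For dual factors, \<open>r1\<close> and \<open>r2\<close> translate moves at the node -i
  through the substitution of 1 - k for k.\<close>

lemma EaFa_embb:
  assumes w: "w \<in> wds s"
  shows "Ea (pms b (qq powi (1 - int s) * z) s) i (embb b f) w = embb b (EW b z i f) w" (is ?t1)
    "Fa (pms b (qq powi (1 - int s) * z) s) i (embb b f) w = embb b (FW b z i f) w" (is ?t2)
proof -
  have r1: "(\<lambda>k. mv n (- i + 1) (- i) (\<lambda>k. cont w (1 - k)) (1 - k)) = mv n i (i + 1) (cont w)"
    and r2: "(\<lambda>k. mv n (- i) (- i + 1) (\<lambda>k. cont w (1 - k)) (1 - k)) = mv n (i + 1) i (cont w)"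
  proof -
    have "(1 - k) mod int n = (- i + 1) mod int n \<longleftrightarrow> k mod int n = i mod int n"
      "(1 - k) mod int n = (- i) mod int n \<longleftrightarrow> k mod int n = (i + 1) mod int n" for k
    proof -
      have "(1 - k) - (- i + 1) = - (k - i)" "(1 - k) - (- i) = - (k - (i + 1))" by simp_all
      then show "(1 - k) mod int n = (- i + 1) mod int n \<longleftrightarrow> k mod int n = i mod int n"
        "(1 - k) mod int n = (- i) mod int n \<longleftrightarrow> k mod int n = (i + 1) mod int n"
        unfolding mod_eq_dvd_iff by (simp_all only: dvd_minus_iff)
    qed
    then show "(\<lambda>k. mv n (- i + 1) (- i) (\<lambda>k. cont w (1 - k)) (1 - k)) = mv n i (i + 1) (cont w)"
      "(\<lambda>k. mv n (- i) (- i + 1) (\<lambda>k. cont w (1 - k)) (1 - k)) = mv n (i + 1) i (cont w)"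
      by (auto simp: mv_def evec_def)
  qed
  have c: "cont (map refl_letter w) = (\<lambda>k. cont w (1 - k))"
    by (rule ext) (rule cont_refl)
  show ?t1
  proof (cases b)
    case True
    then have b: "b = True" by simp
    show ?thesis unfolding b EaFa_refl[OF w] embb_True EaFa_emb[OF wds_refl[OF w]] c r1 r2
      by (simp add: embb_def EW_def aff_w_neg mult_ac add.commute)
  next
    case False
    then show ?thesis by (simp add: embb_False EaFa_emb[OF w] EW_def) (simp add: emb_def EW_def mult_ac)
  qed
  show ?t2
  proof (cases b)
    case True
    then have b: "b = True" by simp
    show ?thesis unfolding b EaFa_refl[OF w] embb_True EaFa_emb[OF wds_refl[OF w]] c r1 r2
      by (simp add: embb_def FW_def aff_w_neg mult_ac add.commute)
  next
    case False
    then show ?thesis by (simp add: embb_False EaFa_emb[OF w] FW_def) (simp add: emb_def FW_def mult_ac)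
  qed
qed

lemma Ba_embb:
  assumes w: "w \<in> wds s"
  shows "Ba (pms b (qq powi (1 - int s) * z) s) i (embb b f) w = embb b (BW b z i f) w"
proof -
  let ?ms = "pms b (qq powi (1 - int s) * z) s"
  have "qq powi (- kX ?ms i u) * embb b f u =
      embb b (\<lambda>\<beta>. qq powi (- sg b * (\<beta> i - \<beta> (i + 1))) * f \<beta>) u" if "u \<in> wds s" for u
    using kX_pms[of u s b] that by (simp add: wds_def embb_def sg_def mult_ac)
  then have "Ba ?ms i (embb b f) w = Fa ?ms i (embb b f) w +
      Ea ?ms (i + h) (embb b (\<lambda>\<beta>. qq powi (- sg b * (\<beta> i - \<beta> (i + 1))) * f \<beta>)) w"
    unfolding Ba_def by (intro arg_cong2[where f = "(+)"] EaFa_cong(1)) (use w in auto)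
  then show ?thesis unfolding EaFa_embb[OF w] by (simp add: embb_def BW_def algebra_simps)
qed

section \<open>The bases and embeddings of the definitions expressed by words\<close>

lemma filter_cont:
  assumes "w \<in> wds s" "c \<in> {1..int n}"
  shows "int (length (filter (\<lambda>x. x < c) w)) = (\<Sum>j\<in>{1..<c}. cont w j)"
  using assms(1)
proof (induction w arbitrary: s)
  case (Cons a w)
  then obtain s' where "a \<in> {1..int n}" "w \<in> wds s'" by (cases s) (auto simp: wds_def)
  then show ?case using Cons.IH[of s'] sum_evec_below[of a c] assms(2) by (simp add: sum.distrib)
qed simp

lemma descs_Cons: "descs (c # w) = length (filter (\<lambda>x. x < c) w) + descs w"
proof -
  let ?P = "\<lambda>w. {(p, p'). p < p' \<and> p' < length w \<and> w ! p > w ! p'}"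
  let ?A = "{j. j < length w \<and> w ! j < c}"
  have fin: "finite (?P w)"
    by (rule finite_subset[of _ "{..<length w} \<times> {..<length w}"]) auto
  have "?P (c # w) = (\<lambda>j. (0, Suc j)) ` ?A \<union> (\<lambda>(p, p'). (Suc p, Suc p')) ` ?P w"
  proof (intro equalityI subsetI)
    fix x assume x: "x \<in> ?P (c # w)"
    obtain p p' where pp: "x = (p, p')" by force
    obtain k where k: "p' = Suc k" using x pp by (cases p') auto
    show "x \<in> (\<lambda>j. (0, Suc j)) ` ?A \<union> (\<lambda>(p, p'). (Suc p, Suc p')) ` ?P w"
      using x pp k by (cases p) auto
  qed auto
  then have "card (?P (c # w)) = card ((\<lambda>j. (0 :: nat, Suc j)) ` ?A) + card ((\<lambda>(p, p'). (Suc p, Suc p')) ` ?P w)"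
    by (simp only:) (subst card_Un_disjoint; use fin in auto)
  also have "card ((\<lambda>j. (0 :: nat, Suc j)) ` ?A) = card ?A"
    by (rule card_image) (auto simp: inj_on_def)
  also have "card ((\<lambda>(p, p'). (Suc p, Suc p')) ` ?P w) = card (?P w)"
    by (rule card_image) (auto simp: inj_on_def)
  finally show ?thesis unfolding descs_def length_filter_conv_card .
qed

lemma descs_dsc: "w \<in> wds s \<Longrightarrow> int (descs w) = dsc w"
proof (induction w arbitrary: s)
  case Nil
  then show ?case by (simp add: descs_def)
next
  case (Cons c w)
  then obtain s' where "c \<in> {1..int n}" "w \<in> wds s'" by (cases s) (auto simp: wds_def)
  then show ?case using Cons.IH[of s'] filter_cont[of w s' c] by (simp add: descs_Cons)
qed

lemma ascs_refl: "ascs w = descs (map refl_letter w)"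
proof -
  have "{(p, p'). p < p' \<and> p' < length w \<and> w ! p < w ! p'} =
    {(p, p'). p < p' \<and> p' < length (map refl_letter w) \<and> map refl_letter w ! p > map refl_letter w ! p'}"
    by (auto simp: refl_letter_def)
  then show ?thesis by (simp add: ascs_def descs_def)
qed

lemma count_cont: "w \<in> wds s \<Longrightarrow> i \<in> {1..int n} \<Longrightarrow> int (count_list w i) = cont w i"
proof (induction w arbitrary: s)
  case (Cons c w)
  then obtain s' where "c \<in> {1..int n}" "w \<in> wds s'" by (cases s) (auto simp: wds_def)
  then show ?case using Cons.IH[of s'] Cons.prems evec_letter[of c i] by auto
qed simp

lemma comps_eqI:
  assumes "\<alpha> \<in> comps n s" "\<beta> \<in> comps n s'" "\<And>i. i \<in> {1..int n} \<Longrightarrow> \<alpha> i = \<beta> i"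
  shows "\<alpha> = \<beta>"
proof
  fix k
  define r where "r = (k - 1) mod int n + 1"
  have r: "r \<in> {1..int n}" "r mod int n = k mod int n"
    using rep_1_n[of "int n" k] n0 by (simp_all add: r_def)
  show "\<alpha> k = \<beta> k"
    using assms(3)[OF r(1)] comps_mod[OF assms(1) r(2)] comps_mod[OF assms(2) r(2)] by simp
qed

lemma words_eq: "\<alpha> \<in> comps n s \<Longrightarrow> words n s \<alpha> = {w \<in> wds s. cont w = \<alpha>}"
  unfolding words_def using count_cont cont_comps comps_eqI[of _ s \<alpha> s]
  by (auto simp: wds_def)

lemma finite_wds: "finite (wds s)"
  unfolding wds_def using finite_lists_length_eq[of "{1..int n}" s] by (simp add: conj_commute)

lemma inj_evec_letter: "inj_on (evec n) {1..int n}"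
  by (rule inj_onI) (use evec_eq_iff mod_1_n_eq in blast)

lemma map_evec_inj: "w \<in> wds s \<Longrightarrow> w' \<in> wds s \<Longrightarrow> map (evec n) w = map (evec n) w' \<longleftrightarrow> w = w'"
  using inj_on_map_eq_map[of "evec n" w w'] inj_on_subset[OF inj_evec_letter]
  by (auto simp: wds_def)

lemma tbasis_eq: "tbasis n s = map (evec n) ` wds s"
proof (intro equalityI subsetI)
  fix l assume l: "l \<in> tbasis n s"
  then have "set l \<subseteq> evec n ` {1..int n}" using comps_1_eq[OF n0] by (simp add: tbasis_def)
  then have "l \<in> lists (evec n ` {1..int n})" by blast
  then have "l \<in> map (evec n) ` lists {1..int n}" by (simp add: lists_image)
  then show "l \<in> map (evec n) ` wds s" using l by (auto simp: wds_def tbasis_def)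
next
  fix l assume "l \<in> map (evec n) ` wds s"
  then show "l \<in> tbasis n s" using evec_in_comps[OF n0] by (auto simp: tbasis_def wds_def)
qed

lemma embed_sum:
  assumes w: "w \<in> wds s"
  shows "(\<Sum>\<alpha>\<in>comps n s. f \<alpha> * (\<Sum>w'\<in>words n s \<alpha>. g w' * of_bool (map (evec n) w = map (evec n) w')))
    = f (cont w) * (g w :: scalar)"
proof -
  have "(\<Sum>w'\<in>words n s \<alpha>. g w' * of_bool (map (evec n) w = map (evec n) w')) = (if cont w = \<alpha> then g w else 0)"
    if "\<alpha> \<in> comps n s" for \<alpha>
  proof -
    have "(\<Sum>w'\<in>words n s \<alpha>. g w' * of_bool (map (evec n) w = map (evec n) w')) =
        (\<Sum>w'\<in>{w \<in> wds s. cont w = \<alpha>}. if w' = w then g w else 0)"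
      unfolding words_eq[OF that] by (rule sum.cong) (use map_evec_inj[OF w] in auto)
    then show ?thesis using w finite_wds by (simp add: sum.delta)
  qed
  then have "(\<Sum>\<alpha>\<in>comps n s. f \<alpha> * (\<Sum>w'\<in>words n s \<alpha>. g w' * of_bool (map (evec n) w = map (evec n) w')))
     = (\<Sum>\<alpha>\<in>comps n s. if \<alpha> = cont w then f (cont w) * g w else 0)"
    by (intro sum.cong) auto
  then show ?thesis using finite_comps[OF n0] cont_comps[OF w] by simp
qed

lemma embed_outside:
  assumes "l \<notin> tbasis n s"
  shows "(\<Sum>\<alpha>\<in>comps n s. f \<alpha> * (\<Sum>w'\<in>words n s \<alpha>. g w' * of_bool (l = map (evec n) w'))) = (0 :: scalar)"
  using assms words_eq unfolding tbasis_eq by (intro sum.neutral ballI) (auto intro!: sum.neutral)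

lemma embed_word: "w \<in> wds s \<Longrightarrow> embed n s f (map (evec n) w) = embb False f w"
  unfolding embed_def embed_sum[where g = "\<lambda>w'. qq powi (- int (descs w'))"]
  by (simp add: embb_def descs_dsc)

lemma embed_dual_word: "w \<in> wds s \<Longrightarrow> embed_dual n s f (map (evec n) w) = embb True f w"
  unfolding embed_dual_def embed_sum[where g = "\<lambda>w'. qq powi (- int (ascs w'))"]
  using descs_dsc[OF wds_refl, of w s] by (simp add: embb_def ascs_refl)

end

text \<open>A negative power of q vanishes at q = infinity, so it cannot be 1. This is how weight
  identities are read off from equations between powers of q.\<close>

lemma qq_powi_inject: "qq powi a = qq powi b \<longleftrightarrow> a = b"
proof
  assume eq: "qq powi a = qq powi b"
  have le: "a \<ge> b" if "qq powi a = qq powi b" for a b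
  proof (rule ccontr)
    assume ab: "\<not> a \<ge> b"
    have "qq powi (a - b) = 1"
      using that qq_nonzero by (simp add: power_int_diff)
    then have "place 0 (1 :: scalar) (0 :: ratx)"
      using place_0_qq_powi[of "a - b"] ab by simp
    then show False using place_unique[OF place_1] by fastforce
  qed
  show "a = b" using le[OF eq] le[OF eq[symmetric]] by simp
qed simp

context even_rank
begin

section \<open>The R-matrix\<close>

definition modl :: "bool \<Rightarrow> scalar \<Rightarrow> comp umodule" where
  "modl b z = affinize n (if b then dual_KR n 1 else KR n 1) z"

lemma basis_modl: "basis (modl b z) = comps n 1"
  by (simp add: modl_def affinize_def KR_def dual_KR_def)

lemma sum_comps_1: "(\<Sum>d\<in>comps n 1. g d) = (\<Sum>j\<in>{1..int n}. g (evec n j))"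
  unfolding comps_1_eq[OF n0] by (rule sum.reindex[OF inj_evec_letter, unfolded o_def])

lemma evec_letter_eq: "c \<in> {1..int n} \<Longrightarrow> c' \<in> {1..int n} \<Longrightarrow> evec n c = evec n c' \<longleftrightarrow> c = c'"
  using inj_evec_letter by (auto simp: inj_on_def)

lemma Eop_modl:
  assumes "c \<in> comps n 1"
  shows "Eop (modl b z) i c (evec n j) =
      of_bool (j mod int n = (if b then i else i + 1) mod int n \<and> c = evec n (if b then i + 1 else i)) * aff_w n z i"
    "Fop (modl b z) i c (evec n j) =
      of_bool (j mod int n = (if b then i + 1 else i) mod int n \<and> c = evec n (if b then i else i + 1)) * aff_w n (inverse z) i"
  using KR_columns[OF n4 assms] by (auto simp: modl_def)

lemma sum_pick_letter:
  "(\<Sum>j\<in>{1..int n}. of_bool (j mod int n = k mod int n) * f (evec n j)) = (f (evec n k) :: scalar)"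
proof -
  define r where "r = (k - 1) mod int n + 1"
  have r: "r \<in> {1..int n}" "r mod int n = k mod int n"
    using rep_1_n[of "int n" k] n0 by (simp_all add: r_def)
  have "j mod int n = k mod int n \<longleftrightarrow> j = r" if "j \<in> {1..int n}" for j
    using mod_1_n_eq[of j "int n" r] r that by metis
  then have "(\<Sum>j\<in>{1..int n}. of_bool (j mod int n = k mod int n) * f (evec n j)) =
      (\<Sum>j\<in>{1..int n}. if j = r then f (evec n r) else 0)"
    by (intro sum.cong) auto
  also have "\<dots> = f (evec n k)" using r evec_eq_iff[of n r k] by simp
  finally show ?thesis .
qed

lemma evec_eS:
  assumes "c \<in> {1..int n}"
  shows "eC b z i c * g (evec n (eS b c)) = of_bool (c mod int n = (if b then i + 1 else i) mod int n) *
      aff_w n z i * g (evec n (if b then i else i + 1))" (is ?t1)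
    "fC b z i c * g (evec n (fS b c)) = of_bool (c mod int n = (if b then i else i + 1) mod int n) *
      aff_w n (inverse z) i * g (evec n (if b then i + 1 else i))" (is ?t2)
proof -
  have s: "c mod int n = k mod int n \<Longrightarrow> evec n (sc c) = evec n (k + 1)" for k
    unfolding evec_eq_iff sc_mod by (rule Suc_mod_cong)
  have p: "c mod int n = (k + 1) mod int n \<Longrightarrow> evec n (pr c) = evec n k" for k
    unfolding evec_eq_iff using Suc_mod_cong[of c "k + 1" "- 1"] Suc_mod_cong[of "int n" 0 "-1"]
    by (auto simp: pr_def)
  show ?t1 ?t2
    using s[of i] p[of i] by (cases b; auto simp: eC_def fC_def eS_def fS_def)+
qed

lemma row_EF:
  assumes "c \<in> {1..int n}"
  shows "(\<Sum>d\<in>comps n 1. Eop (modl b z) i (evec n c) d * g d) = eC b z i c * g (evec n (eS b c))" (is ?t1)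
    "(\<Sum>d\<in>comps n 1. Fop (modl b z) i (evec n c) d * g d) = fC b z i c * g (evec n (fS b c))" (is ?t2)
proof -
  have a: "of_bool (P \<and> Q) * x * y = of_bool P * (of_bool Q * x * (y :: scalar))" for P Q x y
    by (cases P; cases Q) simp_all
  show ?t1 ?t2
    unfolding evec_eS[OF assms] sum_comps_1 Eop_modl[OF evec_in_comps[OF n0]] a evec_eq_iff
    by (rule sum_pick_letter)+
qed

text \<open>The matrix of E_i on the dual fundamental module is the transpose of its matrix on the
  primal one, and likewise for F_i; a column is therefore a row for the negated flag.\<close>

lemma col_EF:
  assumes "c \<in> {1..int n}"
  shows "(\<Sum>d\<in>comps n 1. g d * Eop (modl b z) i d (evec n c)) = eC (\<not> b) z i c * g (evec n (eS (\<not> b) c))" (is ?t1)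
    "(\<Sum>d\<in>comps n 1. g d * Fop (modl b z) i d (evec n c)) = fC (\<not> b) z i c * g (evec n (fS (\<not> b) c))" (is ?t2)
proof -
  have a: "y * (of_bool (P \<and> Q) * x) = of_bool Q * (of_bool P * x * (y :: scalar))" for P Q x y
    by (cases P; cases Q) simp_all
  have k: "evec n j = evec n k \<longleftrightarrow> j mod int n = k mod int n" for j k by (rule evec_eq_iff)
  show ?t1 ?t2
    unfolding evec_eS[OF assms] sum_comps_1 Eop_modl[OF evec_in_comps[OF n0]] a k
    by (subst sum_pick_letter; cases b; simp)+
qed

lemma Kop_modl:
  "Kop (modl b z) i c (evec n j) = of_bool (c = evec n j) * qq powi (kx b i j)"
  "Kiop (modl b z) i c (evec n j) = of_bool (c = evec n j) * qq powi (- kx b i j)"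
  by (auto simp: modl_def affinize_def KR_def dual_KR_def kx_def)

lemma row_K:
  assumes "c \<in> {1..int n}"
  shows "(\<Sum>d\<in>comps n 1. Kop (modl b z) i (evec n c) d * g d) = qq powi (kx b i c) * g (evec n c)" (is ?t1)
    "(\<Sum>d\<in>comps n 1. Kiop (modl b z) i (evec n c) d * g d) = qq powi (- kx b i c) * g (evec n c)" (is ?t2)
    "(\<Sum>d\<in>comps n 1. idm (evec n c) d * g d) = g (evec n c)" (is ?t3)
proof -
  have a: "of_bool (Q) * x * y = of_bool Q * (x * (y :: scalar))" for Q x y by simp
  have "(\<Sum>j\<in>{1..int n}. of_bool (evec n c = evec n j) * (f j :: scalar)) = f c" for f
  proof -
    have "(\<Sum>j\<in>{1..int n}. of_bool (evec n c = evec n j) * f j) = (\<Sum>j\<in>{1..int n}. if j = c then f c else 0)"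
      by (rule sum.cong) (use assms evec_letter_eq in auto)
    then show ?thesis using assms by simp
  qed
  then show ?t1 ?t2 ?t3
    unfolding sum_comps_1 Kop_modl a idm_def by simp_all
qed

lemma col_K:
  assumes "c \<in> {1..int n}"
  shows "(\<Sum>d\<in>comps n 1. g d * Kop (modl b z) i d (evec n c)) = qq powi (kx b i c) * g (evec n c)" (is ?t1)
    "(\<Sum>d\<in>comps n 1. g d * Kiop (modl b z) i d (evec n c)) = qq powi (- kx b i c) * g (evec n c)" (is ?t2)
    "(\<Sum>d\<in>comps n 1. g d * idm d (evec n c)) = g (evec n c)" (is ?t3)
proof -
  have "(\<Sum>j\<in>{1..int n}. f j * (of_bool (evec n j = evec n c) * (y :: scalar))) = f c * y" for f y
  proof -
    have "(\<Sum>j\<in>{1..int n}. f j * (of_bool (evec n j = evec n c) * y)) = (\<Sum>j\<in>{1..int n}. if j = c then f c * y else 0)"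
      by (rule sum.cong) (use assms evec_letter_eq in auto)
    then show ?thesis using assms by simp
  qed
  note s = this[of "\<lambda>j. g (evec n j)"]
  show ?t1 ?t2
    unfolding sum_comps_1 Kop_modl s by (rule mult.commute)+
  show ?t3
    unfolding sum_comps_1 idm_def using s[of 1] by (simp only: mult_1_right)
qed

definition tmod :: "bool \<Rightarrow> scalar \<Rightarrow> bool \<Rightarrow> scalar \<Rightarrow> (comp \<times> comp) umodule" where
  "tmod b z b' z' = tensor (modl b z) (modl b' z')"

lemma basis_tmod: "basis (tmod b z b' z') = comps n 1 \<times> comps n 1"
  by (simp add: tmod_def tensor_def basis_modl)

lemma sum_mtensor_row:
  "(\<Sum>d\<in>comps n 1 \<times> comps n 1. mtensor S T (c, c') d * g d) =
     (\<Sum>d\<in>comps n 1. S c d * (\<Sum>d'\<in>comps n 1. T c' d' * (g (d, d') :: scalar)))"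
  by (simp add: mtensor_def sum_distrib_left mult.assoc sum.cartesian_product split_def)

lemma sum_mtensor_col:
  "(\<Sum>d\<in>comps n 1 \<times> comps n 1. g d * mtensor S T d (c, c')) =
     (\<Sum>d\<in>comps n 1. (\<Sum>d'\<in>comps n 1. (g (d, d') :: scalar) * T d' c') * S d c)"
proof -
  have "(\<Sum>d\<in>comps n 1. (\<Sum>d'\<in>comps n 1. g (d, d') * T d' c') * S d c) =
      (\<Sum>d\<in>comps n 1. \<Sum>d'\<in>comps n 1. g (d, d') * mtensor S T (d, d') (c, c'))"
    by (simp add: mtensor_def sum_distrib_right sum_distrib_left mult_ac)
  then show ?thesis by (simp add: sum.cartesian_product split_def)
qed

lemma tmod_row:
  assumes "c \<in> {1..int n}" "c' \<in> {1..int n}"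
  shows "(\<Sum>d\<in>comps n 1 \<times> comps n 1. Eop (tmod b z b' z') i (evec n c, evec n c') d * g d) =
      eC b z i c * g (evec n (eS b c), evec n c') +
      qq powi (kx b i c) * (eC b' z' i c' * g (evec n c, evec n (eS b' c')))"
    "(\<Sum>d\<in>comps n 1 \<times> comps n 1. Fop (tmod b z b' z') i (evec n c, evec n c') d * g d) =
      fC b z i c * (qq powi (- kx b' i c') * g (evec n (fS b c), evec n c')) +
      fC b' z' i c' * g (evec n c, evec n (fS b' c'))"
    "(\<Sum>d\<in>comps n 1 \<times> comps n 1. Kop (tmod b z b' z') i (evec n c, evec n c') d * g d) =
      qq powi (kx b i c) * (qq powi (kx b' i c') * g (evec n c, evec n c'))"
    "(\<Sum>d\<in>comps n 1 \<times> comps n 1. Kiop (tmod b z b' z') i (evec n c, evec n c') d * g d) =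
      qq powi (- kx b i c) * (qq powi (- kx b' i c') * g (evec n c, evec n c'))"
  unfolding tmod_def tensor_def umodule.simps distrib_right sum.distrib sum_mtensor_row
    row_EF[OF assms(1)] row_EF[OF assms(2)] row_K[OF assms(1)] row_K[OF assms(2)] by simp_all

lemma tmod_col:
  assumes "c \<in> {1..int n}" "c' \<in> {1..int n}"
  shows "(\<Sum>d\<in>comps n 1 \<times> comps n 1. g d * Eop (tmod b z b' z') i d (evec n c, evec n c')) =
      eC (\<not> b) z i c * g (evec n (eS (\<not> b) c), evec n c') +
      qq powi (kx b i c) * (eC (\<not> b') z' i c' * g (evec n c, evec n (eS (\<not> b') c')))"
    "(\<Sum>d\<in>comps n 1 \<times> comps n 1. g d * Fop (tmod b z b' z') i d (evec n c, evec n c')) =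
      fC (\<not> b) z i c * (qq powi (- kx b' i c') * g (evec n (fS (\<not> b) c), evec n c')) +
      fC (\<not> b') z' i c' * g (evec n c, evec n (fS (\<not> b') c'))"
    "(\<Sum>d\<in>comps n 1 \<times> comps n 1. g d * Kop (tmod b z b' z') i d (evec n c, evec n c')) =
      qq powi (kx b i c) * (qq powi (kx b' i c') * g (evec n c, evec n c'))"
    "(\<Sum>d\<in>comps n 1 \<times> comps n 1. g d * Kiop (tmod b z b' z') i d (evec n c, evec n c')) =
      qq powi (- kx b i c) * (qq powi (- kx b' i c') * g (evec n c, evec n c'))"
  unfolding tmod_def tensor_def umodule.simps distrib_left sum.distrib sum_mtensor_col
    col_EF[OF assms(1)] col_EF[OF assms(2)] col_K[OF assms(1)] col_K[OF assms(2)] by simp_all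

text \<open>The entries of \<open>R(u, v)\<close> from \<open>v\<^sub>a\<^sup>\<or> \<otimes> v\<^sub>a\<close> to \<open>v\<^sub>b \<otimes> v\<^sub>b\<^sup>\<or>\<close>, where
  \<open>p = - q\<^sup>-\<^sup>1\<close> and \<open>r = v / u\<close>: the solution of the cyclic recursion that the generators impose.\<close>

definition Cc :: "scalar \<Rightarrow> scalar \<Rightarrow> int \<Rightarrow> int \<Rightarrow> scalar" where
  "Cc p r a b = (if a = b then p powi (int n - 1) * r - p
     else (if a < b then r * p powi (a - b - 1 + int n) else p powi (a - b - 1)) * (1 - p ^ 2)) /
     (1 - p powi int n * r)"

definition rho :: "scalar \<Rightarrow> int \<Rightarrow> scalar" where
  "rho r a = (if a = int n then r else 1)"

text \<open>Off the diagonal the entries are geometric with ratio p in a - b, picking up the factor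
  r once around the cycle, which is recorded by \<open>rho\<close>. The inhomogeneous terms are the
  jumps where the diagonal is entered or left.\<close>

lemma Cc_rec:
  assumes p: "p \<noteq> 0" and d: "1 - p powi int n * r \<noteq> 0"
    and a: "a \<in> {1..int n}" and b: "b \<in> {1..int n}"
  shows "Cc p r (sc a) b = p * rho r a * Cc p r a b + rho r a * of_bool (b = a) - p * of_bool (b = sc a)" (is ?t1)
    "Cc p r a b = p * rho r b * Cc p r a (sc b) - p * of_bool (a = b) + rho r b * of_bool (a = sc b)" (is ?t2)
proof -
  have s: "p powi (k + 1) = p * p powi k" for k
    using p by (simp add: power_int_add)
  have e: "p powi int n = p * p powi (int n - 1)" "p powi (int n - 1) = p * p powi (int n - 2)"
    using s[of "int n - 1"] s[of "int n - 2"] by simp_all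
  let ?d = "1 - p powi int n * r"
  have A: "Cc p r a a = (p powi (int n - 1) * r - p) / ?d" for a by (simp add: Cc_def)
  have G: "b < a \<Longrightarrow> Cc p r a b = p powi (a - b - 1) * (1 - p ^ 2) / ?d" for a b by (simp add: Cc_def)
  have L: "a < b \<Longrightarrow> Cc p r a b = r * p powi (a - b - 1 + int n) * (1 - p ^ 2) / ?d" for a b by (simp add: Cc_def)
  have Gs: "b < a \<Longrightarrow> p * Cc p r a b = p powi (a - b) * (1 - p ^ 2) / ?d" for a b
    using G[of b a] s[of "a - b - 1"] by simp
  have Ls: "a < b \<Longrightarrow> p * Cc p r a b = r * p powi (a - b + int n) * (1 - p ^ 2) / ?d" for a b
    using L[of a b] s[of "a - b - 1 + int n"] by (simp add: algebra_simps)
  \<comment> \<open>\<open>A1\<close> is the jump when leaving the diagonal, \<open>A2\<close> the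
    one when reaching it. The value (p^(n-1) r - p) / (1 - p^n r) on the diagonal makes both
    hold.\<close>
  have A1: "p * Cc p r a a + 1 = (1 - p ^ 2) / ?d" for a
    unfolding A using d e by (simp add: field_simps power2_eq_square)
  have A2: "p * (r * p powi (int n - 2) * (1 - p ^ 2) / ?d) - p = Cc p r a a" for a
    unfolding A using d e by (simp add: field_simps power2_eq_square)
  show ?t1
  proof (cases "a = int n")
    case True
    have sa: "sc a = 1" using True by (simp add: sc_def)
    consider "b = int n" | "b = 1" | "1 < b" "b < int n" using b by fastforce
    then show ?thesis
    proof cases
      case 1
      have "Cc p r 1 b = r * ((1 - p ^ 2) / ?d)" using L[of 1 b] 1 n4 by simp
      also have "\<dots> = r * (p * Cc p r a a + 1)" unfolding A1 ..
      finally show ?thesis using 1 True sa n4 by (simp add: rho_def algebra_simps)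
    next
      case 2
      then show ?thesis using True sa n4 A2[of 1] G[of 1 "int n"] by (simp add: rho_def algebra_simps)
    next
      case 3
      then show ?thesis using True sa Gs[of b "int n"] L[of 1 b]
        by (simp add: rho_def mult.assoc mult.left_commute[of p r])
    qed
  next
    case False
    have sa: "sc a = a + 1" using False by (simp add: sc_def)
    consider "b < a" | "b = a" | "b = a + 1" | "b > a + 1" by linarith
    then show ?thesis
    proof cases
      case 1
      then show ?thesis using False sa Gs[of b a] G[of b "a + 1"] by (simp add: rho_def)
    next
      case 2
      then show ?thesis using False sa A1[of a] G[of b "a + 1"] by (simp add: rho_def)
    next
      case 3
      then show ?thesis using False sa A2[of "a + 1"] L[of a b] by (simp add: rho_def)
    next
      case 4
      then show ?thesis using False sa Ls[of a b] L[of "a + 1" b] by (simp add: rho_def)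
    qed
  qed
  show ?t2
  proof (cases "b = int n")
    case True
    have sb: "sc b = 1" using True by (simp add: sc_def)
    consider "a = int n" | "a = 1" | "1 < a" "a < int n" using a by fastforce
    then show ?thesis
    proof cases
      case 1
      then show ?thesis using True sb n4 A2[of a] G[of 1 a] by (simp add: rho_def algebra_simps)
    next
      case 2
      have "Cc p r 1 b = r * ((1 - p ^ 2) / ?d)" using L[of 1 b] True n4 by simp
      also have "\<dots> = r * (p * Cc p r 1 1 + 1)" unfolding A1 ..
      finally show ?thesis using 2 True sb n4 by (simp add: rho_def algebra_simps)
    next
      case 3
      then show ?thesis using True sb Gs[of 1 a] L[of a b]
        by (simp add: rho_def mult.assoc mult.left_commute[of p r])
    qed
  next
    case False
    have sb: "sc b = b + 1" using False by (simp add: sc_def)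
    consider "b + 1 < a" | "b = a" | "a = b + 1" | "b > a" by linarith
    then show ?thesis
    proof cases
      case 1
      then show ?thesis using False sb Gs[of "b + 1" a] G[of b a] by (simp add: rho_def diff_diff_eq)
    next
      case 2
      then show ?thesis using False sb A2[of a] L[of a "b + 1"] by (simp add: rho_def)
    next
      case 3
      then show ?thesis using False sb A1[of a] G[of b a] by (simp add: rho_def)
    next
      case 4
      then show ?thesis using False sb Ls[of a "b + 1"] L[of a b] by (simp add: rho_def diff_diff_eq)
    qed
  qed
qed

lemma sum_letter: "a \<in> {1..int n} \<Longrightarrow> (\<Sum>b\<in>{1..int n}. f b * of_bool (b = a)) = (f a :: scalar)"
  by (simp add: of_bool_def if_distrib[of "\<lambda>x. _ * x"] sum.delta cong: if_cong)

lemma sc_range: "a \<in> {1..int n} \<Longrightarrow> sc a \<in> {1..int n}"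
  using n4 by (auto simp: sc_def)

text \<open>Going once around the cycle multiplies g by p^n r, which is different from 1.\<close>

lemma rec_zero:
  fixes g :: "int \<Rightarrow> scalar"
  assumes rec: "\<And>a. a \<in> {1..int n} \<Longrightarrow> g (sc a) = p * rho r a * g a"
    and d: "1 - p powi int n * r \<noteq> 0" and a: "a \<in> {1..int n}"
  shows "g a = 0"
proof -
  have *: "g (int (Suc k)) = p ^ k * g 1" if "Suc k \<le> n" for k
    using that
  proof (induction k)
    case (Suc k)
    then show ?case using rec[of "int (Suc k)"] by (simp add: sc_def rho_def add.commute)
  qed simp
  have "g (int n) = p ^ (n - 1) * g 1" using *[of "n - 1"] n0 by simp
  then have "g 1 = p * r * (p ^ (n - 1) * g 1)"
    using rec[of "int n"] n4 by (simp add: sc_def rho_def)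
  also have "\<dots> = p powi int n * r * g 1"
    using n0 by (simp add: power_eq_if[of p n])
  finally have "(1 - p powi int n * r) * g 1 = 0" by (simp add: algebra_simps)
  then have "g 1 = 0" using d by simp
  moreover have "a = int (Suc (nat a - 1))" "Suc (nat a - 1) \<le> n" using a by auto
  ultimately show ?thesis using *[of "nat a - 1"] by simp
qed

lemma rec_zero':
  fixes g :: "int \<Rightarrow> scalar"
  assumes rec: "\<And>a. a \<in> {1..int n} \<Longrightarrow> g a = p * rho r a * g (sc a)"
    and d: "1 - p powi int n * r \<noteq> 0" and a: "a \<in> {1..int n}"
  shows "g a = 0"
proof -
  have *: "g (int n - int k) = p ^ k * g (int n)" if "k < n" for k
    using that
  proof (induction k)
    case (Suc k)
    then show ?case using rec[of "int n - int (Suc k)"] by (simp add: sc_def rho_def)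
  qed simp
  have "g 1 = p ^ (n - 1) * g (int n)" using *[of "n - 1"] n0 by (simp add: of_nat_diff)
  then have "g (int n) = p * r * (p ^ (n - 1) * g (int n))"
    using rec[of "int n"] n4 by (simp add: sc_def rho_def)
  also have "\<dots> = p powi int n * r * g (int n)"
    using n0 by (simp add: power_eq_if[of p n])
  finally have "(1 - p powi int n * r) * g (int n) = 0" by (simp add: algebra_simps)
  then have "g (int n) = 0" using d by simp
  moreover have "a = int n - int (n - nat a)" "n - nat a < n" using a by auto
  ultimately show ?thesis using *[of "n - nat a"] by simp
qed

lemma rho_inverse: "r \<noteq> 0 \<Longrightarrow> rho r a * rho (inverse r) a = 1"
  by (simp add: rho_def)

text \<open>By \<open>Cc_rec\<close>, the product minus the identity matrix satisfies the
  homogeneous cyclic recursion in one index, the inhomogeneous terms of the two factors cancelling.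
  Hence it vanishes by \<open>rec_zero\<close> or \<open>rec_zero'\<close>.\<close>

lemma Cc_inverse:
  assumes p: "p \<noteq> 0" and r: "r \<noteq> 0" and d: "1 - p powi int n * r \<noteq> 0" and d': "1 - p powi int n * inverse r \<noteq> 0"
    and a: "a \<in> {1..int n}" and e: "e \<in> {1..int n}"
  shows "(\<Sum>b\<in>{1..int n}. Cc p r a b * Cc p (inverse r) e b) = of_bool (a = e)" (is ?t1)
    "(\<Sum>b\<in>{1..int n}. Cc p (inverse r) b a * Cc p r b e) = of_bool (a = e)" (is ?t2)
proof -
  define g where "g a = (\<Sum>b\<in>{1..int n}. Cc p r a b * Cc p (inverse r) e b) - of_bool (a = e)" for a
  have "g (sc a) = p * rho r a * g a" if a: "a \<in> {1..int n}" for a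
  proof -
    have "(\<Sum>b\<in>{1..int n}. Cc p r (sc a) b * Cc p (inverse r) e b) =
        (\<Sum>b\<in>{1..int n}. p * rho r a * (Cc p r a b * Cc p (inverse r) e b) +
          rho r a * (Cc p (inverse r) e b * of_bool (b = a)) - p * (Cc p (inverse r) e b * of_bool (b = sc a)))"
      by (rule sum.cong) (auto simp: Cc_rec(1)[OF p d a] algebra_simps)
    also have "\<dots> = p * rho r a * (\<Sum>b\<in>{1..int n}. Cc p r a b * Cc p (inverse r) e b) +
        rho r a * Cc p (inverse r) e a - p * Cc p (inverse r) e (sc a)"
      unfolding sum_subtractf sum.distrib sum_distrib_left[symmetric] sum_letter[OF a] sum_letter[OF sc_range[OF a]] ..
    also have "rho r a * Cc p (inverse r) e a = rho r a * rho (inverse r) a * (p * Cc p (inverse r) e (sc a) + of_bool (e = sc a))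
        - p * rho r a * of_bool (e = a)"
      unfolding Cc_rec(2)[OF p d' e a] by (simp add: algebra_simps)
    finally show ?thesis unfolding g_def rho_inverse[OF r] by (auto simp: algebra_simps)
  qed
  from rec_zero[of g, OF this d a] show ?t1
    by (simp add: g_def)
  define g' where "g' a = (\<Sum>b\<in>{1..int n}. Cc p (inverse r) b a * Cc p r b e) - of_bool (a = e)" for a
  have "g' a = p * rho (inverse r) a * g' (sc a)" if a: "a \<in> {1..int n}" for a
  proof -
    have "(\<Sum>b\<in>{1..int n}. Cc p (inverse r) b a * Cc p r b e) =
        (\<Sum>b\<in>{1..int n}. p * rho (inverse r) a * (Cc p (inverse r) b (sc a) * Cc p r b e) -
          p * (Cc p r b e * of_bool (b = a)) + rho (inverse r) a * (Cc p r b e * of_bool (b = sc a)))"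
      by (rule sum.cong) (auto simp: Cc_rec(2)[OF p d' _ a] algebra_simps)
    also have "\<dots> = p * rho (inverse r) a * (\<Sum>b\<in>{1..int n}. Cc p (inverse r) b (sc a) * Cc p r b e) -
        p * Cc p r a e + rho (inverse r) a * Cc p r (sc a) e"
      unfolding sum_subtractf sum.distrib sum_distrib_left[symmetric] sum_letter[OF a] sum_letter[OF sc_range[OF a]] ..
    also have "rho (inverse r) a * Cc p r (sc a) e = rho r a * rho (inverse r) a * (p * Cc p r a e + of_bool (e = a))
        - p * rho (inverse r) a * of_bool (e = sc a)"
      unfolding Cc_rec(1)[OF p d a e] by (simp add: algebra_simps)
    finally show ?thesis unfolding g'_def rho_inverse[OF r] by (auto simp: algebra_simps)
  qed
  from rec_zero'[of g', OF this d' a] show ?t2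
    by (simp add: g'_def)
qed

end

lemma intertwines_sum:
  assumes "intertwines M N T X Y" "finite (basis M)" "finite (basis N)" "c \<in> basis N"
  shows "(\<Sum>d\<in>basis N. Y c d * (\<Sum>b\<in>basis M. T d b * \<phi> b)) =
    (\<Sum>b\<in>basis M. T c b * (\<Sum>d\<in>basis M. X b d * \<phi> d))"
proof -
  have "(\<Sum>d\<in>basis N. Y c d * (\<Sum>b\<in>basis M. T d b * \<phi> b)) =
      (\<Sum>b\<in>basis M. (\<Sum>d\<in>basis N. Y c d * T d b) * \<phi> b)"
    unfolding sum_distrib_left sum_distrib_right by (subst sum.swap) (simp add: mult.assoc)
  also have "\<dots> = (\<Sum>b\<in>basis M. (\<Sum>d\<in>basis M. T c d * X d b) * \<phi> b)"
    using assms(1,4) by (intro sum.cong) (auto simp: intertwines_def eq_on_def mmul_def)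
  also have "\<dots> = (\<Sum>b\<in>basis M. T c b * (\<Sum>d\<in>basis M. X b d * \<phi> d))"
    unfolding sum_distrib_left sum_distrib_right by (subst sum.swap) (simp add: mult.assoc)
  finally show ?thesis .
qed

context even_rank
begin

lemma coeff_index_cong:
  assumes eq: "i mod int n = j mod int n"
  shows "eC b z i c = eC b z j c" "fC b z i c = fC b z j c"
  using Suc_mod_cong[OF eq, of 1] eq by (cases b; simp add: eC_def fC_def aff_w_def)+

section \<open>An explicit isomorphism and the shape of every isomorphism\<close>

definition lt :: "comp \<Rightarrow> int" where
  "lt = the_inv_into {1..int n} (evec n)"

lemma lt_evec: "c \<in> {1..int n} \<Longrightarrow> lt (evec n c) = c"
  unfolding lt_def by (rule the_inv_into_f_f[OF inj_evec_letter])

text \<open>Two different letters are swapped, since their tensor spans a weight space; pairs of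
  equal letters form the space of weight zero, on which the matrix C acts.\<close>

definition Tl :: "(int \<Rightarrow> int \<Rightarrow> scalar) \<Rightarrow> int \<Rightarrow> int \<Rightarrow> int \<Rightarrow> int \<Rightarrow> scalar" where
  "Tl C c1 c2 b1 b2 = (if b1 = b2 then of_bool (c1 = c2) * C c1 b1 else of_bool (c1 = b2 \<and> c2 = b1))"

lemma letter_forms:
  assumes i: "i \<in> {1..int n}" and c: "c \<in> {1..int n}"
  shows "kx b i c = (if b then -1 else 1) * (of_bool (c = i) - of_bool (c = sc i))" (is ?t1)
    "eC False z i c * g (eS False c) = of_bool (c = i) * (rho z i * g (sc i))" (is ?t2)
    "eC True z i c * g (eS True c) = of_bool (c = sc i) * (rho z i * g i)" (is ?t3)
    "fC False z i c * g (fS False c) = of_bool (c = sc i) * (inverse (rho z i) * g i)" (is ?t4)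
    "fC True z i c * g (fS True c) = of_bool (c = i) * (inverse (rho z i) * g (sc i))" (is ?t5)
proof -
  note si = sc_range[OF i]
  show ?t1
    using evec_letter[OF c i] evec_letter[OF c si] evec_index_cong[OF sc_mod[of i]] by (simp add: kx_def)
  have 1: "c mod int n = i mod int n \<longleftrightarrow> c = i"
    using mod_1_n_eq[OF c i] by blast
  have 2: "c mod int n = (i + 1) mod int n \<longleftrightarrow> c = sc i"
    using mod_1_n_eq[OF c si] sc_mod[of i] by metis
  have 3: "i mod int n = 0 \<longleftrightarrow> i = int n"
    using mod_1_n_eq[OF i, of "int n"] n0 by auto
  have 4: "pr (sc i) = i" using i n4 by (auto simp: pr_def sc_def)
  show ?t2 ?t3 ?t4 ?t5
    by (auto simp: eC_def fC_def 1 2 aff_w_def 3 rho_def eS_def fS_def 4)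
qed

lemma sc_neq: "i \<in> {1..int n} \<Longrightarrow> sc i \<noteq> i"
  using n4 by (auto simp: sc_def)

lemma step_letters: "eS b c \<in> {1..int n}" "fS b c \<in> {1..int n}" if "c \<in> {1..int n}"
  using step_range[OF that] by auto

lemma sum_pairs: "(\<Sum>d\<in>comps n 1 \<times> comps n 1. g d) =
    (\<Sum>a\<in>{1..int n}. \<Sum>b\<in>{1..int n}. g (evec n a, evec n b))"
proof -
  have "(\<Sum>d\<in>comps n 1 \<times> comps n 1. g d) = (\<Sum>a\<in>comps n 1. \<Sum>b\<in>comps n 1. g (a, b))"
    by (simp add: sum.cartesian_product)
  then show ?thesis by (simp only: sum_comps_1)
qed

lemma Tl_mult:
  assumes l: "c1 \<in> {1..int n}" "c2 \<in> {1..int n}" "b1 \<in> {1..int n}" "b2 \<in> {1..int n}"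
    and inv: "\<And>a e. a \<in> {1..int n} \<Longrightarrow> e \<in> {1..int n} \<Longrightarrow> (\<Sum>b\<in>{1..int n}. C a b * C' b e) = of_bool (a = e)"
  shows "(\<Sum>d1\<in>{1..int n}. \<Sum>d2\<in>{1..int n}. Tl C c1 c2 d1 d2 * Tl C' d1 d2 b1 b2) = of_bool (c1 = b1 \<and> c2 = b2)"
proof (cases "b1 = b2")
  case True
  have "(\<Sum>d1\<in>{1..int n}. \<Sum>d2\<in>{1..int n}. Tl C c1 c2 d1 d2 * Tl C' d1 d2 b1 b2) =
      (\<Sum>d1\<in>{1..int n}. \<Sum>d2\<in>{1..int n}. of_bool (c1 = c2) * (C c1 d1 * C' d1 b1) * of_bool (d2 = d1))"
    by (intro sum.cong) (auto simp: Tl_def True)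
  also have "\<dots> = (\<Sum>d1\<in>{1..int n}. of_bool (c1 = c2) * (C c1 d1 * C' d1 b1))"
    by (intro sum.cong refl sum_letter)
  also have "\<dots> = of_bool (c1 = c2) * of_bool (c1 = b1)"
    unfolding sum_distrib_left[symmetric] inv[OF l(1,3)] ..
  finally show ?thesis using True by auto
next
  case False
  have "(\<Sum>d1\<in>{1..int n}. \<Sum>d2\<in>{1..int n}. Tl C c1 c2 d1 d2 * Tl C' d1 d2 b1 b2) =
      (\<Sum>d1\<in>{1..int n}. \<Sum>d2\<in>{1..int n}. Tl C c1 c2 d1 d2 * of_bool (d1 = b2) * of_bool (d2 = b1))"
    by (intro sum.cong) (use False in \<open>auto simp: Tl_def\<close>)
  also have "\<dots> = (\<Sum>d1\<in>{1..int n}. Tl C c1 c2 d1 b1 * of_bool (d1 = b2))"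
    by (intro sum.cong refl sum_letter l)
  also have "\<dots> = Tl C c1 c2 b2 b1" by (rule sum_letter[OF l(4)])
  finally show ?thesis using False by (simp add: Tl_def)
qed

context
  fixes u v :: scalar
  assumes u0: "u \<noteq> 0" and v0: "v \<noteq> 0"
    and d: "1 - (- inverse qq) powi int n * (v / u) \<noteq> 0"
    and d': "1 - (- inverse qq) powi int n * inverse (v / u) \<noteq> 0"
begin

abbreviation "CC \<equiv> Cc (- inverse qq) (v / u)"
abbreviation "CI \<equiv> Cc (- inverse qq) (inverse (v / u))"

text \<open>The recursions for p = -1/q and r = v/u, multiplied out into the form in which the
  equations for E_i produce them.\<close>

lemma CC_rec:
  assumes i: "i \<in> {1..int n}" and a: "a \<in> {1..int n}"
  shows "rho v i * CC a (sc i) + qq * (rho u i * CC a i) = of_bool (a = i) * rho u i + qq * (of_bool (a = sc i) * rho v i)" (is ?t1)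
    "rho u i * CC (sc i) a + inverse qq * (rho v i * CC i a) = of_bool (a = i) * rho v i + inverse qq * (of_bool (a = sc i) * rho u i)" (is ?t2)
proof -
  have p: "- inverse qq \<noteq> 0" using qq_nonzero by simp
  have r: "rho (v / u) i = rho v i / rho u i" by (simp add: rho_def)
  have U: "rho u i \<noteq> 0" using u0 by (simp add: rho_def)
  have c: "CC a i = - inverse qq * (rho v i / rho u i) * CC a (sc i) - - inverse qq * of_bool (a = i) + rho v i / rho u i * of_bool (a = sc i)"
    using Cc_rec(2)[OF p d a i] unfolding r .
  have "qq * (rho u i * CC a i) = of_bool (a = i) * rho u i + qq * (of_bool (a = sc i) * rho v i) - rho v i * CC a (sc i)"
    unfolding c using U qq_nonzero by (simp add: field_simps)
  then show ?t1
    by simp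
  have c: "CC (sc i) a = - inverse qq * (rho v i / rho u i) * CC i a + rho v i / rho u i * of_bool (a = i) - - inverse qq * of_bool (a = sc i)"
    using Cc_rec(1)[OF p d i a] unfolding r .
  have "rho u i * CC (sc i) a = of_bool (a = i) * rho v i + inverse qq * (of_bool (a = sc i) * rho u i) - inverse qq * (rho v i * CC i a)"
    unfolding c using U qq_nonzero by (simp add: field_simps)
  then show ?t2
    by simp
qed

text \<open>Dividing the E_i equations by the product of the factors \<open>rho u i\<close> and
  \<open>rho v i\<close> gives the equations for F_i, where the spectral parameters occur
  inverted.\<close>

lemma CC_rec':
  assumes i: "i \<in> {1..int n}" and a: "a \<in> {1..int n}"
  shows "inverse (rho u i) * CC a (sc i) + qq * (inverse (rho v i) * CC a i) =
      of_bool (a = i) * inverse (rho v i) + qq * (of_bool (a = sc i) * inverse (rho u i))" (is ?t1)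
    "inverse (rho v i) * CC (sc i) a + inverse qq * (inverse (rho u i) * CC i a) =
      of_bool (a = i) * inverse (rho u i) + inverse qq * (of_bool (a = sc i) * inverse (rho v i))" (is ?t2)
proof -
  have U: "rho u i \<noteq> 0" "rho v i \<noteq> 0" using u0 v0 by (simp_all add: rho_def)
  define w where "w = inverse (rho u i) * inverse (rho v i)"
  have w: "w * rho v i = inverse (rho u i)" "w * rho u i = inverse (rho v i)" using U by (simp_all add: w_def)
  have "w * (rho v i * CC a (sc i) + qq * (rho u i * CC a i)) = w * (of_bool (a = i) * rho u i + qq * (of_bool (a = sc i) * rho v i))"
    unfolding CC_rec(1)[OF i a] ..
  then show ?t1
    unfolding w[symmetric] by (simp add: algebra_simps)
  have "w * (rho u i * CC (sc i) a + inverse qq * (rho v i * CC i a)) = w * (of_bool (a = i) * rho v i + inverse qq * (of_bool (a = sc i) * rho u i))"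
    unfolding CC_rec(2)[OF i a] ..
  then show ?t2
    unfolding w[symmetric] by (simp add: algebra_simps)
qed

abbreviation "TT \<equiv> Tl (\<lambda>c b. CC b c)"

text \<open>Each equation splits by the source. From equal letters the generator leaves the space of
  weight zero, and the recursion in the second index of \<open>CC\<close> is what remains. From
  different letters it can reach that space only for the letters i and i + 1, which gives the
  recursion in the first index.\<close>

lemma TT_EF:
  assumes i: "i \<in> {1..int n}" and c: "c1 \<in> {1..int n}" "c2 \<in> {1..int n}" and b: "b1 \<in> {1..int n}" "b2 \<in> {1..int n}"
  shows "eC False v i c1 * TT (eS False c1) c2 b1 b2 + qq powi (kx False i c1) * (eC True u i c2 * TT c1 (eS True c2) b1 b2) =
    eC False u i b1 * TT c1 c2 (eS False b1) b2 + qq powi (kx True i b1) * (eC True v i b2 * TT c1 c2 b1 (eS True b2))" (is ?t1)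
   "fC False v i c1 * (qq powi (- kx True i c2) * TT (fS False c1) c2 b1 b2) + fC True u i c2 * TT c1 (fS True c2) b1 b2 =
    fC False u i b1 * (qq powi (- kx False i b2) * TT c1 c2 (fS False b1) b2) + fC True v i b2 * TT c1 c2 b1 (fS True b2)" (is ?t2)
proof -
  note ij = sc_neq[OF i]
  have e: "eC False v i c1 * TT (eS False c1) c2 b1 b2 + qq powi (kx False i c1) * (eC True u i c2 * TT c1 (eS True c2) b1 b2) =
     of_bool (c1 = i) * (rho v i * TT (sc i) c2 b1 b2) + qq powi (of_bool (c1 = i) - of_bool (c1 = sc i)) * (of_bool (c2 = sc i) * (rho u i * TT c1 i b1 b2))"
    "eC False u i b1 * TT c1 c2 (eS False b1) b2 + qq powi (kx True i b1) * (eC True v i b2 * TT c1 c2 b1 (eS True b2)) =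
     of_bool (b1 = i) * (rho u i * TT c1 c2 (sc i) b2) + qq powi (- of_bool (b1 = i) + of_bool (b1 = sc i)) * (of_bool (b2 = sc i) * (rho v i * TT c1 c2 b1 i))"
    using letter_forms(1)[OF i c(1), of False] letter_forms(1)[OF i b(1), of True]
      letter_forms(2)[OF i c(1), of v "\<lambda>c. TT c c2 b1 b2"] letter_forms(3)[OF i c(2), of u "\<lambda>c. TT c1 c b1 b2"]
      letter_forms(2)[OF i b(1), of u "\<lambda>c. TT c1 c2 c b2"] letter_forms(3)[OF i b(2), of v "\<lambda>c. TT c1 c2 b1 c"]
    by simp_all
  have f: "fC False v i c1 * (qq powi (- kx True i c2) * TT (fS False c1) c2 b1 b2) + fC True u i c2 * TT c1 (fS True c2) b1 b2 =
     of_bool (c1 = sc i) * (inverse (rho v i) * (qq powi (of_bool (c2 = i) - of_bool (c2 = sc i)) * TT i c2 b1 b2)) +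
     of_bool (c2 = i) * (inverse (rho u i) * TT c1 (sc i) b1 b2)"
    "fC False u i b1 * (qq powi (- kx False i b2) * TT c1 c2 (fS False b1) b2) + fC True v i b2 * TT c1 c2 b1 (fS True b2) =
     of_bool (b1 = sc i) * (inverse (rho u i) * (qq powi (- of_bool (b2 = i) + of_bool (b2 = sc i)) * TT c1 c2 i b2)) +
     of_bool (b2 = i) * (inverse (rho v i) * TT c1 c2 b1 (sc i))"
    using letter_forms(1)[OF i c(2), of True] letter_forms(1)[OF i b(2), of False]
      letter_forms(4)[OF i c(1), of v "\<lambda>c. qq powi (of_bool (c2 = i) - of_bool (c2 = sc i)) * TT c c2 b1 b2"]
      letter_forms(5)[OF i c(2), of u "\<lambda>c. TT c1 c b1 b2"]
      letter_forms(4)[OF i b(1), of u "\<lambda>c. qq powi (- of_bool (b2 = i) + of_bool (b2 = sc i)) * TT c1 c2 c b2"]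
      letter_forms(5)[OF i b(2), of v "\<lambda>c. TT c1 c2 b1 c"]
    by simp_all
  show ?t1
    unfolding e
  proof (cases "b1 = b2")
    case True
    show "of_bool (c1 = i) * (rho v i * TT (sc i) c2 b1 b2) + qq powi (of_bool (c1 = i) - of_bool (c1 = sc i)) * (of_bool (c2 = sc i) * (rho u i * TT c1 i b1 b2)) =
      of_bool (b1 = i) * (rho u i * TT c1 c2 (sc i) b2) + qq powi (- of_bool (b1 = i) + of_bool (b1 = sc i)) * (of_bool (b2 = sc i) * (rho v i * TT c1 c2 b1 i))"
      using CC_rec(1)[OF i b(1)] ij True
      by (cases "c1 = i"; cases "c2 = sc i"; auto simp: Tl_def power_int_minus)
  next
    case False
    show "of_bool (c1 = i) * (rho v i * TT (sc i) c2 b1 b2) + qq powi (of_bool (c1 = i) - of_bool (c1 = sc i)) * (of_bool (c2 = sc i) * (rho u i * TT c1 i b1 b2)) =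
      of_bool (b1 = i) * (rho u i * TT c1 c2 (sc i) b2) + qq powi (- of_bool (b1 = i) + of_bool (b1 = sc i)) * (of_bool (b2 = sc i) * (rho v i * TT c1 c2 b1 i))"
      using CC_rec(2)[OF i c(1)] ij False
      by (cases "b1 = i"; cases "b2 = sc i"; auto simp: Tl_def power_int_minus)
  qed
  show ?t2
    unfolding f
  proof (cases "b1 = b2")
    case True
    show "of_bool (c1 = sc i) * (inverse (rho v i) * (qq powi (of_bool (c2 = i) - of_bool (c2 = sc i)) * TT i c2 b1 b2)) +
     of_bool (c2 = i) * (inverse (rho u i) * TT c1 (sc i) b1 b2) =
     of_bool (b1 = sc i) * (inverse (rho u i) * (qq powi (- of_bool (b2 = i) + of_bool (b2 = sc i)) * TT c1 c2 i b2)) +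
     of_bool (b2 = i) * (inverse (rho v i) * TT c1 c2 b1 (sc i))"
      using CC_rec'(1)[OF i b(1)] ij True
      by (cases "c1 = sc i"; cases "c2 = i"; auto simp: Tl_def power_int_minus algebra_simps)
  next
    case False
    show "of_bool (c1 = sc i) * (inverse (rho v i) * (qq powi (of_bool (c2 = i) - of_bool (c2 = sc i)) * TT i c2 b1 b2)) +
     of_bool (c2 = i) * (inverse (rho u i) * TT c1 (sc i) b1 b2) =
     of_bool (b1 = sc i) * (inverse (rho u i) * (qq powi (- of_bool (b2 = i) + of_bool (b2 = sc i)) * TT c1 c2 i b2)) +
     of_bool (b2 = i) * (inverse (rho v i) * TT c1 c2 b1 (sc i))"
      using CC_rec'(2)[OF i c(1)] ij False
      by (cases "b1 = sc i"; cases "b2 = i"; auto simp: Tl_def power_int_minus algebra_simps)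
  qed
qed

definition Tm :: "(comp \<times> comp, comp \<times> comp) matr" where
  "Tm = (\<lambda>c b. TT (lt (fst c)) (lt (snd c)) (lt (fst b)) (lt (snd b)))"

definition Sm :: "(comp \<times> comp, comp \<times> comp) matr" where
  "Sm = (\<lambda>c b. Tl CI (lt (fst c)) (lt (snd c)) (lt (fst b)) (lt (snd b)))"

lemma Tm_letter: "\<lbrakk>c1 \<in> {1..int n}; c2 \<in> {1..int n}; b1 \<in> {1..int n}; b2 \<in> {1..int n}\<rbrakk> \<Longrightarrow>
    Tm (evec n c1, evec n c2) (evec n b1, evec n b2) = TT c1 c2 b1 b2"
  "\<lbrakk>c1 \<in> {1..int n}; c2 \<in> {1..int n}; b1 \<in> {1..int n}; b2 \<in> {1..int n}\<rbrakk> \<Longrightarrow>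
    Sm (evec n c1, evec n c2) (evec n b1, evec n b2) = Tl CI c1 c2 b1 b2"
  by (simp_all add: Tm_def Sm_def lt_evec)

lemma Tm_U_linear: "U_linear (tmod True u False v) (tmod False v True u) Tm"
  unfolding U_linear_def
proof
  fix i :: int
  define r where "r = (i - 1) mod int n + 1"
  have r: "r \<in> {1..int n}" "r mod int n = i mod int n"
    using rep_1_n[of "int n" i] n0 by (simp_all add: r_def)
  let ?M = "tmod True u False v" and ?N = "tmod False v True u"
  have main: "mmul (basis ?N) (Eop ?N i) Tm c b = mmul (basis ?M) Tm (Eop ?M i) c b \<and>
      mmul (basis ?N) (Fop ?N i) Tm c b = mmul (basis ?M) Tm (Fop ?M i) c b \<and>
      mmul (basis ?N) (Kop ?N i) Tm c b = mmul (basis ?M) Tm (Kop ?M i) c b \<and>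
      mmul (basis ?N) (Kiop ?N i) Tm c b = mmul (basis ?M) Tm (Kiop ?M i) c b"
    if "c \<in> comps n 1 \<times> comps n 1" "b \<in> comps n 1 \<times> comps n 1" for c b
  proof -
    obtain c1 c2 b1 b2 where cb: "c = (evec n c1, evec n c2)" "b = (evec n b1, evec n b2)"
      and l: "c1 \<in> {1..int n}" "c2 \<in> {1..int n}" "b1 \<in> {1..int n}" "b2 \<in> {1..int n}"
      using \<open>c \<in> _\<close> \<open>b \<in> _\<close> unfolding comps_1_eq[OF n0] by auto
    note L = l step_letters(1)[OF l(1)] step_letters(1)[OF l(2)] step_letters(1)[OF l(3)] step_letters(1)[OF l(4)]
      step_letters(2)[OF l(1)] step_letters(2)[OF l(2)] step_letters(2)[OF l(3)] step_letters(2)[OF l(4)]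
    have K: "qq powi (kx False i c1) * (qq powi (kx True i c2) * TT c1 c2 b1 b2) =
      qq powi (kx True i b1) * (qq powi (kx False i b2) * TT c1 c2 b1 b2)"
      "qq powi (- kx False i c1) * (qq powi (- kx True i c2) * TT c1 c2 b1 b2) =
      qq powi (- kx True i b1) * (qq powi (- kx False i b2) * TT c1 c2 b1 b2)"
      by (auto simp: Tl_def kx_def qq_powi_mult algebra_simps)
    show ?thesis
      unfolding mmul_def basis_tmod cb tmod_row[OF l(1,2)] tmod_col[OF l(3,4)]
      using TT_EF[OF r(1) l] K
      by (simp only: Tm_letter L coeff_index_cong[OF r(2)] kx_index_cong[OF r(2)] simp_thms)
  qed
  show "intertwines ?M ?N Tm (Eop ?M i) (Eop ?N i) \<and> intertwines ?M ?N Tm (Fop ?M i) (Fop ?N i) \<and>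
     intertwines ?M ?N Tm (Kop ?M i) (Kop ?N i) \<and> intertwines ?M ?N Tm (Kiop ?M i) (Kiop ?N i)"
    unfolding intertwines_def eq_on_def using main by (simp add: basis_tmod)
qed

lemma Tm_isomorphism: "U_isomorphism (tmod True u False v) (tmod False v True u) Tm"
proof -
  have p: "- inverse qq \<noteq> 0" using qq_nonzero by simp
  have r: "v / u \<noteq> 0" using u0 v0 by simp
  note inv = Cc_inverse[OF p r d d']
  have "eq_on (comps n 1 \<times> comps n 1) (comps n 1 \<times> comps n 1) (mmul (comps n 1 \<times> comps n 1) Sm Tm) idm"
    unfolding eq_on_def
  proof safe
    fix \<alpha> \<alpha>' \<beta> \<beta>' assume "\<alpha> \<in> comps n 1" "\<alpha>' \<in> comps n 1" "\<beta> \<in> comps n 1" "\<beta>' \<in> comps n 1"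
    then obtain c1 c2 b1 b2 where cb: "\<alpha> = evec n c1" "\<alpha>' = evec n c2" "\<beta> = evec n b1" "\<beta>' = evec n b2"
      and l: "c1 \<in> {1..int n}" "c2 \<in> {1..int n}" "b1 \<in> {1..int n}" "b2 \<in> {1..int n}"
      unfolding comps_1_eq[OF n0] by auto
    have "mmul (comps n 1 \<times> comps n 1) Sm Tm (\<alpha>, \<alpha>') (\<beta>, \<beta>') =
        (\<Sum>d1\<in>{1..int n}. \<Sum>d2\<in>{1..int n}. Tl CI c1 c2 d1 d2 * TT d1 d2 b1 b2)"
      unfolding mmul_def sum_pairs cb by (intro sum.cong refl) (simp only: Tm_letter l)
    also have "\<dots> = of_bool (c1 = b1 \<and> c2 = b2)"
    proof (rule Tl_mult[OF l])
      fix a e assume "a \<in> {1..int n}" "e \<in> {1..int n}"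
      then have "(\<Sum>b\<in>{1..int n}. CC e b * CI a b) = of_bool (e = a)" by (intro inv(1))
      moreover have "(\<Sum>b\<in>{1..int n}. CI a b * CC e b) = (\<Sum>b\<in>{1..int n}. CC e b * CI a b)"
        by (intro sum.cong refl mult.commute)
      moreover have "(e = a) = (a = e)" by auto
      ultimately show "(\<Sum>b\<in>{1..int n}. CI a b * CC e b) = of_bool (a = e)" by (simp only:)
    qed
    finally show "mmul (comps n 1 \<times> comps n 1) Sm Tm (\<alpha>, \<alpha>') (\<beta>, \<beta>') = idm (\<alpha>, \<alpha>') (\<beta>, \<beta>')"
      using l by (simp add: idm_def cb evec_letter_eq)
  qed
  moreover have "eq_on (comps n 1 \<times> comps n 1) (comps n 1 \<times> comps n 1) (mmul (comps n 1 \<times> comps n 1) Tm Sm) idm"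
    unfolding eq_on_def
  proof safe
    fix \<alpha> \<alpha>' \<beta> \<beta>' assume "\<alpha> \<in> comps n 1" "\<alpha>' \<in> comps n 1" "\<beta> \<in> comps n 1" "\<beta>' \<in> comps n 1"
    then obtain c1 c2 b1 b2 where cb: "\<alpha> = evec n c1" "\<alpha>' = evec n c2" "\<beta> = evec n b1" "\<beta>' = evec n b2"
      and l: "c1 \<in> {1..int n}" "c2 \<in> {1..int n}" "b1 \<in> {1..int n}" "b2 \<in> {1..int n}"
      unfolding comps_1_eq[OF n0] by auto
    have "mmul (comps n 1 \<times> comps n 1) Tm Sm (\<alpha>, \<alpha>') (\<beta>, \<beta>') =
        (\<Sum>d1\<in>{1..int n}. \<Sum>d2\<in>{1..int n}. TT c1 c2 d1 d2 * Tl CI d1 d2 b1 b2)"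
      unfolding mmul_def sum_pairs cb by (intro sum.cong refl) (simp only: Tm_letter l)
    also have "\<dots> = of_bool (c1 = b1 \<and> c2 = b2)"
    proof (rule Tl_mult[OF l])
      fix a e assume "a \<in> {1..int n}" "e \<in> {1..int n}"
      then have "(\<Sum>b\<in>{1..int n}. CI b e * CC b a) = of_bool (e = a)" by (intro inv(2))
      moreover have "(\<Sum>b\<in>{1..int n}. CC b a * CI b e) = (\<Sum>b\<in>{1..int n}. CI b e * CC b a)"
        by (intro sum.cong refl mult.commute)
      moreover have "(e = a) = (a = e)" by auto
      ultimately show "(\<Sum>b\<in>{1..int n}. CC b a * CI b e) = of_bool (a = e)" by (simp only:)
    qed
    finally show "mmul (comps n 1 \<times> comps n 1) Tm Sm (\<alpha>, \<alpha>') (\<beta>, \<beta>') = idm (\<alpha>, \<alpha>') (\<beta>, \<beta>')"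
      using l by (simp add: idm_def cb evec_letter_eq)
  qed
  ultimately show ?thesis
    unfolding U_isomorphism_def basis_tmod using Tm_U_linear by blast
qed

lemma R_W_isomorphism: "U_isomorphism (tmod True u False v) (tmod False v True u) (R_W n u v)"
proof -
  have "R_W n u v = (SOME T. U_isomorphism (tmod True u False v) (tmod False v True u) T)"
    by (simp add: R_W_def tmod_def modl_def)
  then show ?thesis using someI[of "U_isomorphism (tmod True u False v) (tmod False v True u)", OF Tm_isomorphism] by simp
qed

text \<open>The eigenvalues of the K_i fix a weight only up to adding a constant to all its
  coordinates. Here the total of the coordinates of \<open>f\<close> is zero, so the constant
  vanishes, and for different letters the weight determines the two letters.\<close>

lemma R_W_weight:
  assumes l: "c1 \<in> {1..int n}" "c2 \<in> {1..int n}" "b1 \<in> {1..int n}" "b2 \<in> {1..int n}" and b: "b1 \<noteq> b2"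
    and nz: "R_W n u v (evec n c1, evec n c2) (evec n b1, evec n b2) \<noteq> 0"
  shows "c1 = b2 \<and> c2 = b1"
proof -
  let ?M = "tmod True u False v" and ?N = "tmod False v True u"
  let ?c = "(evec n c1, evec n c2)" and ?b = "(evec n b1, evec n b2)"
  have k: "kx False i c1 + kx True i c2 = kx True i b1 + kx False i b2" for i
  proof -
    have "intertwines ?M ?N (R_W n u v) (Kop ?M i) (Kop ?N i)"
      using R_W_isomorphism by (simp add: U_isomorphism_def U_linear_def)
    then have "mmul (basis ?N) (Kop ?N i) (R_W n u v) ?c ?b = mmul (basis ?M) (R_W n u v) (Kop ?M i) ?c ?b"
      unfolding intertwines_def eq_on_def basis_tmod using evec_in_comps[OF n0] by blast
    then have "qq powi (kx False i c1) * (qq powi (kx True i c2) * R_W n u v ?c ?b) =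
        qq powi (kx True i b1) * (qq powi (kx False i b2) * R_W n u v ?c ?b)"
      unfolding mmul_def basis_tmod tmod_row[OF l(1,2)] tmod_col[OF l(3,4)] .
    then show ?thesis unfolding qq_powi_mult using nz by (simp add: qq_powi_inject)
  qed
  define f where "f i = evec n c1 i - evec n c2 i + evec n b1 i - evec n b2 i" for i
  have fs: "f (i + 1) = f i" for i using k[of i] by (simp add: kx_def f_def)
  have fc: "f i = f 1" for i
  proof (induction i rule: int_induct[of _ 1])
    case (step1 i)
    then show ?case using fs[of i] by simp
  next
    case (step2 i)
    then show ?case using fs[of "i - 1"] by simp
  qed simp
  have s1: "(\<Sum>i=1..int n. evec n c i) = 1" for c
    using evec_in_comps[OF n0, of c] by (simp add: comps_def)
  have "(\<Sum>i=1..int n. f i) = 0"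
    unfolding f_def sum_subtractf sum.distrib s1 by simp
  also have "(\<Sum>i=1..int n. f i) = (\<Sum>i=1..int n. f 1)"
    by (intro sum.cong refl fc)
  also have "\<dots> = int n * f 1" by simp
  finally have f0: "f i = 0" for i using n0 fc[of i] by simp
  show ?thesis
    using f0[of b1] f0[of b2] b evec_letter[OF l(1) l(3)] evec_letter[OF l(2) l(3)] evec_letter[OF l(4) l(3)]
      evec_letter[OF l(1) l(4)] evec_letter[OF l(2) l(4)] evec_letter[OF l(3) l(4)] evec_letter[OF l(3) l(3)]
    by (auto simp: f_def evec_letter[OF l(4) l(4)] of_bool_def split: if_splits)
qed

text \<open>By the weight argument this is the only entry of its column that can be nonzero; a zero
  column would contradict invertibility.\<close>

lemma R_W_nonzero:
  assumes l: "b1 \<in> {1..int n}" "b2 \<in> {1..int n}" and b: "b1 \<noteq> b2"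
  shows "R_W n u v (evec n b2, evec n b1) (evec n b1, evec n b2) \<noteq> 0"
proof
  assume z: "R_W n u v (evec n b2, evec n b1) (evec n b1, evec n b2) = 0"
  let ?b = "(evec n b1, evec n b2)"
  have all0: "R_W n u v c ?b = 0" if cc: "c \<in> comps n 1 \<times> comps n 1" for c
  proof -
    obtain c1 c2 where c: "c = (evec n c1, evec n c2)" and lc: "c1 \<in> {1..int n}" "c2 \<in> {1..int n}"
      using cc unfolding comps_1_eq[OF n0] by auto
    show ?thesis using R_W_weight[OF lc l b] z unfolding c by metis
  qed
  obtain S where "eq_on (comps n 1 \<times> comps n 1) (comps n 1 \<times> comps n 1)
      (mmul (comps n 1 \<times> comps n 1) S (R_W n u v)) idm"
    using R_W_isomorphism unfolding U_isomorphism_def basis_tmod by blast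
  then have "mmul (comps n 1 \<times> comps n 1) S (R_W n u v) ?b ?b = 1"
    using evec_in_comps[OF n0] by (simp add: eq_on_def idm_def)
  moreover have "mmul (comps n 1 \<times> comps n 1) S (R_W n u v) ?b ?b = 0"
    unfolding mmul_def using all0 by (intro sum.neutral) simp
  ultimately show False by simp
qed

end

text \<open>As n is even, (-1/q)^n is a power of q. The excluded equalities would state that a power
  of q times x^2 or x^(-2) is 1, which fails at q = 1.\<close>

lemma generic_ratio:
  assumes "v / u = qq powi m * xx powi 2" "u \<noteq> 0" "v \<noteq> 0"
  shows "1 - (- inverse qq) powi int n * (v / u) \<noteq> 0" (is ?t1)
    "1 - (- inverse qq) powi int n * inverse (v / u) \<noteq> 0" (is ?t2)
proof -
  have "even n" using nh by presburger
  then have p: "(- inverse qq) powi int n = qq powi (- int n)"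
    by (simp add: power_int_minus power_inverse)
  have ne: "qq powi a * xx powi b \<noteq> 1" if "b \<noteq> 0" for a b
  proof
    assume "qq powi a * xx powi b = 1"
    then have "place 1 (1 :: scalar) (1 * rat_x powi b)"
      using place_mult[OF place_1_qq_powi place_xx_powi, of a b] by metis
    then have "rat_x powi b = rat_x powi 0" using place_unique[OF place_1] by fastforce
    then show False using that rat_x_powi_inject by blast
  qed
  have i: "inverse (qq powi m * xx powi 2) = qq powi (- m) * xx powi (- 2)"
    by (simp add: power_int_minus)
  show ?t1
    using ne[of 2 "- int n + m"] unfolding p assms(1) qq_powi_mult by fastforce
  show ?t2
    using ne[of "- 2" "- int n + - m"] unfolding p assms(1) i qq_powi_mult by fastforce
qed

section \<open>R acting on two neighbouring factors of a longer tensor product\<close>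

definition generic :: "scalar \<Rightarrow> scalar \<Rightarrow> bool" where
  "generic u v \<longleftrightarrow> u \<noteq> 0 \<and> v \<noteq> 0 \<and> 1 - (- inverse qq) powi int n * (v / u) \<noteq> 0 \<and>
    1 - (- inverse qq) powi int n * inverse (v / u) \<noteq> 0"

lemma generic_powers: "generic (qq powi a * inverse xx) (qq powi b * xx)"
proof -
  have "(qq powi b * xx) / (qq powi a * inverse xx) = qq powi (b - a) * xx powi 2"
    using xx_nonzero qq_nonzero by (simp add: power_int_diff field_simps power2_eq_square)
  then show ?thesis unfolding generic_def
    using generic_ratio[of "qq powi b * xx" "qq powi a * inverse xx"] xx_nonzero qq_nonzero by simp
qed

text \<open>Positions are counted from 0, so \<open>Rk R k\<close> corresponds to
  \<open>R_comp\<close> with the index \<open>Suc k\<close>.\<close>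

fun Rk :: "(comp \<times> comp, comp \<times> comp) matr \<Rightarrow> nat \<Rightarrow> (int list \<Rightarrow> scalar) \<Rightarrow> int list \<Rightarrow> scalar" where
  "Rk R 0 \<phi> (c1 # c2 # w) = (\<Sum>b1\<in>{1..int n}. \<Sum>b2\<in>{1..int n}.
     R (evec n c1, evec n c2) (evec n b1, evec n b2) * \<phi> (b1 # b2 # w))"
| "Rk R (Suc k) \<phi> (c # w) = Rk R k (\<lambda>u. \<phi> (c # u)) w"
| "Rk R _ \<phi> _ = 0"

lemma Rk_eq:
  "Suc k < length w \<Longrightarrow> Rk R k \<phi> w = (\<Sum>b1\<in>{1..int n}. \<Sum>b2\<in>{1..int n}.
     R (evec n (w ! k), evec n (w ! Suc k)) (evec n b1, evec n b2) * \<phi> (w[k := b1, Suc k := b2]))"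
proof (induction R k \<phi> w rule: Rk.induct)
  case (2 R k \<phi> c w)
  then show ?case by simp
qed (auto simp: nth_Cons' split: if_splits)

lemma Rk_linear:
  "Rk R k (\<lambda>u. a * \<phi> u + b * \<psi> u) w = a * Rk R k \<phi> w + b * Rk R k \<psi> w"
proof (induction R k \<phi> w arbitrary: \<psi> rule: Rk.induct)
  case (1 R \<phi> c1 c2 w)
  then show ?case by (simp add: algebra_simps sum.distrib sum_distrib_left)
qed auto

lemma Rk_add: "Rk R k (\<lambda>u. \<phi> u + \<psi> u) w = Rk R k \<phi> w + Rk R k \<psi> w"
  using Rk_linear[of R k 1 \<phi> 1 \<psi> w] by simp

lemma Rk_cmult: "Rk R k (\<lambda>u. a * \<phi> u) w = a * Rk R k \<phi> w"
  using Rk_linear[of R k a \<phi> 0 \<phi> w] by simp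

lemma EaFa_linear:
  "Ea ms i (\<lambda>u. a * \<phi> u + b * \<psi> u) w = a * Ea ms i \<phi> w + b * Ea ms i \<psi> w"
  "Fa ms i (\<lambda>u. a * \<phi> u + b * \<psi> u) w = a * Fa ms i \<phi> w + b * Fa ms i \<psi> w"
proof -
  have "Ea ms i (\<lambda>u. a * \<phi> u + b * \<psi> u) w = a * Ea ms i \<phi> w + b * Ea ms i \<psi> w \<and>
    Fa ms i (\<lambda>u. a * \<phi> u + b * \<psi> u) w = a * Fa ms i \<phi> w + b * Fa ms i \<psi> w"
  proof (induction ms arbitrary: w \<phi> \<psi>)
    case (Cons m ms)
    then show ?case by (cases m; cases w) (simp_all add: algebra_simps)
  qed simp
  then show "Ea ms i (\<lambda>u. a * \<phi> u + b * \<psi> u) w = a * Ea ms i \<phi> w + b * Ea ms i \<psi> w"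
    "Fa ms i (\<lambda>u. a * \<phi> u + b * \<psi> u) w = a * Fa ms i \<phi> w + b * Fa ms i \<psi> w" by auto
qed

lemma EaFa_sum:
  "Ea ms i (\<lambda>u. \<Sum>x\<in>A. a x * \<phi> x u) w = (\<Sum>x\<in>A. a x * Ea ms i (\<phi> x) w)"
  "Fa ms i (\<lambda>u. \<Sum>x\<in>A. a x * \<phi> x u) w = (\<Sum>x\<in>A. a x * Fa ms i (\<phi> x) w)"
proof -
  have z: "Ea ms i (\<lambda>u. 0) w = 0" "Fa ms i (\<lambda>u. 0) w = 0"
    using EaFa_linear[of ms i 0 "\<lambda>_. 0" 0 "\<lambda>_. 0" w] by simp_all
  show "Ea ms i (\<lambda>u. \<Sum>x\<in>A. a x * \<phi> x u) w = (\<Sum>x\<in>A. a x * Ea ms i (\<phi> x) w)"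
  proof (induction A rule: infinite_finite_induct)
    case (insert y A)
    then show ?case using EaFa_linear(1)[of ms i "a y" "\<phi> y" 1 "\<lambda>u. \<Sum>x\<in>A. a x * \<phi> x u" w] by simp
  qed (simp_all add: z)
  show "Fa ms i (\<lambda>u. \<Sum>x\<in>A. a x * \<phi> x u) w = (\<Sum>x\<in>A. a x * Fa ms i (\<phi> x) w)"
  proof (induction A rule: infinite_finite_induct)
    case (insert y A)
    then show ?case using EaFa_linear(2)[of ms i "a y" "\<phi> y" 1 "\<lambda>u. \<Sum>x\<in>A. a x * \<phi> x u" w] by simp
  qed (simp_all add: z)
qed

context
  fixes u v :: scalar and R :: "(comp \<times> comp, comp \<times> comp) matr"
  assumes gen: "generic u v" and R_def: "R = R_W n u v"
begin

lemma R_iso: "U_isomorphism (tmod True u False v) (tmod False v True u) R"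
  using gen unfolding generic_def R_def by (elim conjE, intro R_W_isomorphism)

lemma R_rows:
  assumes l: "c1 \<in> {1..int n}" "c2 \<in> {1..int n}"
  shows "eC False v i c1 * Rk R 0 \<phi> (eS False c1 # c2 # w) +
      qq powi (kx False i c1) * (eC True u i c2 * Rk R 0 \<phi> (c1 # eS True c2 # w)) =
      (\<Sum>b1\<in>{1..int n}. \<Sum>b2\<in>{1..int n}. R (evec n c1, evec n c2) (evec n b1, evec n b2) *
        (eC True u i b1 * \<phi> (eS True b1 # b2 # w) +
         qq powi (kx True i b1) * (eC False v i b2 * \<phi> (b1 # eS False b2 # w))))" (is ?t1)
    "fC False v i c1 * (qq powi (- kx True i c2) * Rk R 0 \<phi> (fS False c1 # c2 # w)) +
      fC True u i c2 * Rk R 0 \<phi> (c1 # fS True c2 # w) =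
      (\<Sum>b1\<in>{1..int n}. \<Sum>b2\<in>{1..int n}. R (evec n c1, evec n c2) (evec n b1, evec n b2) *
        (fC True u i b1 * (qq powi (- kx False i b2) * \<phi> (fS True b1 # b2 # w)) +
         fC False v i b2 * \<phi> (b1 # fS False b2 # w)))" (is ?t2)
    "R (evec n c1, evec n c2) (evec n b1, evec n b2) \<noteq> 0 \<Longrightarrow> b1 \<in> {1..int n} \<Longrightarrow> b2 \<in> {1..int n} \<Longrightarrow>
       kx False i c1 + kx True i c2 = kx True i b1 + kx False i b2"
proof -
  let ?M = "tmod True u False v" and ?N = "tmod False v True u"
  let ?c = "(evec n c1, evec n c2)"
  define \<psi> where "\<psi> d = \<phi> (lt (fst d) # lt (snd d) # w)" for d
  have fin: "finite (basis ?M)" "finite (basis ?N)" using finite_comps[OF n0] by (simp_all add: basis_tmod)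
  have c: "?c \<in> basis ?N" using evec_in_comps[OF n0] by (simp add: basis_tmod)
  have lin: "intertwines ?M ?N R (Eop ?M i) (Eop ?N i)" "intertwines ?M ?N R (Fop ?M i) (Fop ?N i)"
      "intertwines ?M ?N R (Kop ?M i) (Kop ?N i)"
    using R_iso by (simp_all add: U_isomorphism_def U_linear_def)
  have \<psi>: "\<psi> (evec n b1, evec n b2) = \<phi> (b1 # b2 # w)" if "b1 \<in> {1..int n}" "b2 \<in> {1..int n}" for b1 b2
    using that by (simp add: \<psi>_def lt_evec)
  have RR: "(\<Sum>b\<in>comps n 1 \<times> comps n 1. R (evec n c1, evec n c2) b * \<psi> b) = Rk R 0 \<phi> (c1 # c2 # w)" for c1 c2
    unfolding sum_pairs Rk.simps by (intro sum.cong refl) (simp only: \<psi>)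
  note st = step_range
  have E: "(\<Sum>b\<in>comps n 1 \<times> comps n 1. R ?c b * (\<Sum>d\<in>comps n 1 \<times> comps n 1. Eop ?M i b d * \<psi> d)) =
      (\<Sum>b1\<in>{1..int n}. \<Sum>b2\<in>{1..int n}. R ?c (evec n b1, evec n b2) *
        (eC True u i b1 * \<phi> (eS True b1 # b2 # w) +
         qq powi (kx True i b1) * (eC False v i b2 * \<phi> (b1 # eS False b2 # w))))"
    unfolding sum_pairs[of "\<lambda>b. R ?c b * _ b"] by (intro sum.cong refl) (simp only: tmod_row \<psi> st)
  have F: "(\<Sum>b\<in>comps n 1 \<times> comps n 1. R ?c b * (\<Sum>d\<in>comps n 1 \<times> comps n 1. Fop ?M i b d * \<psi> d)) =
      (\<Sum>b1\<in>{1..int n}. \<Sum>b2\<in>{1..int n}. R ?c (evec n b1, evec n b2) *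
        (fC True u i b1 * (qq powi (- kx False i b2) * \<phi> (fS True b1 # b2 # w)) +
         fC False v i b2 * \<phi> (b1 # fS False b2 # w)))"
    unfolding sum_pairs[of "\<lambda>b. R ?c b * _ b"] by (intro sum.cong refl) (simp only: tmod_row \<psi> st)
  show ?t1
    using intertwines_sum[OF lin(1) fin c, of \<psi>]
    unfolding basis_tmod E tmod_row[OF l] RR .
  show ?t2
    using intertwines_sum[OF lin(2) fin c, of \<psi>]
    unfolding basis_tmod F tmod_row[OF l] RR .
  assume nz: "R ?c (evec n b1, evec n b2) \<noteq> 0" and b: "b1 \<in> {1..int n}" "b2 \<in> {1..int n}"
  have "mmul (basis ?N) (Kop ?N i) R ?c (evec n b1, evec n b2) = mmul (basis ?M) R (Kop ?M i) ?c (evec n b1, evec n b2)"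
    using lin(3) c evec_in_comps[OF n0] unfolding intertwines_def eq_on_def basis_tmod by blast
  then have "qq powi (kx False i c1) * (qq powi (kx True i c2) * R ?c (evec n b1, evec n b2)) =
      qq powi (kx True i b1) * (qq powi (kx False i b2) * R ?c (evec n b1, evec n b2))"
    unfolding mmul_def basis_tmod tmod_row[OF l] tmod_col[OF b] .
  then show "kx False i c1 + kx True i c2 = kx True i b1 + kx False i b2"
    unfolding qq_powi_mult using nz by (simp add: qq_powi_inject)
qed

text \<open>Induction on the factors to the left of R. In the base case the powers of q by which the
  coproduct couples the two factors to the tail depend only on their joint weight, which R
  preserves. The statement on weights is carried along because F_i on a left factor comes with
  K_i^-1 on everything to its right, including the two factors on which R acts.\<close>

lemma Rk_comm:
  assumes "w \<in> wds (length (pre @ (True, u) # (False, v) # post))"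
  shows "Ea (pre @ (False, v) # (True, u) # post) i (Rk R (length pre) \<phi>) w =
        Rk R (length pre) (Ea (pre @ (True, u) # (False, v) # post) i \<phi>) w" (is ?t1)
    "Fa (pre @ (False, v) # (True, u) # post) i (Rk R (length pre) \<phi>) w =
        Rk R (length pre) (Fa (pre @ (True, u) # (False, v) # post) i \<phi>) w" (is ?t2)
    "Rk R (length pre) (\<lambda>u'. qq powi (e * kX (pre @ (True, u) # (False, v) # post) i u') * \<phi> u') w =
        qq powi (e * kX (pre @ (False, v) # (True, u) # post) i w) * Rk R (length pre) \<phi> w" (is ?t3)
proof -
  have "?t1 \<and> ?t2 \<and>
    (\<forall>e. Rk R (length pre) (\<lambda>u'. qq powi (e * kX (pre @ (True, u) # (False, v) # post) i u') * \<phi> u') w =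
        qq powi (e * kX (pre @ (False, v) # (True, u) # post) i w) * Rk R (length pre) \<phi> w)"
    using assms
  proof (induction pre arbitrary: w \<phi>)
    case Nil
    then obtain c1 c2 w' where w: "w = c1 # c2 # w'" and l: "c1 \<in> {1..int n}" "c2 \<in> {1..int n}"
      by (auto simp: wds_Suc)
    let ?R = "\<lambda>b1 b2. R (evec n c1, evec n c2) (evec n b1, evec n b2)"
    have kxe: "qq powi (e * (kx False i c1 + kx True i c2)) * (?R b1 b2 * y) =
        ?R b1 b2 * (qq powi (e * (kx True i b1 + kx False i b2)) * y)"
      if "b1 \<in> {1..int n}" "b2 \<in> {1..int n}" for b1 b2 y e
      using R_rows(3)[OF l _ that, of i] by (cases "?R b1 b2 = 0") auto
    have Rk0: "(\<lambda>u'. Rk R 0 \<phi> (c1 # c2 # u')) =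
        (\<lambda>u'. \<Sum>b\<in>{1..int n} \<times> {1..int n}. ?R (fst b) (snd b) * \<phi> (fst b # snd b # u'))"
      by (rule ext) (simp add: sum.cartesian_product split_def)
    have tE: "Ea post i (\<lambda>u'. Rk R 0 \<phi> (c1 # c2 # u')) w' =
        (\<Sum>b1\<in>{1..int n}. \<Sum>b2\<in>{1..int n}. ?R b1 b2 * Ea post i (\<lambda>u'. \<phi> (b1 # b2 # u')) w')"
      unfolding Rk0 EaFa_sum by (simp add: sum.cartesian_product split_def)
    have tF: "Fa post i (\<lambda>u'. Rk R 0 \<phi> (c1 # c2 # u')) w' =
        (\<Sum>b1\<in>{1..int n}. \<Sum>b2\<in>{1..int n}. ?R b1 b2 * Fa post i (\<lambda>u'. \<phi> (b1 # b2 # u')) w')"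
      unfolding Rk0 EaFa_sum by (simp add: sum.cartesian_product split_def)
    have "Ea ([] @ (False, v) # (True, u) # post) i (Rk R 0 \<phi>) w =
       (eC False v i c1 * Rk R 0 \<phi> (eS False c1 # c2 # w') +
        qq powi (kx False i c1) * (eC True u i c2 * Rk R 0 \<phi> (c1 # eS True c2 # w'))) +
        qq powi (1 * (kx False i c1 + kx True i c2)) * Ea post i (\<lambda>u'. Rk R 0 \<phi> (c1 # c2 # u')) w'"
      unfolding w by (simp add: distrib_left qq_powi_mult del: Rk.simps)
    also have "\<dots> = Rk R 0 (Ea ([] @ (True, u) # (False, v) # post) i \<phi>) w"
      unfolding R_rows(1)[OF l] tE unfolding sum_distrib_left sum.distrib[symmetric] w Rk.simps(1)
      by (intro sum.cong refl) (simp add: kxe[where e = 1, simplified] distrib_left qq_powi_mult add.assoc)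
    finally have 1: "Ea ([] @ (False, v) # (True, u) # post) i (Rk R 0 \<phi>) w =
      Rk R 0 (Ea ([] @ (True, u) # (False, v) # post) i \<phi>) w" .
    have "Fa ([] @ (False, v) # (True, u) # post) i (Rk R 0 \<phi>) w =
       qq powi (- kX post i w') * (fC False v i c1 * (qq powi (- kx True i c2) * Rk R 0 \<phi> (fS False c1 # c2 # w')) +
        fC True u i c2 * Rk R 0 \<phi> (c1 # fS True c2 # w')) +
        Fa post i (\<lambda>u'. Rk R 0 \<phi> (c1 # c2 # u')) w'"
      unfolding w by (simp add: algebra_simps qq_powi_mult del: Rk.simps)
    also have "\<dots> = Rk R 0 (Fa ([] @ (True, u) # (False, v) # post) i \<phi>) w"
      unfolding R_rows(2)[OF l] tF unfolding sum_distrib_left sum.distrib[symmetric] w Rk.simps(1)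
      by (intro sum.cong refl) (simp add: algebra_simps qq_powi_mult)
    finally have 2: "Fa ([] @ (False, v) # (True, u) # post) i (Rk R 0 \<phi>) w =
      Rk R 0 (Fa ([] @ (True, u) # (False, v) # post) i \<phi>) w" .
    have 3: "Rk R 0 (\<lambda>u'. qq powi (e * kX ([] @ (True, u) # (False, v) # post) i u') * \<phi> u') w =
        qq powi (e * kX ([] @ (False, v) # (True, u) # post) i w) * Rk R 0 \<phi> w" for e
    proof -
      have "qq powi (e * kX ([] @ (False, v) # (True, u) # post) i w) * Rk R 0 \<phi> w =
        qq powi (e * kX post i w') * (qq powi (e * (kx False i c1 + kx True i c2)) * Rk R 0 \<phi> w)"
        unfolding w qq_powi_mult by (simp add: algebra_simps del: Rk.simps)
      also have "\<dots> = Rk R 0 (\<lambda>u'. qq powi (e * kX ([] @ (True, u) # (False, v) # post) i u') * \<phi> u') w"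
        unfolding w Rk.simps(1) sum_distrib_left
      proof (intro sum.cong refl)
        fix b1 b2 assume b: "b1 \<in> {1..int n}" "b2 \<in> {1..int n}"
        have x: "e * kX ([] @ (True, u) # (False, v) # post) i (b1 # b2 # w') =
            e * kX post i w' + e * (kx True i b1 + kx False i b2)"
          by (simp add: algebra_simps)
        show "qq powi (e * kX post i w') * (qq powi (e * (kx False i c1 + kx True i c2)) * (?R b1 b2 * \<phi> (b1 # b2 # w'))) =
           ?R b1 b2 * (qq powi (e * kX ([] @ (True, u) # (False, v) # post) i (b1 # b2 # w')) * \<phi> (b1 # b2 # w'))"
          unfolding kxe[OF b] x qq_powi_mult[symmetric] by (rule mult.left_commute)
      qed
      finally show ?thesis ..
    qed
    show ?case using 1 2 3 by simp
  next
    case (Cons m pre)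
    obtain b z where m: "m = (b, z)" by force
    obtain c w' where w: "w = c # w'" and w': "w' \<in> wds (length (pre @ (True, u) # (False, v) # post))"
      using Cons.prems by (auto simp: wds_Suc)
    note IH = Cons.IH[OF w']
    let ?ms = "pre @ (True, u) # (False, v) # post" and ?ms' = "pre @ (False, v) # (True, u) # post"
    have K: "Rk R (length pre) (\<lambda>u'. qq powi (e * kX ?ms i u') * \<phi> u') w' = qq powi (e * kX ?ms' i w') * Rk R (length pre) \<phi> w'" for e \<phi>
      using IH by blast
    have 1: "Ea ?ms' i (Rk R (length pre) \<phi>) w' = Rk R (length pre) (Ea ?ms i \<phi>) w'" for \<phi> using IH by blast
    have 2: "Fa ?ms' i (Rk R (length pre) \<phi>) w' = Rk R (length pre) (Fa ?ms i \<phi>) w'" for \<phi> using IH by blast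
    have c1: "Ea ((m # pre) @ (False, v) # (True, u) # post) i (Rk R (length (m # pre)) \<phi>) w =
        Rk R (length (m # pre)) (Ea ((m # pre) @ (True, u) # (False, v) # post) i \<phi>) w"
      unfolding w m by (simp add: 1 Rk_add Rk_cmult)
    have c2: "Fa ((m # pre) @ (False, v) # (True, u) # post) i (Rk R (length (m # pre)) \<phi>) w =
        Rk R (length (m # pre)) (Fa ((m # pre) @ (True, u) # (False, v) # post) i \<phi>) w"
      unfolding w m using K[of "- 1"] by (simp add: 2 Rk_add Rk_cmult mult.assoc)
    have c3: "Rk R (length (m # pre)) (\<lambda>u'. qq powi (e * kX ((m # pre) @ (True, u) # (False, v) # post) i u') * \<phi> u') w =
        qq powi (e * kX ((m # pre) @ (False, v) # (True, u) # post) i w) * Rk R (length (m # pre)) \<phi> w" for e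
    proof -
      have "Rk R (length (m # pre)) (\<lambda>u'. qq powi (e * kX ((m # pre) @ (True, u) # (False, v) # post) i u') * \<phi> u') w =
         Rk R (length pre) (\<lambda>u'. qq powi (e * kx b i c) * (qq powi (e * kX ?ms i u') * \<phi> (c # u'))) w'"
        unfolding w m by (simp add: qq_powi_mult distrib_left)
      also have "\<dots> = qq powi (e * kx b i c) * (qq powi (e * kX ?ms' i w') * Rk R (length pre) (\<lambda>u'. \<phi> (c # u')) w')"
        unfolding Rk_cmult K ..
      finally show ?thesis unfolding w m by (simp add: qq_powi_mult distrib_left)
    qed
    show ?case using c1 c2 c3 by blast
  qed
  then show ?t1 ?t2 ?t3 by blast+
qed

lemma Rk_Ba:
  assumes w: "w \<in> wds (length (pre @ (True, u) # (False, v) # post))"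
  shows "Ba (pre @ (False, v) # (True, u) # post) i (Rk R (length pre) \<phi>) w =
        Rk R (length pre) (Ba (pre @ (True, u) # (False, v) # post) i \<phi>) w"
proof -
  let ?ms = "pre @ (True, u) # (False, v) # post" and ?ms' = "pre @ (False, v) # (True, u) # post"
  have "Ea ?ms' (i + h) (\<lambda>u'. qq powi (- kX ?ms' i u') * Rk R (length pre) \<phi> u') w =
      Ea ?ms' (i + h) (Rk R (length pre) (\<lambda>u'. qq powi (- kX ?ms i u') * \<phi> u')) w"
    by (rule EaFa_cong(1)) (use w Rk_comm(3)[where e = "- 1"] in simp_all)
  then show ?thesis unfolding Ba_def
    by (simp add: Rk_comm(1)[OF w] Rk_comm(2)[OF w] Rk_add)
qed

end

section \<open>The K-matrix on the tensor product\<close>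

lemma h_div: "h = int (n div 2)"
  using nh by simp

lemma even_n: "even n"
  using nh by presburger

definition kk :: "factor list \<Rightarrow> int \<Rightarrow> int list \<Rightarrow> int" where
  "kk ms i w = kX ms i w - kX ms (i + h) w"

definition Kf :: "scalar \<Rightarrow> (int list \<Rightarrow> scalar) \<Rightarrow> int list \<Rightarrow> scalar" where
  "Kf z \<phi> w = (\<Sum>b\<in>{1..int n}. K_W n z (evec n (hd w)) (evec n b) * \<phi> (b # tl w))"

lemma Kf_Cons: "Kf z \<phi> (c # w) = (\<Sum>b\<in>{1..int n}. K_W n z (evec n c) (evec n b) * \<phi> (b # w))"
  by (simp add: Kf_def)

lemma row_B:
  assumes c: "c \<in> {1..int n}"
  shows "(\<Sum>d\<in>comps n 1. Bop n (modl b z) i (evec n c) d * \<psi> d) = fC b z i c * \<psi> (evec n (fS b c)) +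
      eC b z (i + h) c * (qq powi (- kx b i (eS b c)) * \<psi> (evec n (eS b c)))"
proof -
  have "(\<Sum>d\<in>comps n 1. mmul (comps n 1) (Eop (modl b z) (i + h)) (Kiop (modl b z) i) (evec n c) d * \<psi> d) =
      (\<Sum>e\<in>comps n 1. Eop (modl b z) (i + h) (evec n c) e * (\<Sum>d\<in>comps n 1. Kiop (modl b z) i e d * \<psi> d))"
    unfolding mmul_def sum_distrib_left sum_distrib_right by (subst sum.swap) (simp add: mult.assoc)
  also have "\<dots> = eC b z (i + h) c * (qq powi (- kx b i (eS b c)) * \<psi> (evec n (eS b c)))"
    unfolding row_EF[OF c] row_K[OF step_letters(1)[OF c]] ..
  finally show ?thesis
    unfolding Bop_def basis_modl h_div[symmetric] distrib_right sum.distrib row_EF[OF c] by simp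
qed

lemma row_KK:
  assumes c: "c \<in> {1..int n}"
  shows "(\<Sum>d\<in>comps n 1. KKop n (modl b z) i (evec n c) d * \<psi> d) =
      qq powi (kx b i c - kx b (i + h) c) * \<psi> (evec n c)"
proof -
  have "(\<Sum>d\<in>comps n 1. KKop n (modl b z) i (evec n c) d * \<psi> d) =
      (\<Sum>e\<in>comps n 1. Kop (modl b z) i (evec n c) e * (\<Sum>d\<in>comps n 1. Kiop (modl b z) (i + h) e d * \<psi> d))"
    unfolding KKop_def basis_modl h_div[symmetric] mmul_def sum_distrib_left sum_distrib_right
    by (subst sum.swap) (simp add: mult.assoc)
  also have "\<dots> = qq powi (kx b i c - kx b (i + h) c) * \<psi> (evec n c)"
    unfolding row_K[OF c] qq_powi_mult by simp
  finally show ?thesis .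
qed

lemma Kf_rows:
  assumes z: "z \<noteq> 0" and c: "c \<in> {1..int n}"
  shows "fC True (inverse z) i c * Kf z \<phi> (fS True c # w) +
      eC True (inverse z) (i + h) c * (qq powi (- kx True i (eS True c)) * Kf z \<phi> (eS True c # w)) =
      (\<Sum>b\<in>{1..int n}. K_W n z (evec n c) (evec n b) * (fC False z i b * \<phi> (fS False b # w) +
        eC False z (i + h) b * (qq powi (- kx False i (eS False b)) * \<phi> (eS False b # w))))" (is ?t1)
    "K_W n z (evec n c) (evec n b) \<noteq> 0 \<Longrightarrow> b \<in> {1..int n} \<Longrightarrow>
       kx True i c - kx True (i + h) c = kx False i b - kx False (i + h) b"
proof -
  let ?M = "modl False z" and ?N = "modl True (inverse z)"
  have "Ui_linear n ?M ?N (K_W n z)"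
    using K_W_Ui_linear[OF n4 even_n h_div z] by (simp add: modl_def)
  then have lin: "intertwines ?M ?N (K_W n z) (Bop n ?M i) (Bop n ?N i)"
      "intertwines ?M ?N (K_W n z) (KKop n ?M i) (KKop n ?N i)"
    by (auto simp: Ui_linear_def)
  have fin: "finite (basis ?M)" "finite (basis ?N)" using finite_comps[OF n0] by (simp_all add: basis_modl)
  have cN: "evec n c \<in> basis ?N" using evec_in_comps[OF n0] by (simp add: basis_modl)
  define \<psi> where "\<psi> d = \<phi> (lt d # w)" for d
  have \<psi>: "\<psi> (evec n b) = \<phi> (b # w)" if "b \<in> {1..int n}" for b
    using that by (simp add: \<psi>_def lt_evec)
  have KK: "(\<Sum>b\<in>comps n 1. K_W n z (evec n c) b * \<psi> b) = Kf z \<phi> (c # w)" for c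
    unfolding sum_comps_1 Kf_Cons by (intro sum.cong refl) (simp only: \<psi>)
  have B: "(\<Sum>b\<in>comps n 1. K_W n z (evec n c) b * (\<Sum>d\<in>comps n 1. Bop n ?M i b d * \<psi> d)) =
      (\<Sum>b\<in>{1..int n}. K_W n z (evec n c) (evec n b) * (fC False z i b * \<phi> (fS False b # w) +
        eC False z (i + h) b * (qq powi (- kx False i (eS False b)) * \<phi> (eS False b # w))))"
    unfolding sum_comps_1[of "\<lambda>b. K_W n z (evec n c) b * _ b"]
    by (intro sum.cong refl) (simp only: row_B \<psi> step_letters)
  show ?t1
    using intertwines_sum[OF lin(1) fin cN, of \<psi>]
    unfolding basis_modl B row_B[OF c] KK .
  assume nz: "K_W n z (evec n c) (evec n b) \<noteq> 0" and b: "b \<in> {1..int n}"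
  define \<delta> :: "comp \<Rightarrow> scalar" where "\<delta> d = of_bool (d = evec n b)" for d
  have \<delta>: "\<delta> (evec n j) = of_bool (j = b)" if "j \<in> {1..int n}" for j
    using evec_letter_eq[OF that b] by (simp add: \<delta>_def)
  have 1: "(\<Sum>d\<in>comps n 1. K_W n z (evec n c) d * \<delta> d) = K_W n z (evec n c) (evec n b)"
  proof -
    have "(\<Sum>d\<in>comps n 1. K_W n z (evec n c) d * \<delta> d) = (\<Sum>j\<in>{1..int n}. K_W n z (evec n c) (evec n j) * of_bool (j = b))"
      unfolding sum_comps_1 by (intro sum.cong refl) (simp only: \<delta>)
    then show ?thesis using sum_letter[OF b] by simp
  qed
  have 2: "(\<Sum>d\<in>comps n 1. K_W n z (evec n c) d * (\<Sum>e\<in>comps n 1. KKop n ?M i d e * \<delta> e)) =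
      K_W n z (evec n c) (evec n b) * qq powi (kx False i b - kx False (i + h) b)"
  proof -
    have "(\<Sum>d\<in>comps n 1. K_W n z (evec n c) d * (\<Sum>e\<in>comps n 1. KKop n ?M i d e * \<delta> e)) =
      (\<Sum>j\<in>{1..int n}. (K_W n z (evec n c) (evec n j) * qq powi (kx False i j - kx False (i + h) j)) * of_bool (j = b))"
      unfolding sum_comps_1[of "\<lambda>d. K_W n z (evec n c) d * _ d"]
      by (intro sum.cong refl) (simp only: row_KK \<delta> mult.assoc)
    then show ?thesis using sum_letter[OF b] by simp
  qed
  have "qq powi (kx True i c - kx True (i + h) c) * K_W n z (evec n c) (evec n b) =
      K_W n z (evec n c) (evec n b) * qq powi (kx False i b - kx False (i + h) b)"
    using intertwines_sum[OF lin(2) fin cN, of \<delta>]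
    unfolding basis_modl 2 row_KK[OF c] 1 .
  then show "kx True i c - kx True (i + h) c = kx False i b - kx False (i + h) b"
    using nz by (simp add: qq_powi_inject)
qed

text \<open>This is the coideal property: the coproduct of B_i is the sum of B_i \<otimes> K_i^-1, 1
  \<otimes> F_i and K_i^-1 K_{i+n'} \<otimes> E_{i+n'} K_i^-1. The first tensor factor sees only
  elements of the coideal subalgebra, so the K-matrix on that factor commutes with B_i on the whole
  product.\<close>

lemma Ba_Cons:
  "Ba ((b, z) # ms) i \<phi> (c # w) = qq powi (- kX ms i w) * (fC b z i c * \<phi> (fS b c # w) +
      eC b z (i + h) c * (qq powi (- kx b i (eS b c)) * \<phi> (eS b c # w))) +
    Fa ms i (\<lambda>u. \<phi> (c # u)) w +
    qq powi (- (kx b i c - kx b (i + h) c)) * Ea ms (i + h) (\<lambda>u. qq powi (- kX ms i u) * \<phi> (c # u)) w"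
proof -
  have "(\<lambda>u. qq powi (- (kx b i c + kX ms i u)) * \<phi> (c # u)) =
      (\<lambda>u. qq powi (- kx b i c) * (qq powi (- kX ms i u) * \<phi> (c # u)) + 0 * 0)"
    by (simp add: qq_powi_mult)
  then have "Ea ms (i + h) (\<lambda>u. qq powi (- (kx b i c + kX ms i u)) * \<phi> (c # u)) w =
      qq powi (- kx b i c) * Ea ms (i + h) (\<lambda>u. qq powi (- kX ms i u) * \<phi> (c # u)) w"
    using EaFa_linear(1)[of ms "i + h" "qq powi (- kx b i c)" _ 0 "\<lambda>_. 0"] by simp
  then show ?thesis
    unfolding Ba_def kX.simps Ea.simps Fa.simps by (simp add: algebra_simps qq_powi_mult flip: qq_powi_add)
qed

lemma Kf_Ba:
  assumes z: "z \<noteq> 0" and w: "w \<in> wds (Suc (length ms))"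
  shows "Ba ((True, inverse z) # ms) i (Kf z \<phi>) w = Kf z (Ba ((False, z) # ms) i \<phi>) w"
proof -
  obtain c w' where cw: "w = c # w'" and c: "c \<in> {1..int n}" using w by (auto simp: wds_Suc)
  let ?K = "\<lambda>b. K_W n z (evec n c) (evec n b)"
  have kx: "qq powi (- (kx True i c - kx True (i + h) c)) * (?K b * y) =
      ?K b * (qq powi (- (kx False i b - kx False (i + h) b)) * y)" if "b \<in> {1..int n}" for b y
    using Kf_rows(2)[OF z c _ that, of i] by (cases "?K b = 0") auto
  have l: "qq powi (- kX ms i u) * Kf z \<phi> (c # u) = (\<Sum>b\<in>{1..int n}. ?K b * (qq powi (- kX ms i u) * \<phi> (b # u)))" for u
    unfolding Kf_Cons sum_distrib_left by (intro sum.cong refl) simp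
  show ?thesis
    unfolding cw Ba_Cons unfolding Kf_rows(1)[OF z c] l unfolding Kf_Cons EaFa_sum Ba_Cons
    unfolding sum_distrib_left sum.distrib[symmetric]
    by (intro sum.cong refl) (simp only: kx distrib_left mult.left_commute[of "qq powi (- kX ms i w')" "?K _"] add.assoc)
qed

lemma Kf_kk:
  assumes z: "z \<noteq> 0" and w: "w \<in> wds (Suc (length ms))"
  shows "Kf z (\<lambda>u. qq powi (kk ((False, z) # ms) i u) * \<phi> u) w = qq powi (kk ((True, inverse z) # ms) i w) * Kf z \<phi> w"
proof -
  obtain c w' where cw: "w = c # w'" and c: "c \<in> {1..int n}" using w by (auto simp: wds_Suc)
  let ?K = "\<lambda>b. K_W n z (evec n c) (evec n b)"
  have "?K b * (qq powi (kk ((False, z) # ms) i (b # w')) * y) = qq powi (kk ((True, inverse z) # ms) i (c # w')) * (?K b * y)"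
    if "b \<in> {1..int n}" for b y
  proof (cases "?K b = 0")
    case False
    have "kk ((False, z) # ms) i (b # w') = kk ((True, inverse z) # ms) i (c # w')"
      using Kf_rows(2)[OF z c False that, of i] by (simp add: kk_def)
    then show ?thesis by simp
  qed simp
  then show ?thesis unfolding cw Kf_Cons sum_distrib_left by (intro sum.cong refl)
qed

lemma Rk_kk:
  assumes gen: "generic u v" and w: "w \<in> wds (length (pre @ (True, u) # (False, v) # post))"
  shows "Rk (R_W n u v) (length pre) (\<lambda>u'. qq powi (kk (pre @ (True, u) # (False, v) # post) i u') * \<phi> u') w =
      qq powi (kk (pre @ (False, v) # (True, u) # post) i w) * Rk (R_W n u v) (length pre) \<phi> w"
proof -
  have e: "qq powi (kk ms i u') * y = qq powi (1 * kX ms i u') * (qq powi (- 1 * kX ms (i + h) u') * y)" for ms u' y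
    by (simp add: qq_powi_mult kk_def)
  show ?thesis unfolding e Rk_comm(3)[OF gen refl w] ..
qed

section \<open>The operators of the definitions acting on words\<close>

lemma tensor_op_word:
  assumes "w \<in> wds s"
  shows "tensor_op n s T g (map (evec n) w) =
    (\<Sum>w'\<in>wds s. T (map (evec n) w) (map (evec n) w') * g (map (evec n) w'))"
proof -
  have "inj_on (map (evec n)) (wds s)" using map_evec_inj by (auto simp: inj_on_def)
  then show ?thesis
    using assms unfolding tensor_op_def tbasis_eq by (simp add: sum.reindex)
qed

lemma nth_wds: "w \<in> wds s \<Longrightarrow> k < s \<Longrightarrow> w ! k \<in> {1..int n}"
  unfolding wds_def using nth_mem by blast

lemma update_wds: "w \<in> wds s \<Longrightarrow> b \<in> {1..int n} \<Longrightarrow> w[k := b] \<in> wds s"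
  unfolding wds_def using set_update_subset_insert[of w k b] by auto

lemma tensor_R_word:
  assumes w: "w \<in> wds s" and k: "Suc k < s"
  shows "tensor_op n s (R_comp n s (Suc k) u v) g (map (evec n) w) =
    Rk (R_W n u v) k (\<lambda>u. g (map (evec n) u)) w"
proof -
  let ?A = "{w' \<in> wds s. \<forall>m<s. m \<noteq> k \<and> m \<noteq> Suc k \<longrightarrow> w ! m = w' ! m}"
  let ?R = "\<lambda>w'. R_W n u v (evec n (w ! k), evec n (w ! Suc k)) (evec n (w' ! k), evec n (w' ! Suc k)) * g (map (evec n) w')"
  have len: "length w' = s" if "w' \<in> wds s" for w' using that by (simp add: wds_def)
  have "tensor_op n s (R_comp n s (Suc k) u v) g (map (evec n) w) = (\<Sum>w'\<in>wds s. if w' \<in> ?A then ?R w' else 0)"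
    unfolding tensor_op_word[OF w]
  proof (rule sum.cong[OF refl])
    fix w' assume w': "w' \<in> wds s"
    have "(\<forall>m<s. m \<noteq> Suc k - 1 \<and> m \<noteq> Suc k \<longrightarrow> map (evec n) w ! m = map (evec n) w' ! m) \<longleftrightarrow> w' \<in> ?A"
      using w' len[OF w] len[OF w'] nth_wds[OF w] nth_wds[OF w'] evec_letter_eq by auto
    then show "R_comp n s (Suc k) u v (map (evec n) w) (map (evec n) w') * g (map (evec n) w') =
        (if w' \<in> ?A then ?R w' else 0)"
      unfolding R_comp_def using len[OF w] len[OF w'] k by simp
  qed
  also have "\<dots> = (\<Sum>w'\<in>?A. ?R w')"
    using finite_wds[of s] by (simp add: sum.inter_filter[symmetric])
  also have "\<dots> = (\<Sum>b\<in>{1..int n} \<times> {1..int n}. ?R (w[k := fst b, Suc k := snd b]))"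
  proof (rule sum.reindex_bij_witness[of _ "\<lambda>b. w[k := fst b, Suc k := snd b]" "\<lambda>w'. (w' ! k, w' ! Suc k)"])
    fix w' assume w': "w' \<in> ?A"
    then show "w[k := fst (w' ! k, w' ! Suc k), Suc k := snd (w' ! k, w' ! Suc k)] = w'"
      using len[OF w] len[of w'] k by (intro nth_equalityI) (auto simp: nth_list_update)
    show "(w' ! k, w' ! Suc k) \<in> {1..int n} \<times> {1..int n}"
      using w' nth_wds[of w' s k] nth_wds[of w' s "Suc k"] k by auto
    show "?R (w[k := fst (w' ! k, w' ! Suc k), Suc k := snd (w' ! k, w' ! Suc k)]) = ?R w'"
      using \<open>w[k := fst (w' ! k, w' ! Suc k), Suc k := snd (w' ! k, w' ! Suc k)] = w'\<close> by simp
  next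
    fix b assume b: "b \<in> {1..int n} \<times> {1..int n}"
    then show "w[k := fst b, Suc k := snd b] \<in> ?A"
      using update_wds[OF update_wds[OF w]] by auto
    show "(w[k := fst b, Suc k := snd b] ! k, w[k := fst b, Suc k := snd b] ! Suc k) = b"
      using len[OF w] k by simp
  qed
  also have "\<dots> = Rk (R_W n u v) k (\<lambda>u. g (map (evec n) u)) w"
    using len[OF w] k by (simp add: Rk_eq sum.cartesian_product split_def)
  finally show ?thesis .
qed

lemma tensor_K_word:
  assumes w: "w \<in> wds s" and s: "s > 0"
  shows "tensor_op n s (K_first n s z) g (map (evec n) w) = Kf z (\<lambda>u. g (map (evec n) u)) w"
proof -
  obtain c w1 where cw: "w = c # w1" "c \<in> {1..int n}" "w1 \<in> wds (s - 1)"
    using w s wds_Suc[of w "s - 1"] by auto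
  let ?A = "{w' \<in> wds s. tl w' = w1}"
  let ?R = "\<lambda>w'. K_W n z (evec n c) (evec n (hd w')) * g (map (evec n) w')"
  have "tensor_op n s (K_first n s z) g (map (evec n) w) = (\<Sum>w'\<in>wds s. if w' \<in> ?A then ?R w' else 0)"
    unfolding tensor_op_word[OF w]
  proof (rule sum.cong[OF refl])
    fix w' assume w': "w' \<in> wds s"
    then obtain c' w2 where w2: "w' = c' # w2" "w2 \<in> wds (s - 1)" using s wds_Suc[of w' "s - 1"] by auto
    have "(\<forall>m<s. m \<noteq> 0 \<longrightarrow> map (evec n) w ! m = map (evec n) w' ! m) \<longleftrightarrow> map (evec n) w1 = map (evec n) w2"
      using s w2 cw unfolding list_eq_iff_nth_eq
      by (auto simp: wds_def nth_Cons' gr0_conv_Suc less_Suc_eq_0_disj)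
    also have "\<dots> \<longleftrightarrow> w' \<in> ?A" using map_evec_inj[OF cw(3) w2(2)] w2 w' by auto
    finally show "K_first n s z (map (evec n) w) (map (evec n) w') * g (map (evec n) w') =
        (if w' \<in> ?A then ?R w' else 0)"
      unfolding K_first_def using cw w2 w' by auto
  qed
  also have "\<dots> = (\<Sum>w'\<in>?A. ?R w')"
    using finite_wds[of s] by (simp add: sum.inter_filter[symmetric])
  also have "\<dots> = (\<Sum>b\<in>{1..int n}. ?R (b # w1))"
    by (rule sum.reindex_bij_witness[of _ "\<lambda>b. b # w1" hd])
       (use cw s wds_Suc[of _ "s - 1"] in \<open>auto simp: wds_Cons\<close>)
  also have "\<dots> = Kf z (\<lambda>u. g (map (evec n) u)) w"
    by (simp add: Kf_Cons cw)
  finally show ?thesis .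
qed

definition gw :: "(comp list \<Rightarrow> scalar) \<Rightarrow> int list \<Rightarrow> scalar" where
  "gw g w = g (map (evec n) w)"

definition ind :: "int list \<Rightarrow> int list \<Rightarrow> scalar" where
  "ind w0 w = of_bool (w = w0)"

text \<open>\<open>TR ms w0 ms' w0' X\<close>: the operator \<open>X\<close> on the \<open>s\<close>-fold tensor product commutes with the
  generators of the \<open>\<imath>\<close>quantum group and sends the basis vector \<open>w0\<close> to a nonzero multiple of \<open>w0'\<close>.\<close>

definition TR :: "nat \<Rightarrow> factor list \<Rightarrow> int list \<Rightarrow> factor list \<Rightarrow> int list \<Rightarrow>
    ((comp list \<Rightarrow> scalar) \<Rightarrow> comp list \<Rightarrow> scalar) \<Rightarrow> bool" where
  "TR s ms w0 ms' w0' X \<longleftrightarrow>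
     (\<forall>i g g'. (\<forall>w\<in>wds s. gw g' w = Ba ms i (gw g) w) \<longrightarrow>
        (\<forall>w\<in>wds s. gw (X g') w = Ba ms' i (gw (X g)) w)) \<and>
     (\<forall>i g g'. (\<forall>w\<in>wds s. gw g' w = qq powi (kk ms i w) * gw g w) \<longrightarrow>
        (\<forall>w\<in>wds s. gw (X g') w = qq powi (kk ms' i w) * gw (X g) w)) \<and>
     (\<forall>g c. c \<noteq> 0 \<longrightarrow> (\<forall>w\<in>wds s. gw g w = c * ind w0 w) \<longrightarrow>
        (\<exists>c'. c' \<noteq> 0 \<and> (\<forall>w\<in>wds s. gw (X g) w = c' * ind w0' w)))"

lemma TR_comp:
  assumes "TR s ms w0 ms' w0' X" "TR s ms' w0' ms'' w0'' Y"
  shows "TR s ms w0 ms'' w0'' (Y \<circ> X)"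
proof -
  note X = assms(1)[unfolded TR_def] and Y = assms(2)[unfolded TR_def]
  show ?thesis unfolding TR_def o_apply
  proof (intro conjI allI impI)
    fix i g g' assume "\<forall>w\<in>wds s. gw g' w = Ba ms i (gw g) w"
    then have "\<forall>w\<in>wds s. gw (X g') w = Ba ms' i (gw (X g)) w" using conjunct1[OF X] by simp
    then show "\<forall>w\<in>wds s. gw (Y (X g')) w = Ba ms'' i (gw (Y (X g))) w" using conjunct1[OF Y] by simp
  next
    fix i g g' assume "\<forall>w\<in>wds s. gw g' w = qq powi (kk ms i w) * gw g w"
    then have "\<forall>w\<in>wds s. gw (X g') w = qq powi (kk ms' i w) * gw (X g) w"
      using conjunct1[OF conjunct2[OF X]] by simp
    then show "\<forall>w\<in>wds s. gw (Y (X g')) w = qq powi (kk ms'' i w) * gw (Y (X g)) w"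
      using conjunct1[OF conjunct2[OF Y]] by simp
  next
    fix g c assume "c \<noteq> (0 :: scalar)" "\<forall>w\<in>wds s. gw g w = c * ind w0 w"
    then obtain c' where "c' \<noteq> 0" "\<forall>w\<in>wds s. gw (X g) w = c' * ind w0' w"
      using conjunct2[OF conjunct2[OF X]] by blast
    then show "\<exists>c'. c' \<noteq> 0 \<and> (\<forall>w\<in>wds s. gw (Y (X g)) w = c' * ind w0'' w)"
      using conjunct2[OF conjunct2[OF Y]] by blast
  qed
qed

lemma TR_id: "TR s ms w0 ms w0 id"
  by (auto simp: TR_def)

lemma Rk_cong:
  assumes "w \<in> wds s" "Suc k < s" "\<And>u. u \<in> wds s \<Longrightarrow> \<phi> u = \<psi> u"
  shows "Rk R k \<phi> w = Rk R k \<psi> w"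
  using assms update_wds[OF update_wds[OF assms(1)]]
  by (simp add: Rk_eq wds_def)

lemma Kf_cong:
  assumes "w \<in> wds s" "s > 0" "\<And>u. u \<in> wds s \<Longrightarrow> \<phi> u = \<psi> u"
  shows "Kf z \<phi> w = Kf z \<psi> w"
proof -
  obtain c w1 where cw: "w = c # w1" "w1 \<in> wds (s - 1)"
    using assms wds_Suc[of w "s - 1"] by auto
  show ?thesis unfolding cw(1) Kf_Cons using assms(2,3) cw(2) wds_Cons[of _ w1 "s - 1"]
    by (intro sum.cong refl) auto
qed

text \<open>Only pairs of different letters are considered; their image is known up to a nonzero
  scalar for every choice of R.\<close>

lemma Rk_ind:
  assumes gen: "generic u v" and b: "b1 \<in> {1..int n}" "b2 \<in> {1..int n}" "b1 \<noteq> b2"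
  shows "w \<in> wds s \<Longrightarrow> Rk (R_W n u v) (length pre) (ind (pre @ b1 # b2 # post)) w =
    (if Suc (length pre) < s then R_W n u v (evec n b2, evec n b1) (evec n b1, evec n b2) else 0) * ind (pre @ b2 # b1 # post) w"
proof (induction pre arbitrary: w s)
  case Nil
  show ?case
  proof (cases "Suc 0 < s")
    case False
    then consider "s = 0" | "s = Suc 0" by linarith
    then show ?thesis using Nil by cases (auto simp: wds_0 wds_Suc)
  next
    case True
    obtain s' where "s = Suc (Suc s')" using less_imp_Suc_add[OF True] by auto
    with Nil obtain c1 c2 w' where w: "w = c1 # c2 # w'" and l: "c1 \<in> {1..int n}" "c2 \<in> {1..int n}"
      by (auto simp: wds_Suc)
    let ?r = "R_W n u v (evec n c1, evec n c2) (evec n b1, evec n b2)"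
    have "Rk (R_W n u v) 0 (ind (b1 # b2 # post)) w = (\<Sum>d1\<in>{1..int n}. \<Sum>d2\<in>{1..int n}.
        (R_W n u v (evec n c1, evec n c2) (evec n d1, evec n d2) * of_bool (w' = post)) * of_bool (d1 = b1) * of_bool (d2 = b2))"
      unfolding w Rk.simps ind_def by (intro sum.cong refl) auto
    also have "\<dots> = ?r * of_bool (w' = post)"
      unfolding sum_letter[OF b(2)] sum_letter[OF b(1)] ..
    also have "\<dots> = R_W n u v (evec n b2, evec n b1) (evec n b1, evec n b2) * ind (b2 # b1 # post) w"
    proof (cases "?r = 0")
      case True
      then have "ind (b2 # b1 # post) w = 0"
        using R_W_nonzero[of u v b1 b2] gen b by (auto simp: generic_def ind_def w)
      then show ?thesis using True by simp
    next
      case False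
      then have "c1 = b2 \<and> c2 = b1"
        using R_W_weight[of u v c1 c2 b1 b2] gen b l unfolding generic_def by blast
      then show ?thesis by (simp add: ind_def w)
    qed
    finally show ?thesis using True by simp
  qed
next
  case (Cons p pre)
  show ?case
  proof (cases s)
    case 0
    then show ?thesis using Cons.prems by (simp add: wds_0)
  next
    case (Suc s')
    then obtain c w' where w: "w = c # w'" "w' \<in> wds s'" using Cons.prems wds_Suc by auto
    have "(\<lambda>u. ind ((p # pre) @ b1 # b2 # post) (c # u)) = (\<lambda>u. of_bool (c = p) * ind (pre @ b1 # b2 # post) u)"
      by (auto simp: ind_def)
    then show ?thesis
      unfolding w(1) using Cons.IH[OF w(2)] by (simp add: Rk_cmult Suc) (simp add: ind_def)
  qed
qed

lemma TR_R:
  assumes gen: "generic u v" and s: "s = length (pre @ (True, u) # (False, v) # post)"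
    and b: "b1 \<in> {1..int n}" "b2 \<in> {1..int n}" "b1 \<noteq> b2" and l: "length wp = length pre"
  shows "TR s (pre @ (True, u) # (False, v) # post) (wp @ b1 # b2 # wq)
    (pre @ (False, v) # (True, u) # post) (wp @ b2 # b1 # wq)
    (tensor_op n s (R_comp n s (Suc (length pre)) u v))"
proof -
  let ?ms = "pre @ (True, u) # (False, v) # post" and ?ms' = "pre @ (False, v) # (True, u) # post"
  let ?X = "tensor_op n s (R_comp n s (Suc (length pre)) u v)"
  have k: "Suc (length pre) < s" using s by simp
  have X: "gw (?X g) w = Rk (R_W n u v) (length pre) (gw g) w" if "w \<in> wds s" for g w
    unfolding gw_def using tensor_R_word[OF that k] .
  have s': "length ?ms' = s" "length ?ms = s" using s by simp_all
  show ?thesis unfolding TR_def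
  proof (intro conjI allI impI ballI)
    fix i g g' w assume a: "\<forall>w\<in>wds s. gw g' w = Ba ?ms i (gw g) w" and w: "w \<in> wds s"
    have "gw (?X g') w = Rk (R_W n u v) (length pre) (Ba ?ms i (gw g)) w"
      unfolding X[OF w] by (rule Rk_cong[OF w k]) (use a in auto)
    also have "\<dots> = Ba ?ms' i (Rk (R_W n u v) (length pre) (gw g)) w"
      using Rk_Ba[OF gen refl, of w pre post i "gw g"] w s by simp
    also have "\<dots> = Ba ?ms' i (gw (?X g)) w"
      by (rule Ba_cong) (use w X s' in auto)
    finally show "gw (?X g') w = Ba ?ms' i (gw (?X g)) w" .
  next
    fix i g g' w assume a: "\<forall>w\<in>wds s. gw g' w = qq powi (kk ?ms i w) * gw g w" and w: "w \<in> wds s"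
    have "gw (?X g') w = Rk (R_W n u v) (length pre) (\<lambda>w. qq powi (kk ?ms i w) * gw g w) w"
      unfolding X[OF w] by (rule Rk_cong[OF w k]) (use a in auto)
    also have "\<dots> = qq powi (kk ?ms' i w) * gw (?X g) w"
      unfolding X[OF w] using Rk_kk[OF gen, of w pre post i "gw g"] w s by simp
    finally show "gw (?X g') w = qq powi (kk ?ms' i w) * gw (?X g) w" .
  next
    fix g c assume c: "c \<noteq> (0 :: scalar)" and a: "\<forall>w\<in>wds s. gw g w = c * ind (wp @ b1 # b2 # wq) w"
    let ?r = "R_W n u v (evec n b2, evec n b1) (evec n b1, evec n b2)"
    have "gw (?X g) w = c * ?r * ind (wp @ b2 # b1 # wq) w" if w: "w \<in> wds s" for w
    proof -
      have "gw (?X g) w = Rk (R_W n u v) (length pre) (\<lambda>w. c * ind (wp @ b1 # b2 # wq) w) w"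
        unfolding X[OF w] by (rule Rk_cong[OF w k]) (use a in auto)
      then show ?thesis using Rk_ind[OF gen b w, of wp wq] k l by (simp add: Rk_cmult)
    qed
    moreover have "c * ?r \<noteq> 0" using c R_W_nonzero[of u v b1 b2] gen b by (auto simp: generic_def)
    ultimately show "\<exists>c'. c' \<noteq> 0 \<and> (\<forall>w\<in>wds s. gw (?X g) w = c' * ind (wp @ b2 # b1 # wq) w)" by blast
  qed
qed

lemma h1_range: "1 + h \<in> {1..int n}" "1 \<in> {1..int n}" "1 + h \<noteq> 1"
  using h2 nh by auto

lemma TR_K:
  assumes z: "z \<noteq> 0" and s: "s = Suc (length ms)"
  shows "TR s ((False, z) # ms) (1 # wq) ((True, inverse z) # ms) ((1 + h) # wq)
    (tensor_op n s (K_first n s z))"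
proof -
  let ?ms = "(False, z) # ms" and ?ms' = "(True, inverse z) # ms"
  let ?X = "tensor_op n s (K_first n s z)"
  have k: "s > 0" using s by simp
  have X: "gw (?X g) w = Kf z (gw g) w" if "w \<in> wds s" for g w
    unfolding gw_def using tensor_K_word[OF that k] .
  have s': "length ?ms' = s" "length ?ms = s" using s by simp_all
  show ?thesis unfolding TR_def
  proof (intro conjI allI impI ballI)
    fix i g g' w assume a: "\<forall>w\<in>wds s. gw g' w = Ba ?ms i (gw g) w" and w: "w \<in> wds s"
    have "gw (?X g') w = Kf z (Ba ?ms i (gw g)) w"
      unfolding X[OF w] by (rule Kf_cong[OF w k]) (use a in auto)
    also have "\<dots> = Ba ?ms' i (Kf z (gw g)) w"
      using Kf_Ba[OF z, of w ms i "gw g"] w s by simp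
    also have "\<dots> = Ba ?ms' i (gw (?X g)) w"
      by (rule Ba_cong) (use w X s' in auto)
    finally show "gw (?X g') w = Ba ?ms' i (gw (?X g)) w" .
  next
    fix i g g' w assume a: "\<forall>w\<in>wds s. gw g' w = qq powi (kk ?ms i w) * gw g w" and w: "w \<in> wds s"
    have "gw (?X g') w = Kf z (\<lambda>w. qq powi (kk ?ms i w) * gw g w) w"
      unfolding X[OF w] by (rule Kf_cong[OF w k]) (use a in auto)
    also have "\<dots> = qq powi (kk ?ms' i w) * gw (?X g) w"
      unfolding X[OF w] using Kf_kk[OF z, of w ms i "gw g"] w s by simp
    finally show "gw (?X g') w = qq powi (kk ?ms' i w) * gw (?X g) w" .
  next
    fix g c assume c: "c \<noteq> (0 :: scalar)" and a: "\<forall>w\<in>wds s. gw g w = c * ind (1 # wq) w"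
    have kw: "K_W n z (evec n c1) (evec n 1) = of_bool (c1 = 1 + h)" if "c1 \<in> {1..int n}" for c1
      using K_W_column[OF n0, of z "evec n c1" 1] evec_letter_eq[OF that h1_range(1)] h2
      by (simp add: h_div[symmetric] K_w_def)
    have "gw (?X g) w = c * ind ((1 + h) # wq) w" if w: "w \<in> wds s" for w
    proof -
      obtain c1 w1 where cw: "w = c1 # w1" "c1 \<in> {1..int n}" using w s wds_Suc by auto
      have "gw (?X g) w = Kf z (\<lambda>w. c * ind (1 # wq) w) w"
        unfolding X[OF w] by (rule Kf_cong[OF w k]) (use a in auto)
      also have "\<dots> = (\<Sum>b\<in>{1..int n}. (c * K_W n z (evec n c1) (evec n b) * of_bool (w1 = wq)) * of_bool (b = 1))"
        unfolding cw(1) Kf_Cons by (intro sum.cong refl) (auto simp: ind_def)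
      also have "\<dots> = c * ind ((1 + h) # wq) w"
        unfolding sum_letter[OF h1_range(2)] kw[OF cw(2)] by (auto simp: ind_def cw(1))
      finally show ?thesis .
    qed
    then show "\<exists>c'. c' \<noteq> 0 \<and> (\<forall>w\<in>wds s. gw (?X g) w = c' * ind ((1 + h) # wq) w)" using c by blast
  qed
qed

section \<open>Spectral parameters and the extremal vector along the product defining K\<close>

definition zP :: "nat \<Rightarrow> nat \<Rightarrow> scalar" where
  "zP s j = qq powi (- int s + 2 * int j - 1) * xx"

definition zD :: "nat \<Rightarrow> nat \<Rightarrow> nat \<Rightarrow> scalar" where
  "zD s j k = qq powi (int s - 2 * int j + 2 * int k + 1) * inverse xx"

definition primal_tail :: "nat \<Rightarrow> nat \<Rightarrow> factor list" where
  "primal_tail s j = map (\<lambda>k. (False, zP s k)) [Suc j..<Suc s]"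

text \<open>After j steps the first j factors are dual. Their parameters are those that the
  R-matrices of step j + 1 expect, hence \<open>Suc j\<close>; they satisfy
  \<open>zD s (Suc j) (Suc k) = zD s j k\<close>, and the new first one is the inverse of
  \<open>zP s j\<close>.\<close>

definition dual_head :: "nat \<Rightarrow> nat \<Rightarrow> factor list" where
  "dual_head s j = map (\<lambda>k. (True, zD s (Suc j) k)) [1..<Suc j]"

text \<open>Step j carries the j-th primal factor leftwards past the j - 1 dual ones and then
  applies K to it in front. Every swap involves the different letters 1 + h and 1, so a basis vector
  stays a nonzero multiple of a basis vector.\<close>

lemma TR_K_factor:
  assumes j: "1 \<le> j" "j \<le> s"
  shows "TR s (dual_head s (j - 1) @ primal_tail s (j - 1)) (replicate (j - 1) (1 + h) @ replicate (Suc s - j) 1)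
     (dual_head s j @ primal_tail s j) (replicate j (1 + h) @ replicate (s - j) 1) (K_factor n s j)"
proof -
  let ?D = "\<lambda>k. (True, zD s j k)"
  \<comment> \<open>The list of factors at the moment when the primal factor stands at position k
    (counted from 1); \<open>?w k\<close> is the word of the extremal vector at that moment. The
    index k descends from j to 1.\<close>
  let ?st = "\<lambda>k. map ?D [1..<k] @ (False, zP s j) # map ?D [k..<j] @ primal_tail s j"
  let ?w = "\<lambda>k. replicate (k - 1) (1 + h) @ 1 # replicate (j - k) (1 + h) @ replicate (s - j) 1"
  let ?F = "\<lambda>k g. tensor_op n s (R_comp n s k (zD s j k) (zP s j)) \<circ> g"
  have gen: "generic (zD s j k) (zP s j)" for k
    unfolding zD_def zP_def by (rule generic_powers)
  have lpt: "length (primal_tail s j) = s - j" by (simp add: primal_tail_def del: upt_Suc)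
  have main: "TR s (?st j) (?w j) (?st k) (?w k) (foldr ?F [k..<j] id)" if "1 \<le> k" "k \<le> j" for k
    using that(2,1)
  proof (induction k rule: inc_induct)
    case base
    then show ?case using TR_id by (simp add: id_def)
  next
    case (step k)
    have IH: "TR s (?st j) (?w j) (?st (Suc k)) (?w (Suc k)) (foldr ?F [Suc k..<j] id)"
      by (rule step.IH) simp
    have u1: "[1..<Suc k] = [1..<k] @ [k]" using step by simp
    have u2: "[k..<j] = k # [Suc k..<j]" using step by (simp add: upt_conv_Cons)
    have st1: "?st (Suc k) = map ?D [1..<k] @ ?D k # (False, zP s j) # (map ?D [Suc k..<j] @ primal_tail s j)"
      unfolding u1 by simp
    have st2: "?st k = map ?D [1..<k] @ (False, zP s j) # ?D k # (map ?D [Suc k..<j] @ primal_tail s j)"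
      unfolding u2 by simp
    have w1: "?w (Suc k) = replicate (k - 1) (1 + h) @ (1 + h) # 1 # (replicate (j - Suc k) (1 + h) @ replicate (s - j) 1)"
    proof -
      have "replicate k (1 + h) = replicate (k - 1) (1 + h) @ [1 + h]"
        using step by (metis Suc_diff_1 replicate_Suc replicate_append_same less_eq_Suc_le One_nat_def)
      then show ?thesis by simp
    qed
    have w2: "?w k = replicate (k - 1) (1 + h) @ 1 # (1 + h) # (replicate (j - Suc k) (1 + h) @ replicate (s - j) 1)"
    proof -
      have "j - k = Suc (j - Suc k)" using step by simp
      then show ?thesis by simp
    qed
    have "TR s (?st (Suc k)) (?w (Suc k)) (?st k) (?w k) (tensor_op n s (R_comp n s (Suc (length (map ?D [1..<k]))) (zD s j k) (zP s j)))"
      unfolding st1 st2 w1 w2 using step j lpt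
      by (intro TR_R gen h1_range) simp_all
    moreover have "Suc (length (map ?D [1..<k])) = k" using step by simp
    ultimately have "TR s (?st (Suc k)) (?w (Suc k)) (?st k) (?w k) (tensor_op n s (R_comp n s k (zD s j k) (zP s j)))"
      by simp
    have "foldr ?F (k # [Suc k..<j]) id = tensor_op n s (R_comp n s k (zD s j k) (zP s j)) \<circ> foldr ?F [Suc k..<j] id"
      by simp
    with TR_comp[OF IH \<open>TR s _ _ _ _ (tensor_op n s (R_comp n s k (zD s j k) (zP s j)))\<close>] show ?case by (simp only: u2)
  qed
  have z0: "zP s j \<noteq> 0" using qq_nonzero xx_nonzero by (simp add: zP_def)
  have iz: "inverse (zP s j) = zD s (Suc j) 1"
  proof -
    have e: "int s - 2 * int (Suc j) + 2 * int 1 + 1 = - (- int s + 2 * int j - 1)" by simp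
    show ?thesis unfolding zP_def zD_def e power_int_minus by (rule inverse_mult_distrib)
  qed
  have K: "TR s (?st 1) (?w 1) ((True, inverse (zP s j)) # map ?D [1..<j] @ primal_tail s j)
     ((1 + h) # replicate (j - 1) (1 + h) @ replicate (s - j) 1) (tensor_op n s (K_first n s (zP s j)))"
    using TR_K[OF z0, of s "map ?D [1..<j] @ primal_tail s j"] j lpt by simp
  have K_factor: "K_factor n s j = tensor_op n s (K_first n s (zP s j)) \<circ> foldr ?F [1..<j] id"
    unfolding K_factor_def Let_def zP_def zD_def by (rule refl)
  have e1: "dual_head s (j - 1) @ primal_tail s (j - 1) = ?st j"
  proof -
    have "[Suc (j - 1)..<Suc s] = j # [Suc j..<Suc s]" using j by (simp add: upt_conv_Cons)
    then show ?thesis using j by (simp add: dual_head_def primal_tail_def)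
  qed
  have e2: "(True, inverse (zP s j)) # map ?D [1..<j] = dual_head s j"
  proof -
    have "[1..<Suc j] = 1 # map Suc [1..<j]" using j by (simp add: map_Suc_upt upt_conv_Cons)
    then show ?thesis by (simp add: dual_head_def iz) (simp add: zD_def algebra_simps)
  qed
  have e3: "replicate (j - 1) (1 + h) @ replicate (Suc s - j) 1 = ?w j"
    using j by (simp add: Suc_diff_le)
  have e4: "(1 + h) # replicate (j - 1) (1 + h) @ replicate (s - j) 1 = replicate j (1 + h) @ replicate (s - j) 1"
    using j by (cases j) auto
  show ?thesis
    using TR_comp[OF main[of 1] K] j unfolding K_factor e1 e3 e4[symmetric] e2[symmetric] by simp
qed

lemma pms_map: "pms b (qq powi a * y) m = map (\<lambda>k. (b, qq powi (a + 2 * int k) * y)) [0..<m]"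
proof (induction m arbitrary: a)
  case (Suc m)
  have e: "[0..<Suc m] = 0 # map Suc [0..<m]" by (simp add: map_Suc_upt upt_conv_Cons del: upt_Suc)
  have "pms b (qq powi 2 * (qq powi a * y)) m = map (\<lambda>k. (b, qq powi (a + 2 * int (Suc k)) * y)) [0..<m]"
    using Suc.IH[of "2 + a"] unfolding qq_powi_mult by (simp add: algebra_simps)
  then show ?case unfolding pms.simps e by simp
qed simp

lemma primal_eq: "primal_tail s 0 = pms False (qq powi (1 - int s) * xx) s"
proof -
  have "[Suc 0..<Suc s] = map Suc [0..<s]" by (simp add: map_Suc_upt)
  then show ?thesis unfolding pms_map primal_tail_def by (simp add: zP_def algebra_simps del: upt_Suc)
qed

lemma dual_eq: "dual_head s s = pms True (qq powi (1 - int s) * inverse xx) s"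
proof -
  have "[1..<Suc s] = map Suc [0..<s]" by (simp add: map_Suc_upt)
  then show ?thesis unfolding pms_map dual_head_def by (simp add: zD_def algebra_simps del: upt_Suc)
qed

lemma TR_K_full:
  "TR s (pms False (qq powi (1 - int s) * xx) s) (replicate s 1)
     (pms True (qq powi (1 - int s) * inverse xx) s) (replicate s (1 + h)) (K_full n s)"
proof -
  have "TR s (dual_head s 0 @ primal_tail s 0) (replicate 0 (1 + h) @ replicate s 1)
     (dual_head s j @ primal_tail s j) (replicate j (1 + h) @ replicate (s - j) 1) (fold (K_factor n s) [1..<Suc j])"
    if "j \<le> s" for j
    using that
  proof (induction j)
    case 0
    then show ?case using TR_id by (simp add: id_def)
  next
    case (Suc j)
    have "TR s (dual_head s j @ primal_tail s j) (replicate j (1 + h) @ replicate (s - j) 1)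
      (dual_head s (Suc j) @ primal_tail s (Suc j)) (replicate (Suc j) (1 + h) @ replicate (s - Suc j) 1) (K_factor n s (Suc j))"
      using TR_K_factor[of "Suc j" s] Suc.prems by simp
    moreover have "fold (K_factor n s) [1..<Suc (Suc j)] = K_factor n s (Suc j) \<circ> fold (K_factor n s) [1..<Suc j]"
      by (simp add: o_assoc)
    ultimately show ?case using TR_comp[OF Suc.IH] Suc.prems by (simp only: Suc_leD)
  qed
  from this[of s] show ?thesis
    unfolding K_full_def primal_eq[symmetric] dual_eq[symmetric]
    by (simp add: dual_head_def[of s 0] primal_tail_def[of s s])
qed

text \<open>Linearity is stated for sums indexed by compositions, the form in which an embedded
  vector is expanded.\<close>

definition linear_op :: "((comp list \<Rightarrow> scalar) \<Rightarrow> comp list \<Rightarrow> scalar) \<Rightarrow> bool" where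
  "linear_op X \<longleftrightarrow> (\<forall>A c G. finite A \<longrightarrow>
     X (\<lambda>l. \<Sum>a\<in>(A :: comp set). c a * G a l) = (\<lambda>l. \<Sum>a\<in>A. c a * X (G a) l))"

lemma linear_tensor_op: "linear_op (tensor_op n s T)"
proof -
  have "(\<Sum>l\<in>tbasis n s. T l' l * (\<Sum>a\<in>A. c a * G a l)) = (\<Sum>a\<in>A. c a * (\<Sum>l\<in>tbasis n s. T l' l * G a l))"
    for l' c G and A :: "comp set"
    unfolding sum_distrib_left by (subst sum.swap) (simp add: mult.left_commute)
  then show ?thesis unfolding linear_op_def tensor_op_def by (simp add: fun_eq_iff)
qed

lemma linear_op_comp: "linear_op X \<Longrightarrow> linear_op Y \<Longrightarrow> linear_op (X \<circ> Y)"
  by (auto simp: linear_op_def)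

lemma linear_K_full: "linear_op (K_full n s)"
proof -
  have id: "linear_op id" by (simp add: linear_op_def)
  have f: "linear_op (foldr (\<lambda>k g. tensor_op n s (T k) \<circ> g) ks id)" for T ks
  proof (induction ks)
    case (Cons k ks)
    then show ?case using linear_op_comp[OF linear_tensor_op Cons.IH] by (simp add: comp_def)
  qed (use id in \<open>simp add: id_def\<close>)
  have "linear_op (K_factor n s j)" for j
    unfolding K_factor_def Let_def by (intro linear_op_comp linear_tensor_op f)
  then have "linear_op (fold (K_factor n s) js \<circ> X)" if "linear_op X" for js X
    using that by (induction js arbitrary: X) (simp_all add: o_assoc[symmetric] linear_op_comp comp_assoc)
  from this[OF id] show ?thesis by (simp add: K_full_def)
qed

lemma K_full_outside: "s \<ge> 1 \<Longrightarrow> l \<notin> tbasis n s \<Longrightarrow> K_full n s g l = 0"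
  by (simp add: K_full_def K_factor_def Let_def tensor_op_def)

end

lemma rdeg_rat_x_powi: "rdeg (rat_x powi k) = k"
proof -
  have p: "rdeg (f ^ m) = int m * rdeg f" if "f \<noteq> 0" for f :: ratx and m
    using that rdeg_of_int[of 1] by (induction m) (simp_all add: rdeg_mult algebra_simps)
  show ?thesis
    using p[OF rat_x_nonzero, of "nat k"] p[of "inverse rat_x" "nat (- k)"] rat_x_nonzero
    by (simp add: power_int_def rdeg_rat_x rdeg_inverse_rat_x)
qed

lemma rdeg_of_int_nonzero: "of_int k \<noteq> (0 :: ratx) \<Longrightarrow> rdeg (of_int k :: ratx) = 0"
  by (rule rdeg_of_int) auto

context even_rank
begin

section \<open>The extremal vector generates the Kirillov-Reshetikhin module\<close>

text \<open>\<open>BW\<close> evaluates its formula at any \<gamma>; only its values on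
  \<open>comps n s\<close> are coordinates of a vector, and the rest is cut off.\<close>

definition rst :: "nat \<Rightarrow> (comp \<Rightarrow> scalar) \<Rightarrow> comp \<Rightarrow> scalar" where
  "rst s f \<gamma> = (if \<gamma> \<in> comps n s then f \<gamma> else 0)"

definition vtop :: "nat \<Rightarrow> int \<Rightarrow> comp \<Rightarrow> scalar" where
  "vtop s i \<gamma> = of_bool (\<gamma> = conc n s i)"

text \<open>The vectors obtained by applying words in the B_i to the extremal vector. Their span is
  not formed; generation is expressed by saying that a functional vanishing on all of them is
  zero.\<close>

inductive cyc :: "nat \<Rightarrow> (comp \<Rightarrow> scalar) \<Rightarrow> bool" for s where
  cyc_base: "cyc s (vtop s 1)"
| cyc_step: "cyc s f \<Longrightarrow> cyc s (rst s (BW False xx i f))"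

definition lsum :: "(int \<Rightarrow> int) \<Rightarrow> comp \<Rightarrow> int" where
  "lsum p \<gamma> = (\<Sum>k\<in>{1..<1 + int n}. p k * \<gamma> k)"

lemma lsum_mv: "a \<in> {1..int n} \<Longrightarrow> b \<in> {1..int n} \<Longrightarrow> lsum p (mv n a b \<gamma>) = lsum p \<gamma> + p a - p b"
  using sum_mult_evec[of a 1 n p] sum_mult_evec[of b 1 n p]
  by (simp add: lsum_def mv_def algebra_simps sum.distrib sum_subtractf)

text \<open>The principal grading: \<open>x\<close> has degree \<open>n\<close> and \<open>v\<^sub>\<gamma>\<close> has degree
  \<open>- (\<Sum>j. j * \<gamma> j)\<close>, so that \<open>E\<^sub>i\<close> raises the degree by one and \<open>F\<^sub>i\<close> lowers it by one.\<close>

definition dle :: "ratx \<Rightarrow> comp \<Rightarrow> int \<Rightarrow> bool" where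
  "dle c \<gamma> k \<longleftrightarrow> c = 0 \<or> int n * rdeg c - lsum id \<gamma> \<le> k"

lemma dle_add:
  assumes "dle c \<gamma> k" "dle d \<gamma> k"
  shows "dle (c + d) \<gamma> k"
proof (cases "c = 0 \<or> d = 0 \<or> c + d = 0")
  case False
  have "rdeg_le (c + d) (max (rdeg c) (rdeg d))"
    by (rule rdeg_le_add) (simp_all add: rdeg_le_def)
  then have "int n * rdeg (c + d) \<le> int n * max (rdeg c) (rdeg d)"
    using False by (intro mult_left_mono) (simp_all add: rdeg_le_def)
  then show ?thesis using assms False by (auto simp: dle_def max_def split: if_splits)
qed (use assms in \<open>auto simp: dle_def\<close>)

text \<open>The action of B_i at q = 1, with \<open>j\<close> the representative of i + h in 1..n:
  quantum integers become integers and K_i^-1 becomes the identity.\<close>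

definition bval :: "nat \<Rightarrow> int \<Rightarrow> int \<Rightarrow> (comp \<Rightarrow> ratx) \<Rightarrow> comp \<Rightarrow> ratx" where
  "bval s i j X \<gamma> = (if \<gamma> \<in> comps n s then
     rat_x powi (- of_bool (i = int n)) * of_int (\<gamma> (sc i)) * X (mv n i (sc i) \<gamma>) +
     rat_x powi (of_bool (j = int n)) * of_int (\<gamma> j) * X (mv n (sc j) j \<gamma>) else 0)"

lemma place_BW:
  assumes i: "i \<in> {1..int n}" and j: "j \<in> {1..int n}" and ij: "(i + h) mod int n = j mod int n"
    and X: "\<And>\<gamma>. place 1 (f \<gamma>) (X \<gamma>)"
  shows "place 1 (rst s (BW False xx i f) \<gamma>) (bval s i j X \<gamma>)"
proof (cases "\<gamma> \<in> comps n s")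
  case False
  then show ?thesis by (simp add: rst_def bval_def place_0)
next
  case True
  have z: "k \<in> {1..int n} \<Longrightarrow> k mod int n = 0 \<longleftrightarrow> k = int n" for k
    using mod_1_n_eq[of k "int n" "int n"] n0 by auto
  have a: "aff_w n (inverse xx) i = xx powi (- of_bool (i = int n))"
      "aff_w n xx (i + h) = xx powi (of_bool (j = int n))"
    unfolding aff_w_powi ij z[OF i] z[OF j] by simp_all
  have g: "\<gamma> (i + 1) = \<gamma> (sc i)" "\<gamma> (i + h) = \<gamma> j"
    using comps_mod[OF True] sc_mod[of i] ij by metis+
  have m: "mv n i (i + 1) = mv n i (sc i)" "mv n (i + h + 1) (i + h) = mv n (sc j) j"
    by (intro mv_cong; use sc_mod Suc_mod_cong[OF ij, of 1] ij in simp)+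
  have "place 1 (xx powi (- of_bool (i = int n)) * (qint (\<gamma> (sc i)) * f (mv n i (sc i) \<gamma>)) +
      xx powi (of_bool (j = int n)) * (qint (\<gamma> j) * (qq powi (- sg False * (mv n (sc j) j \<gamma> i - mv n (sc j) j \<gamma> (i + 1))) * f (mv n (sc j) j \<gamma>))))
     (rat_x powi (- of_bool (i = int n)) * (of_int (\<gamma> (sc i)) * X (mv n i (sc i) \<gamma>)) +
      rat_x powi (of_bool (j = int n)) * (of_int (\<gamma> j) * (1 * X (mv n (sc j) j \<gamma>))))"
    by (intro place_add place_mult place_xx_powi place_1_qq_powi place_1_qint X comps_nonneg[OF True])
  then show ?thesis using True unfolding rst_def bval_def BW_def EW_def FW_def a g m
    by (simp add: mult.assoc)
qed

lemma conc_1_eq: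
  assumes \<beta>: "\<beta> \<in> comps n s" and z: "\<And>j. j \<in> {2..int n} \<Longrightarrow> \<beta> j = 0"
  shows "\<beta> = conc n s 1"
proof (rule comps_eqI[OF \<beta> conc_comps[OF n0]])
  fix j assume j: "j \<in> {1..int n}"
  have "{1..int n} = insert 1 {2..int n}" using n0 by auto
  then have "\<beta> 1 = int s" using \<beta> z by (simp add: comps_def)
  then show "\<beta> j = conc n s 1 j"
    using z[of j] j evec_letter[of 1 j] by (cases "j = 1") (auto simp: conc_def evec_def)
qed

text \<open>A composition other than the concentrated one has a unit at some j \<ge> 2. It arises by
  E_j from its neighbour \<alpha> with that unit at the next site, where the induction hypothesis
  applies. B_i with i + h congruent to j does the same to leading order, because its summand F_i
  lowers the degree.\<close>

lemma cyc_dominant: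
  assumes "\<beta> \<in> comps n s"
  shows "\<exists>f X. cyc s f \<and> (\<forall>\<gamma>. place 1 (f \<gamma>) (X \<gamma>)) \<and> X \<beta> \<noteq> 0 \<and>
    (\<forall>\<gamma>. \<gamma> \<noteq> \<beta> \<longrightarrow> dle (X \<gamma>) \<gamma> (int n * rdeg (X \<beta>) - lsum id \<beta> - 1))"
proof -
  \<comment> \<open>Repeated use of the E_j takes a unit from 1 to n and then down to k; this needs
    n + 1 - k steps.\<close>
  define pot where "pot k = (if k = 1 then 0 else int n + 1 - k)" for k
  have pos: "lsum pot \<gamma> \<ge> 0" if "\<gamma> \<in> comps n s" for \<gamma>
    unfolding lsum_def using comps_nonneg[OF that] by (intro sum_nonneg) (auto simp: pot_def)
  show ?thesis
    using assms
  proof (induction "nat (lsum pot \<beta>)" arbitrary: \<beta> rule: less_induct)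
    case less
    note \<beta> = less.prems
    show ?case
    proof (cases "\<exists>j\<in>{2..int n}. \<beta> j \<noteq> 0")
      case False
      then have b: "\<beta> = conc n s 1" using conc_1_eq[OF \<beta>] by blast
      have "\<forall>\<gamma>. place 1 (vtop s 1 \<gamma>) (of_bool (\<gamma> = conc n s 1))"
        by (simp only: vtop_def) (simp add: place_0 place_1)
      then show ?thesis
        by (intro exI[of _ "vtop s 1"] exI[of _ "\<lambda>\<gamma>. of_bool (\<gamma> = conc n s 1)"])
           (auto simp: b dle_def intro: cyc_base)
    next
      case True
      then obtain j where j2: "j \<in> {2..int n}" "\<beta> j \<noteq> 0" by blast
      then have j: "j \<in> {1..int n}" and bj: "\<beta> j \<ge> 1" using comps_nonneg[OF \<beta>, of j] by auto
      define \<alpha> where "\<alpha> = mv n (sc j) j \<beta>"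
      have \<alpha>: "\<alpha> \<in> comps n s" using mv_comps_iff[OF \<beta> n0] bj by (simp add: \<alpha>_def)
      have "lsum pot \<alpha> < lsum pot \<beta>"
        unfolding \<alpha>_def lsum_mv[OF sc_range[OF j] j] using j2 by (auto simp: pot_def sc_def)
      then have "nat (lsum pot \<alpha>) < nat (lsum pot \<beta>)" using pos[OF \<alpha>] by simp
      from less.hyps[OF this \<alpha>] obtain f X where f: "cyc s f" and X: "\<And>\<gamma>. place 1 (f \<gamma>) (X \<gamma>)"
        and X\<alpha>: "X \<alpha> \<noteq> 0" and dom: "\<And>\<gamma>. \<gamma> \<noteq> \<alpha> \<Longrightarrow> dle (X \<gamma>) \<gamma> (int n * rdeg (X \<alpha>) - lsum id \<alpha> - 1)"
        by blast
      \<comment> \<open>The degree of the dominant coordinate at \<alpha>. The E_j summand puts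
        degree W + 1 at \<beta> and at most W elsewhere, while the F_i summand has degree at most W
        - 1 everywhere.\<close>
      define W where "W = int n * rdeg (X \<alpha>) - lsum id \<alpha>"
      define i where "i = (if j > h then j - h else j + h)"
      have i: "i \<in> {1..int n}" and ij: "(i + h) mod int n = j mod int n"
        using j nh h2 by (auto simp: i_def mod_eq_dvd_iff)
      have t1: "dle (rat_x powi (- of_bool (i = int n)) * of_int (\<gamma> (sc i)) * X (mv n i (sc i) \<gamma>)) \<gamma> (W - 1)" for \<gamma>
      proof (cases "of_int (\<gamma> (sc i)) * X (mv n i (sc i) \<gamma>) = 0")
        case False
        let ?\<delta> = "mv n i (sc i) \<gamma>"
        have "dle (X ?\<delta>) ?\<delta> W" using dom[of ?\<delta>] by (cases "?\<delta> = \<alpha>") (auto simp: dle_def W_def)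
        then show ?thesis using False rat_x_nonzero unfolding dle_def lsum_mv[OF i sc_range[OF i]]
          by (auto simp: rdeg_mult rdeg_rat_x_powi rdeg_of_int_nonzero sc_def algebra_simps)
      qed (auto simp: dle_def)
      have t2: "dle (rat_x powi (of_bool (j = int n)) * of_int (\<gamma> j) * X (mv n (sc j) j \<gamma>)) \<gamma> W" if "\<gamma> \<noteq> \<beta>" for \<gamma>
      proof (cases "of_int (\<gamma> j) * X (mv n (sc j) j \<gamma>) = 0")
        case False
        let ?\<delta> = "mv n (sc j) j \<gamma>"
        have "?\<delta> \<noteq> \<alpha>" using that mv_inverse unfolding \<alpha>_def by metis
        then have "dle (X ?\<delta>) ?\<delta> (W - 1)" using dom[of ?\<delta>] by (simp add: W_def)
        then show ?thesis using False rat_x_nonzero unfolding dle_def lsum_mv[OF sc_range[OF j] j]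
          by (auto simp: rdeg_mult rdeg_rat_x_powi rdeg_of_int_nonzero sc_def algebra_simps)
      qed (auto simp: dle_def)
      let ?X = "bval s i j X"
      let ?a = "rat_x powi (of_bool (j = int n)) * of_int (\<beta> j) * X \<alpha>"
      let ?b = "rat_x powi (- of_bool (i = int n)) * of_int (\<beta> (sc i)) * X (mv n i (sc i) \<beta>)"
      have Xb: "?X \<beta> = ?a + ?b" using \<beta> by (simp add: bval_def \<alpha>_def)
      have oj: "of_int (\<beta> j) \<noteq> (0 :: ratx)" using bj of_int_ratx_nonzero[of "\<beta> j"] by simp
      have a0: "?a \<noteq> 0" using oj X\<alpha> rat_x_nonzero by simp
      have ad: "int n * rdeg ?a - lsum id \<beta> = W + 1"
        using oj X\<alpha> rat_x_nonzero bj lsum_mv[OF sc_range[OF j] j, of id \<beta>, folded \<alpha>_def]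
        by (auto simp: rdeg_mult rdeg_rat_x_powi rdeg_of_int_nonzero W_def sc_def algebra_simps)
      have "rdeg_le ?b (rdeg ?a - 1)"
      proof (cases "?b = 0")
        case False
        then have "int n * rdeg ?b - lsum id \<beta> \<le> W - 1" using t1[of \<beta>] unfolding dle_def by blast
        then have "int n * rdeg ?b < int n * rdeg ?a" using ad by linarith
        then have "rdeg ?b < rdeg ?a" using n0 by (simp add: mult_less_cancel_left)
        then show ?thesis by (simp add: rdeg_le_def)
      qed (simp add: rdeg_le_def)
      note D = rdeg_dominant[OF a0 this]
      have "dle (?X \<gamma>) \<gamma> W" if "\<gamma> \<noteq> \<beta>" for \<gamma>
      proof (cases "\<gamma> \<in> comps n s")
        case True
        have "dle (rat_x powi (- of_bool (i = int n)) * of_int (\<gamma> (sc i)) * X (mv n i (sc i) \<gamma>)) \<gamma> W"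
          using t1[of \<gamma>] by (auto simp: dle_def)
        from dle_add[OF this t2[OF that]] show ?thesis using True by (simp add: bval_def)
      qed (simp add: bval_def dle_def)
      moreover have "int n * rdeg (?X \<beta>) - lsum id \<beta> - 1 = W"
        using ad unfolding Xb D(2) by simp
      moreover have "?X \<beta> \<noteq> 0" unfolding Xb by (rule D(1))
      moreover have "\<forall>\<gamma>. place 1 (rst s (BW False xx i f) \<gamma>) (?X \<gamma>)"
        by (intro allI place_BW[OF i j ij] X)
      ultimately show ?thesis using cyc_step[OF f, of i] by metis
    qed
  qed
qed

text \<open>A nonzero functional is scaled so that it is regular and nonzero at q = 1. Evaluated
  there on the vector with dominant coordinate at \<beta>, where \<beta> carries the leading degree
  of the functional, the term at \<beta> has strictly larger degree in x than all others, so the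
  value cannot be zero.\<close>

lemma cyclic:
  assumes ann: "\<And>f. cyc s f \<Longrightarrow> (\<Sum>\<gamma>\<in>comps n s. \<phi> \<gamma> * f \<gamma>) = 0" and "\<gamma> \<in> comps n s"
  shows "\<phi> \<gamma> = 0"
proof (rule ccontr)
  assume "\<phi> \<gamma> \<noteq> 0"
  with assms(2) obtain y where y: "y \<in> comps n s" "\<phi> y \<noteq> 0"
    and pl: "\<forall>\<gamma>\<in>comps n s. \<exists>c. place 1 (\<phi> \<gamma> / \<phi> y) c"
    using place_normalize[OF finite_comps[OF n0], of s \<phi> 1] by blast
  from pl obtain c where c: "\<And>\<gamma>. \<gamma> \<in> comps n s \<Longrightarrow> place 1 (\<phi> \<gamma> / \<phi> y) (c \<gamma>)" by metis
  have cy: "c y = 1" using c[OF y(1)] y(2) place_unique[OF place_1] by fastforce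
  have ann': "(\<Sum>\<gamma>\<in>comps n s. c \<gamma> * X \<gamma>) = 0" if "cyc s f" "\<And>\<gamma>. place 1 (f \<gamma>) (X \<gamma>)" for f X
  proof -
    have "(\<Sum>\<gamma>\<in>comps n s. \<phi> \<gamma> / \<phi> y * f \<gamma>) = (\<Sum>\<gamma>\<in>comps n s. \<phi> \<gamma> * f \<gamma>) / \<phi> y"
      by (simp add: sum_divide_distrib)
    also have "\<dots> = 0" using ann[OF that(1)] by simp
    finally have "(\<Sum>\<gamma>\<in>comps n s. \<phi> \<gamma> / \<phi> y * f \<gamma>) = 0" .
    moreover have "place 1 (\<Sum>\<gamma>\<in>comps n s. \<phi> \<gamma> / \<phi> y * f \<gamma>) (\<Sum>\<gamma>\<in>comps n s. c \<gamma> * X \<gamma>)"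
      by (intro place_sum place_mult c that)
    ultimately show ?thesis using place_unique place_0 by metis
  qed
  define A where "A = {\<gamma> \<in> comps n s. c \<gamma> \<noteq> 0}"
  have A: "finite A" "A \<noteq> {}" using finite_comps[OF n0] y cy by (auto simp: A_def)
  \<comment> \<open>The dual grading: the sign of \<open>lsum\<close> is opposite to that for
    vectors, so it cancels in a product of a coefficient of the functional and a coordinate.\<close>
  let ?F = "\<lambda>\<gamma>. int n * rdeg (c \<gamma>) + lsum id \<gamma>"
  have "Max (?F ` A) \<in> ?F ` A" using A by (intro Max_in) auto
  then obtain \<beta> where \<beta>: "\<beta> \<in> A" and \<beta>_max: "?F \<beta> = Max (?F ` A)" by auto
  have mx: "?F \<gamma> \<le> ?F \<beta>" if "\<gamma> \<in> A" for \<gamma>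
    unfolding \<beta>_max using A that by (intro Max_ge) auto
  from \<beta> have \<beta>c: "\<beta> \<in> comps n s" "c \<beta> \<noteq> 0" by (auto simp: A_def)
  obtain f X where f: "cyc s f" and X: "\<And>\<gamma>. place 1 (f \<gamma>) (X \<gamma>)" and X\<beta>: "X \<beta> \<noteq> 0"
    and dom: "\<And>\<gamma>. \<gamma> \<noteq> \<beta> \<Longrightarrow> dle (X \<gamma>) \<gamma> (int n * rdeg (X \<beta>) - lsum id \<beta> - 1)"
    using cyc_dominant[OF \<beta>c(1)] by blast
  have b0: "c \<beta> * X \<beta> \<noteq> 0" using \<beta>c X\<beta> by simp
  have "rdeg_le (c \<gamma> * X \<gamma>) (rdeg (c \<beta> * X \<beta>) - 1)" if "\<gamma> \<in> comps n s - {\<beta>}" for \<gamma>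
  proof (cases "c \<gamma> * X \<gamma> = 0")
    case False
    then have "int n * rdeg (c \<gamma>) + lsum id \<gamma> \<le> int n * rdeg (c \<beta>) + lsum id \<beta>"
      "int n * rdeg (X \<gamma>) - lsum id \<gamma> \<le> int n * rdeg (X \<beta>) - lsum id \<beta> - 1"
      using mx[of \<gamma>] dom[of \<gamma>] that by (auto simp: A_def dle_def)
    then have "int n * rdeg (c \<gamma> * X \<gamma>) < int n * rdeg (c \<beta> * X \<beta>)"
      using False \<beta>c X\<beta> by (simp add: rdeg_mult distrib_left)
    then have "rdeg (c \<gamma> * X \<gamma>) < rdeg (c \<beta> * X \<beta>)" using n0 by (simp add: mult_less_cancel_left)
    then show ?thesis by (simp add: rdeg_le_def)
  qed (simp add: rdeg_le_def)
  then have "rdeg_le (\<Sum>\<gamma>\<in>comps n s - {\<beta>}. c \<gamma> * X \<gamma>) (rdeg (c \<beta> * X \<beta>) - 1)"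
    by (rule rdeg_le_sum)
  from rdeg_dominant(1)[OF b0 this] have "(\<Sum>\<gamma>\<in>comps n s. c \<gamma> * X \<gamma>) \<noteq> 0"
    using sum.remove[OF finite_comps[OF n0] \<beta>c(1), of "\<lambda>\<gamma>. c \<gamma> * X \<gamma>"] by simp
  with ann'[OF f X] show False by simp
qed

text \<open>A one-element index set turns the rule for sums into homogeneity.\<close>

lemma linear_op_scale: "linear_op X \<Longrightarrow> X (\<lambda>l. k * g l) = (\<lambda>l. k * X g l)"
  unfolding linear_op_def
  by (drule spec[of _ "{undefined}"], drule spec[of _ "\<lambda>_. k"], drule spec[of _ "\<lambda>_. g"]) simp

lemma word_exists: "\<beta> \<in> comps n s \<Longrightarrow> \<exists>w\<in>wds s. cont w = \<beta>"
proof (induction s arbitrary: \<beta>)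
  case 0
  have "(\<lambda>k. 0) = \<beta>"
  proof (rule comps_eqI[of _ 0 _ 0])
    show "(\<lambda>k. 0) \<in> comps n 0" by (simp add: comps_def)
    show "(0 :: int) = \<beta> i" if "i \<in> {1..int n}" for i
    proof -
      have "sum \<beta> {1..int n} = 0" using 0 by (simp add: comps_def)
      then show ?thesis using that comps_nonneg[OF 0] by (subst (asm) sum_nonneg_eq_0_iff) auto
    qed
  qed (rule 0)
  then show ?case by (intro bexI[of _ "[]"]) (auto simp: wds_0)
next
  case (Suc s)
  have "sum \<beta> {1..int n} \<noteq> 0" using Suc.prems by (simp add: comps_def)
  then obtain j where j: "j \<in> {1..int n}" "\<beta> j \<noteq> 0" by (meson sum.neutral)
  then have "\<beta> j \<ge> 1" using comps_nonneg[OF Suc.prems, of j] by simp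
  then have nn: "\<beta> k - evec n j k \<ge> 0" for k
    using comps_mod[OF Suc.prems, of k j] comps_nonneg[OF Suc.prems, of k] by (auto simp: evec_def)
  have "(\<lambda>k. \<beta> k - evec n j k) \<in> comps n s"
    using Suc.prems evec_in_comps[OF n0, of j] nn by (simp add: comps_def sum_subtractf)
  then obtain w where "w \<in> wds s" "cont w = (\<lambda>k. \<beta> k - evec n j k)" using Suc.IH by blast
  then show ?case using j by (intro bexI[of _ "j # w"]) (auto simp: wds_Cons)
qed

lemma cont_conc:
  assumes "w \<in> wds s" "c \<in> {1..int n}"
  shows "cont w = conc n s c \<longleftrightarrow> w = replicate s c"
proof
  have "cont (replicate s c) = conc n s c"
    by (induction s) (auto simp: conc_def algebra_simps)
  then show "w = replicate s c \<Longrightarrow> cont w = conc n s c" by simp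
  assume eq: "cont w = conc n s c"
  have "a = c" if "a \<in> set w" for a
  proof (rule ccontr)
    assume "a \<noteq> c"
    have a: "a \<in> {1..int n}" using that assms(1) by (auto simp: wds_def)
    have "int (count_list w a) = 0"
      using count_cont[OF assms(1) a] evec_letter[OF assms(2) a] \<open>a \<noteq> c\<close> by (simp add: eq conc_def)
    then show False using that by (simp add: count_list_0_iff)
  qed
  then show "w = replicate s c" using assms(1) by (simp add: wds_def replicate_eqI)
qed

lemma dsc_replicate:
  assumes c: "c \<in> {1..int n}"
  shows "dsc (replicate s c) = 0"
proof -
  have *: "cont (replicate s c) k = int s * evec n c k" for s k
    by (induction s) (auto simp: algebra_simps)
  show ?thesis
  proof (induction s)
    case (Suc s)
    have "(\<Sum>j\<in>{1..<c}. cont (replicate s c) j) = 0"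
      unfolding * using c evec_letter[OF c] by (intro sum.neutral) auto
    then show ?case using Suc by simp
  qed simp
qed

lemma embb_vtop:
  assumes "w \<in> wds s" "c \<in> {1..int n}"
  shows "embb b (vtop s c) w = ind (replicate s c) w"
proof (cases "w = replicate s c")
  case True
  have "map refl_letter w = replicate s (refl_letter c)" by (simp add: True)
  then have "dsc (if b then map refl_letter w else w) = 0"
    using True dsc_replicate[OF assms(2)] dsc_replicate[OF refl_range[OF assms(2)]] by simp
  then show ?thesis using cont_conc[OF assms] True unfolding embb_def by (simp only: vtop_def ind_def) simp
next
  case False
  then show ?thesis using cont_conc[OF assms] by (simp add: embb_def vtop_def ind_def)
qed

section \<open>K maps the embedded module into the embedded dual one; its matrix\<close>

context
  fixes s :: nat
  assumes s1: "s \<ge> 1"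
begin

definition Tw :: "(comp \<Rightarrow> scalar) \<Rightarrow> int list \<Rightarrow> scalar" where
  "Tw f = gw (K_full n s (embed n s f))"

abbreviation msd where "msd \<equiv> pms True (qq powi (1 - int s) * inverse xx) s"
abbreviation msp where "msp \<equiv> pms False (qq powi (1 - int s) * xx) s"

lemma gw_embed: "w \<in> wds s \<Longrightarrow> gw (embed n s f) w = embb False f w"
  by (simp add: gw_def embed_word)

lemma TR_full: "TR s msp (replicate s 1) msd (replicate s (1 + h)) (K_full n s)"
  by (rule TR_K_full)

lemma embb_rst: "w \<in> wds s \<Longrightarrow> embb b (rst s f) w = embb b f w"
  using cont_comps[of w s] by (simp add: embb_def rst_def)

lemma Tw_B:
  assumes w: "w \<in> wds s"
  shows "Tw (rst s (BW False xx i f)) w = Ba msd i (Tw f) w"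
proof -
  have "gw (embed n s (rst s (BW False xx i f))) w = Ba msp i (gw (embed n s f)) w" if w: "w \<in> wds s" for w
  proof -
    have "Ba msp i (gw (embed n s f)) w = Ba msp i (embb False f) w"
      by (rule Ba_cong) (use w in \<open>auto simp: gw_embed\<close>)
    then show ?thesis unfolding gw_embed[OF w] embb_rst[OF w] Ba_embb[OF w] by simp
  qed
  then show ?thesis using TR_full w unfolding TR_def Tw_def by blast
qed

lemma Tw_linear:
  assumes "f \<in> coord_space n s"
  shows "Tw f w = (\<Sum>\<gamma>\<in>comps n s. f \<gamma> * Tw (\<lambda>\<beta>. of_bool (\<beta> = \<gamma>)) w)"
proof -
  have fin: "finite (comps n s)" by (rule finite_comps[OF n0])
  have e: "embed n s f = (\<lambda>l. \<Sum>\<gamma>\<in>comps n s. f \<gamma> * embed n s (\<lambda>\<beta>. of_bool (\<beta> = \<gamma>)) l)"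
    unfolding embed_def by (intro ext sum.cong refl) (simp add: fin of_bool_def if_distrib[of "\<lambda>x. x * _"] sum.delta cong: if_cong)
  show ?thesis unfolding Tw_def gw_def e
    using linear_K_full[of s] fin unfolding linear_op_def by simp
qed

lemma Tw_vtop: "\<exists>c. c \<noteq> 0 \<and> (\<forall>w\<in>wds s. Tw (vtop s 1) w = embb True (\<lambda>\<beta>. c * vtop s (1 + h) \<beta>) w)"
proof -
  have "\<forall>w\<in>wds s. gw (embed n s (vtop s 1)) w = 1 * ind (replicate s 1) w"
    using gw_embed embb_vtop[OF _ h1_range(2), of _ s False] by simp
  then obtain c where "c \<noteq> 0" "\<forall>w\<in>wds s. Tw (vtop s 1) w = c * ind (replicate s (1 + h)) w"
    using TR_full unfolding TR_def Tw_def by (metis one_neq_zero)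
  moreover have "embb True (\<lambda>\<beta>. c * vtop s (1 + h) \<beta>) w = c * embb True (vtop s (1 + h)) w" for w
    by (simp add: embb_def)
  ultimately show ?thesis using embb_vtop[OF _ h1_range(1), of _ s True] by auto
qed

text \<open>The image of the extremal vector lies in the embedded dual module, and both the
  intertwining relation and the stability of that module under B_i propagate this along the
  generation.\<close>

lemma Tw_cyc: "cyc s f \<Longrightarrow> f \<in> coord_space n s \<and> (\<exists>k. \<forall>w\<in>wds s. Tw f w = embb True k w)"
proof (induction rule: cyc.induct)
  case cyc_base
  have "vtop s 1 \<in> coord_space n s"
    using conc_comps[OF n0] by (auto simp: coord_space_def vtop_def)
  then show ?case using Tw_vtop by blast
next
  case (cyc_step f i)
  then obtain k where k: "\<And>w. w \<in> wds s \<Longrightarrow> Tw f w = embb True k w" by blast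
  have "Tw (rst s (BW False xx i f)) w = embb True (BW True (inverse xx) i k) w" if w: "w \<in> wds s" for w
  proof -
    have "Tw (rst s (BW False xx i f)) w = Ba msd i (embb True k) w"
      unfolding Tw_B[OF w] by (rule Ba_cong) (use w k in auto)
    then show ?thesis unfolding Ba_embb[OF w] .
  qed
  moreover have "rst s (BW False xx i f) \<in> coord_space n s" by (simp add: coord_space_def rst_def)
  ultimately show ?case by blast
qed

definition dd :: "int list \<Rightarrow> int" where "dd w = dsc (map refl_letter w)"

text \<open>A function on words comes from the embedded dual module exactly if, after removal of the
  power of q, it depends only on the content of the word. For two words of equal content this is one
  linear condition on f; it holds on generated vectors, so the functional expressing it vanishes by
  \<open>cyclic\<close>.\<close>

lemma Tw_cont:
  assumes f: "f \<in> coord_space n s" and w: "w \<in> wds s" "w' \<in> wds s" "cont w = cont w'"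
  shows "qq powi (dd w) * Tw f w = qq powi (dd w') * Tw f w'"
proof -
  define \<phi> where "\<phi> \<gamma> = qq powi (dd w) * Tw (\<lambda>\<beta>. of_bool (\<beta> = \<gamma>)) w - qq powi (dd w') * Tw (\<lambda>\<beta>. of_bool (\<beta> = \<gamma>)) w'" for \<gamma>
  have sm: "(\<Sum>\<gamma>\<in>comps n s. \<phi> \<gamma> * f \<gamma>) = qq powi (dd w) * Tw f w - qq powi (dd w') * Tw f w'"
    if f: "f \<in> coord_space n s" for f
    unfolding Tw_linear[OF f, of w] Tw_linear[OF f, of w'] \<phi>_def sum_distrib_left sum_subtractf[symmetric]
    by (intro sum.cong refl) (simp add: algebra_simps)
  have emb: "qq powi (dd w) * embb True k w = k (cont w)" for k w
    by (simp add: embb_def dd_def qq_powi_mult)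
  have "(\<Sum>\<gamma>\<in>comps n s. \<phi> \<gamma> * f \<gamma>) = 0" if cf: "cyc s f" for f
  proof -
    obtain k where f: "f \<in> coord_space n s" and "\<And>w. w \<in> wds s \<Longrightarrow> Tw f w = embb True k w"
      using Tw_cyc[OF cf] by blast
    then show ?thesis using w by (simp add: sm emb)
  qed
  then have "(\<Sum>\<gamma>\<in>comps n s. \<phi> \<gamma> * f \<gamma>) = 0"
    using cyclic[of s \<phi>] by (intro sum.neutral) auto
  then show ?thesis using sm[OF f] by simp
qed

text \<open>By \<open>Tw_cont\<close>, every word of the given content leads to the same coordinate
  in \<open>kap\<close>.\<close>

definition wrd :: "comp \<Rightarrow> int list" where
  "wrd \<beta> = (SOME w. w \<in> wds s \<and> cont w = \<beta>)"

lemma wrd: "\<beta> \<in> comps n s \<Longrightarrow> wrd \<beta> \<in> wds s \<and> cont (wrd \<beta>) = \<beta>"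
  unfolding wrd_def by (rule someI_ex) (use word_exists in blast)

definition kap :: "(comp \<Rightarrow> scalar) \<Rightarrow> comp \<Rightarrow> scalar" where
  "kap f \<beta> = (if \<beta> \<in> comps n s then qq powi (dd (wrd \<beta>)) * Tw f (wrd \<beta>) else 0)"

definition km :: "comp \<Rightarrow> comp \<Rightarrow> scalar" where
  "km \<gamma> \<eta> = (if \<eta> \<in> comps n s then kap (\<lambda>\<beta>. of_bool (\<beta> = \<eta>)) \<gamma> else 0)"

lemma Tw_kap:
  assumes f: "f \<in> coord_space n s" and w: "w \<in> wds s"
  shows "Tw f w = embb True (kap f) w"
proof -
  note c = cont_comps[OF w]
  have "qq powi (- dd w) * (qq powi (dd w) * Tw f w) = qq powi (- dd w) * kap f (cont w)"
    using Tw_cont[OF f w, of "wrd (cont w)"] wrd[OF c] c by (simp add: kap_def)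
  then show ?thesis by (simp add: qq_powi_mult embb_def dd_def)
qed

lemma embb_cancel: "(\<And>w. w \<in> wds s \<Longrightarrow> embb b f w = embb b g w) \<Longrightarrow> \<beta> \<in> comps n s \<Longrightarrow> f \<beta> = g \<beta>"
  using wrd[of \<beta>] qq_nonzero by (fastforce simp: embb_def)

lemma is_K_Ws_kap: "is_K_Ws n s kap"
  unfolding is_K_Ws_def
proof (intro ballI conjI ext)
  fix f l assume f: "f \<in> coord_space n s"
  show "kap f \<in> coord_space n s" by (simp add: coord_space_def kap_def)
  show "embed_dual n s (kap f) l = K_full n s (embed n s f) l"
  proof (cases "l \<in> tbasis n s")
    case True
    then obtain w where "w \<in> wds s" "l = map (evec n) w" by (auto simp: tbasis_eq)
    then show ?thesis using Tw_kap[OF f] embed_dual_word[of w s "kap f"] by (simp add: Tw_def gw_def)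
  next
    case False
    then show ?thesis unfolding embed_dual_def embed_outside[OF False] using K_full_outside[OF s1] by simp
  qed
qed

lemma coord_delta: "\<eta> \<in> comps n s \<Longrightarrow> (\<lambda>\<beta>. of_bool (\<beta> = \<eta>)) \<in> coord_space n s"
  by (auto simp: coord_space_def)

lemma kap_linear:
  assumes f: "f \<in> coord_space n s"
  shows "kap f \<gamma> = (\<Sum>\<eta>\<in>comps n s. f \<eta> * km \<gamma> \<eta>)"
proof (cases "\<gamma> \<in> comps n s")
  case True
  then show ?thesis
    by (simp add: kap_def km_def Tw_linear[OF f, of "wrd \<gamma>"] sum_distrib_left mult.left_commute)
next
  case False
  then show ?thesis by (simp add: kap_def km_def)
qed

lemma km_outside: "\<gamma> \<notin> comps n s \<or> \<eta> \<notin> comps n s \<Longrightarrow> km \<gamma> \<eta> = 0"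
  by (auto simp: km_def kap_def)

lemma kap_B:
  assumes f: "f \<in> coord_space n s" and \<gamma>: "\<gamma> \<in> comps n s"
  shows "kap (rst s (BW False xx i f)) \<gamma> = BW True (inverse xx) i (kap f) \<gamma>"
proof (rule embb_cancel[OF _ \<gamma>, of True])
  fix w assume w: "w \<in> wds s"
  have "rst s (BW False xx i f) \<in> coord_space n s" by (auto simp: coord_space_def rst_def)
  then have "embb True (kap (rst s (BW False xx i f))) w = Ba msd i (Tw f) w"
    using Tw_kap w Tw_B[OF w] by metis
  also have "\<dots> = Ba msd i (embb True (kap f)) w"
    by (rule Ba_cong) (use w Tw_kap[OF f] in auto)
  also have "\<dots> = embb True (BW True (inverse xx) i (kap f)) w" by (rule Ba_embb[OF w])
  finally show "embb True (kap (rst s (BW False xx i f))) w = embb True (BW True (inverse xx) i (kap f)) w" .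
qed

text \<open>The coefficient at \<gamma> of K B_i = B_i K applied to the basis vector at \<alpha>. On
  the left B_i spreads \<alpha> to two neighbours, on the right \<gamma> collects from two
  neighbours.\<close>

lemma km_relation:
  assumes \<alpha>: "\<alpha> \<in> comps n s" and \<gamma>: "\<gamma> \<in> comps n s"
  shows "aff_w n (inverse xx) i * qint (\<alpha> (i + 1) + 1) * km \<gamma> (mv n (i + 1) i \<alpha>) +
      aff_w n xx (i + h) * (qint (\<alpha> (i + h) + 1) * qq powi (\<alpha> (i + 1) - \<alpha> i)) * km \<gamma> (mv n (i + h) (i + h + 1) \<alpha>) =
    aff_w n xx i * qint (\<gamma> i) * km (mv n (i + 1) i \<gamma>) \<alpha> +
      aff_w n (inverse xx) (i + h) * (qint (\<gamma> (i + h + 1)) * qq powi (\<gamma> i - \<gamma> (i + 1))) * km (mv n (i + h) (i + h + 1) \<gamma>) \<alpha>"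
proof -
  let ?d = "\<lambda>\<beta>. of_bool (\<beta> = \<alpha>) :: scalar"
  have fin: "finite (comps n s)" by (rule finite_comps[OF n0])
  have n1: "evec n (i + 1) i = 0" "evec n i (i + 1) = 0" "evec n (i + h) i = 0" "evec n (i + h + 1) i = 0"
    "evec n (i + h) (i + 1) = 0" "evec n (i + h + 1) (i + 1) = 0" "evec n (i + h) (i + h + 1) = 0"
    "evec n (i + h + 1) (i + h) = 0"
    using not_dvd[of 1] not_dvd[of "-1"] not_dvd[of h] not_dvd[of "- h"] not_dvd[of "- h - 1"] not_dvd[of "h + 1"]
      not_dvd[of "1 - h"] h2 nh by (simp_all add: evec_def mod_eq_dvd_iff)
  have inv: "mv n a b \<beta> = \<alpha> \<longleftrightarrow> \<beta> = mv n b a \<alpha>" for a b \<beta> using mv_inverse by metis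
  have pick: "(\<Sum>\<beta>\<in>comps n s. (g \<beta> * of_bool (\<beta> = \<beta>0)) * km \<gamma> \<beta>) = g \<beta>0 * km \<gamma> \<beta>0" for g \<beta>0
  proof (cases "\<beta>0 \<in> comps n s")
    case True
    have "(\<Sum>\<beta>\<in>comps n s. (g \<beta> * of_bool (\<beta> = \<beta>0)) * km \<gamma> \<beta>) = (\<Sum>\<beta>\<in>comps n s. if \<beta> = \<beta>0 then g \<beta>0 * km \<gamma> \<beta>0 else 0)"
      by (intro sum.cong) auto
    then show ?thesis using True fin by simp
  next
    case False
    then show ?thesis using km_outside by (auto intro!: sum.neutral)
  qed
  have "rst s (BW False xx i ?d) \<in> coord_space n s" by (auto simp: coord_space_def rst_def)
  from kap_linear[OF this] have "kap (rst s (BW False xx i ?d)) \<gamma> =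
     (\<Sum>\<beta>\<in>comps n s. ((aff_w n (inverse xx) i * qint (\<beta> (i + 1))) * of_bool (\<beta> = mv n (i + 1) i \<alpha>)) * km \<gamma> \<beta> +
       ((aff_w n xx (i + h) * (qint (\<beta> (i + h)) * qq powi (- (\<alpha> i - \<alpha> (i + 1))))) * of_bool (\<beta> = mv n (i + h) (i + h + 1) \<alpha>)) * km \<gamma> \<beta>)"
    by (auto simp: rst_def BW_def EW_def FW_def sg_def inv distrib_right mv_inverse intro!: sum.cong)
  also have "\<dots> = aff_w n (inverse xx) i * qint (\<alpha> (i + 1) + 1) * km \<gamma> (mv n (i + 1) i \<alpha>) +
      aff_w n xx (i + h) * (qint (\<alpha> (i + h) + 1) * qq powi (\<alpha> (i + 1) - \<alpha> i)) * km \<gamma> (mv n (i + h) (i + h + 1) \<alpha>)"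
    unfolding sum.distrib pick using n1 by (simp add: mv_def evec_def)
  finally have L: "kap (rst s (BW False xx i ?d)) \<gamma> = \<dots>" .
  have km: "kap ?d = (\<lambda>\<beta>. km \<beta> \<alpha>)" using \<alpha> by (simp add: km_def)
  have R: "BW True (inverse xx) i (\<lambda>\<beta>. km \<beta> \<alpha>) \<gamma> =
    aff_w n xx i * qint (\<gamma> i) * km (mv n (i + 1) i \<gamma>) \<alpha> +
      aff_w n (inverse xx) (i + h) * (qint (\<gamma> (i + h + 1)) * qq powi (\<gamma> i - \<gamma> (i + 1))) * km (mv n (i + h) (i + h + 1) \<gamma>) \<alpha>"
    using n1 by (simp add: BW_def EW_def FW_def sg_def mult.assoc) (simp add: mv_def)
  show ?thesis using kap_B[OF coord_delta[OF \<alpha>] \<gamma>, of i] unfolding L km R .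
qed

text \<open>Commutation with K_i K_{i+n'}^-1 shows that \<open>c\<close>, the sum of the opposite
  differences of \<gamma> and \<eta>, is the same at all sites. As it changes sign under the shift
  by h, it is zero.\<close>

lemma km_weight:
  assumes "km \<gamma> \<eta> \<noteq> 0"
  shows "\<gamma> i - \<gamma> (i + h) = \<eta> (i + h) - \<eta> i"
proof -
  have \<gamma>: "\<gamma> \<in> comps n s" and \<eta>: "\<eta> \<in> comps n s" using assms km_outside by blast+
  let ?d = "\<lambda>\<beta>. of_bool (\<beta> = \<eta>) :: scalar"
  let ?k = "\<lambda>\<beta> i. (\<beta> i - \<beta> (i + 1)) - (\<beta> (i + h) - \<beta> (i + h + 1)) :: int"
  have nz: "Tw ?d (wrd \<gamma>) \<noteq> 0" using assms \<gamma> \<eta> by (auto simp: km_def kap_def)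
  have kkw: "kk (pms b y s) i w = (if b then - 1 else 1) * ?k (cont w) i" if "w \<in> wds s" for b y i w
    using that by (simp add: kk_def kX_pms wds_def add.assoc algebra_simps)
  have step: "?k \<eta> i = - ?k \<gamma> i" for i
  proof -
    define g where "g = embed n s ?d"
    define g' where "g' = (\<lambda>l. qq powi (?k \<eta> i) * g l)"
    have "gw g' w = qq powi (kk msp i w) * gw g w" if w: "w \<in> wds s" for w
      using kkw[OF w, of False] unfolding g'_def g_def
      by (cases "cont w = \<eta>") (simp_all add: gw_def embed_word[OF w] embb_def)
    then have "gw (K_full n s g') (wrd \<gamma>) = qq powi (kk msd i (wrd \<gamma>)) * gw (K_full n s g) (wrd \<gamma>)"
      using TR_full wrd[OF \<gamma>] unfolding TR_def by blast
    moreover have "K_full n s g' = (\<lambda>l. qq powi (?k \<eta> i) * K_full n s g l)"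
      unfolding g'_def by (rule linear_op_scale[OF linear_K_full])
    ultimately have "qq powi (?k \<eta> i) * Tw ?d (wrd \<gamma>) = qq powi (kk msd i (wrd \<gamma>)) * Tw ?d (wrd \<gamma>)"
      by (simp add: gw_def Tw_def g_def)
    then show ?thesis using nz kkw[of "wrd \<gamma>" True _ i] wrd[OF \<gamma>] by (simp add: qq_powi_inject)
  qed
  define c where "c i = (\<gamma> i - \<gamma> (i + h)) + (\<eta> i - \<eta> (i + h))" for i
  have c1: "c (i + 1) = c i" for i using step[of i] by (simp add: c_def algebra_simps)
  have c2: "c (i + int k) = c i" for k
  proof (induction k)
    case (Suc k)
    then show ?case using c1[of "i + int k"] by (simp add: algebra_simps)
  qed simp
  have "c (i + h) = c i" using c2[of "nat h"] h2 by simp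
  moreover have "c (i + h) = - c i" using shift_hh[OF \<gamma>, of i] shift_hh[OF \<eta>, of i] by (simp add: c_def)
  ultimately show ?thesis by (simp add: c_def)
qed

lemma km_nonzero: "\<exists>\<gamma>\<in>comps n s. \<exists>\<eta>\<in>comps n s. km \<gamma> \<eta> \<noteq> 0"
proof -
  obtain c where c: "c \<noteq> 0" and "\<And>w. w \<in> wds s \<Longrightarrow> Tw (vtop s 1) w = embb True (\<lambda>\<beta>. c * vtop s (1 + h) \<beta>) w"
    using Tw_vtop by blast
  note cc = conc_comps[OF n0, of s]
  have d: "vtop s 1 = (\<lambda>\<beta>. of_bool (\<beta> = conc n s 1))" by (rule ext) (simp add: vtop_def)
  have "kap (vtop s 1) (conc n s (1 + h)) = c * vtop s (1 + h) (conc n s (1 + h))"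
  proof (rule embb_cancel[OF _ cc, of True])
    fix w assume w: "w \<in> wds s"
    show "embb True (kap (vtop s 1)) w = embb True (\<lambda>\<beta>. c * vtop s (1 + h) \<beta>) w"
      using Tw_kap[OF coord_delta[OF cc] w, of 1] \<open>\<And>w. w \<in> wds s \<Longrightarrow> _\<close>[OF w] unfolding d by simp
  qed
  then have "km (conc n s (1 + h)) (conc n s 1) \<noteq> 0"
    using c cc by (simp add: km_def d[symmetric]) (simp add: vtop_def)
  then show ?thesis using cc by blast
qed

end

section \<open>The limit at \<open>q = \<infinity>\<close>\<close>

context
  fixes s :: nat
  assumes s1: "s \<ge> 1"
begin

definition xw :: "int \<Rightarrow> int \<Rightarrow> ratx" where
  "xw e i = rat_x powi (e * of_bool (i mod int n = 0))"

lemma place_xw: "place 0 (aff_w n xx i) (xw 1 i)" "place 0 (aff_w n (inverse xx) i) (xw (- 1) i)"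
  unfolding aff_w_powi xw_def using place_xx_powi[of 0] by simp_all

lemma xw_nonzero: "xw e i \<noteq> 0"
  using rat_x_nonzero by (simp add: xw_def)

text \<open>For m \<ge> 1 the leading term of q^e [m] is q^(e+m-1): the limit is 1 if the exponent
  is 0, and 0 if it is negative.\<close>

lemma place_qint_shift:
  assumes "m \<ge> 0" "e + m \<le> 1"
  shows "place 0 (qq powi e * qint m) (of_bool (m \<ge> 1 \<and> e + m = 1))"
proof (cases "m = 0")
  case True
  then show ?thesis by (simp add: qint_0 place_0)
next
  case False
  have "place 0 (qq powi (e + m - 1) * (qq powi (- (m - 1)) * qint (m - 1 + 1))) (of_bool (e + m - 1 = 0) * 1)"
    using assms False by (intro place_mult place_0_qq_powi place_0_qint) simp_all
  moreover have "m \<ge> 1" using assms False by simp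
  ultimately show ?thesis unfolding qq_powi_mult by (auto simp: algebra_simps)
qed

context
  fixes c0 :: scalar and kb :: "comp \<Rightarrow> comp \<Rightarrow> ratx"
  assumes kb: "\<And>\<gamma> \<eta>. place 0 (c0 * km s \<gamma> \<eta>) (kb \<gamma> \<eta>)" and c0: "c0 \<noteq> 0"
begin

lemma kb_outside: "\<gamma> \<notin> comps n s \<or> \<eta> \<notin> comps n s \<Longrightarrow> kb \<gamma> \<eta> = 0"
proof -
  assume "\<gamma> \<notin> comps n s \<or> \<eta> \<notin> comps n s"
  then have "place 0 0 (kb \<gamma> \<eta>)" using kb[of \<gamma> \<eta>] km_outside[OF s1] by simp
  then show ?thesis using place_unique place_0 by blast
qed

lemma kb_weight: "kb \<gamma> \<eta> \<noteq> 0 \<Longrightarrow> \<gamma> i - \<gamma> (i + h) = \<eta> (i + h) - \<eta> i"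
  using place_nonzero[OF kb, of \<gamma> \<eta>] km_weight[OF s1, of \<gamma> \<eta> i] by auto

lemma evec_values:
  "evec n i i = 1" "evec n (i + 1) i = 0" "evec n i (i + 1) = 0" "evec n (i + 1) (i + 1) = 1"
  "evec n i (i + h) = 0" "evec n (i + 1) (i + h) = 0" "evec n i (i + h + 1) = 0" "evec n (i + 1) (i + h + 1) = 0"
  "evec n (i + h) i = 0" "evec n (i + h + 1) i = 0"
  using not_dvd[of 1] not_dvd[of "-1"] not_dvd[of h] not_dvd[of "- h"] not_dvd[of "- h - 1"] not_dvd[of "- 1 - h"] not_dvd[of "h + 1"]
    not_dvd[of "1 - h"] not_dvd[of "h - 1"] h2 nh by (simp_all add: evec_def mod_eq_dvd_iff algebra_simps)

text \<open>The equation obtained from \<open>B\<^sub>i\<close> by comparing the leading coefficients at \<open>q = \<infinity>\<close>: since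
  \<open>\<alpha>\<^sub>i > \<alpha>\<^bsub>i+n'\<^esub>\<close>, the summand \<open>F\<^sub>i\<close> of \<open>B\<^sub>i\<close> dominates on \<open>v\<^sub>\<alpha>\<close>.\<close>

lemma kb_relation:
  assumes \<alpha>: "\<alpha> \<in> comps n s" and gt: "\<alpha> i > \<alpha> (i + h)" and \<gamma>: "\<gamma> \<in> comps n s"
    and wt: "\<gamma> (i + 1) - \<gamma> (i + h + 1) = \<alpha> (i + h + 1) - \<alpha> (i + 1) - 1"
    and le: "\<gamma> i \<le> \<alpha> (i + 1) + 1" "\<gamma> i \<le> \<alpha> (i + h + 1)"
  shows "xw (- 1) i * kb \<gamma> (mv n (i + 1) i \<alpha>) =
    of_bool (\<gamma> i = \<alpha> (i + 1) + 1) * xw 1 i * kb (mv n (i + 1) i \<gamma>) \<alpha> +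
    of_bool (\<gamma> i = \<alpha> (i + h + 1)) * xw (- 1) (i + h) * kb (mv n (i + h) (i + h + 1) \<gamma>) \<alpha>"
proof -
  let ?a = "\<alpha> (i + 1)"
  note nn = comps_nonneg[OF \<alpha>] comps_nonneg[OF \<gamma>]
  have q1: "place 0 (qq powi (- ?a) * qint (?a + 1)) 1"
    using place_qint_shift[of "?a + 1" "- ?a"] nn(1)[of "i + 1"] by simp
  have q2: "place 0 (qq powi (- \<alpha> i) * qint (\<alpha> (i + h) + 1)) 0"
    using place_qint_shift[of "\<alpha> (i + h) + 1" "- \<alpha> i"] gt nn(1)[of "i + h"] by simp
  have q3: "place 0 (qq powi (- ?a) * qint (\<gamma> i)) (of_bool (\<gamma> i \<ge> 1 \<and> - ?a + \<gamma> i = 1))"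
    using place_qint_shift[of "\<gamma> i" "- ?a"] le nn(2)[of i] by simp
  have q4: "place 0 (qq powi (- ?a + \<gamma> i - \<gamma> (i + 1)) * qint (\<gamma> (i + h + 1)))
      (of_bool (\<gamma> (i + h + 1) \<ge> 1 \<and> (- ?a + \<gamma> i - \<gamma> (i + 1)) + \<gamma> (i + h + 1) = 1))"
    using place_qint_shift[of "\<gamma> (i + h + 1)" "- ?a + \<gamma> i - \<gamma> (i + 1)"] le wt nn(2)[of "i + h + 1"] by simp
  have L: "place 0 (aff_w n (inverse xx) i * (qq powi (- ?a) * qint (?a + 1)) * (c0 * km s \<gamma> (mv n (i + 1) i \<alpha>)) +
      aff_w n xx (i + h) * (qq powi (- \<alpha> i) * qint (\<alpha> (i + h) + 1)) * (c0 * km s \<gamma> (mv n (i + h) (i + h + 1) \<alpha>)))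
      (xw (- 1) i * 1 * kb \<gamma> (mv n (i + 1) i \<alpha>) + xw 1 (i + h) * 0 * kb \<gamma> (mv n (i + h) (i + h + 1) \<alpha>))"
    by (intro place_add place_mult place_xw q1 q2 kb)
  have R: "place 0 (aff_w n xx i * (qq powi (- ?a) * qint (\<gamma> i)) * (c0 * km s (mv n (i + 1) i \<gamma>) \<alpha>) +
      aff_w n (inverse xx) (i + h) * (qq powi (- ?a + \<gamma> i - \<gamma> (i + 1)) * qint (\<gamma> (i + h + 1))) * (c0 * km s (mv n (i + h) (i + h + 1) \<gamma>) \<alpha>))
      (xw 1 i * of_bool (\<gamma> i \<ge> 1 \<and> - ?a + \<gamma> i = 1) * kb (mv n (i + 1) i \<gamma>) \<alpha> +
       xw (- 1) (i + h) * of_bool (\<gamma> (i + h + 1) \<ge> 1 \<and> (- ?a + \<gamma> i - \<gamma> (i + 1)) + \<gamma> (i + h + 1) = 1) * kb (mv n (i + h) (i + h + 1) \<gamma>) \<alpha>)"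
    by (intro place_add place_mult place_xw q3 q4 kb)
  have e: "qq powi (- \<alpha> i) = qq powi (- ?a) * qq powi (?a - \<alpha> i)"
    "qq powi (- ?a + \<gamma> i - \<gamma> (i + 1)) = qq powi (- ?a) * qq powi (\<gamma> i - \<gamma> (i + 1))"
    unfolding qq_powi_add[symmetric] by (simp_all add: algebra_simps)
  have "aff_w n (inverse xx) i * (qq powi (- ?a) * qint (?a + 1)) * (c0 * km s \<gamma> (mv n (i + 1) i \<alpha>)) +
      aff_w n xx (i + h) * (qq powi (- \<alpha> i) * qint (\<alpha> (i + h) + 1)) * (c0 * km s \<gamma> (mv n (i + h) (i + h + 1) \<alpha>)) =
      c0 * qq powi (- ?a) * (aff_w n (inverse xx) i * qint (\<alpha> (i + 1) + 1) * km s \<gamma> (mv n (i + 1) i \<alpha>) +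
      aff_w n xx (i + h) * (qint (\<alpha> (i + h) + 1) * qq powi (\<alpha> (i + 1) - \<alpha> i)) * km s \<gamma> (mv n (i + h) (i + h + 1) \<alpha>))"
    unfolding e by (simp add: algebra_simps)
  also have "\<dots> = aff_w n xx i * (qq powi (- ?a) * qint (\<gamma> i)) * (c0 * km s (mv n (i + 1) i \<gamma>) \<alpha>) +
      aff_w n (inverse xx) (i + h) * (qq powi (- ?a + \<gamma> i - \<gamma> (i + 1)) * qint (\<gamma> (i + h + 1))) * (c0 * km s (mv n (i + h) (i + h + 1) \<gamma>) \<alpha>)"
    unfolding km_relation[OF s1 \<alpha> \<gamma>] e by (simp add: algebra_simps)
  finally have "xw (- 1) i * kb \<gamma> (mv n (i + 1) i \<alpha>) =
      xw 1 i * of_bool (\<gamma> i \<ge> 1 \<and> - ?a + \<gamma> i = 1) * kb (mv n (i + 1) i \<gamma>) \<alpha> +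
      xw (- 1) (i + h) * of_bool (\<gamma> (i + h + 1) \<ge> 1 \<and> (- ?a + \<gamma> i - \<gamma> (i + 1)) + \<gamma> (i + h + 1) = 1) * kb (mv n (i + h) (i + h + 1) \<gamma>) \<alpha>"
    using place_unique[OF L] R by simp
  moreover have "of_bool (\<gamma> i \<ge> 1 \<and> - ?a + \<gamma> i = 1) = (of_bool (\<gamma> i = ?a + 1) :: ratx)"
    using nn(1)[of "i + 1"] by auto
  moreover have "of_bool (\<gamma> (i + h + 1) \<ge> 1 \<and> (- ?a + \<gamma> i - \<gamma> (i + 1)) + \<gamma> (i + h + 1) = 1) * kb (mv n (i + h) (i + h + 1) \<gamma>) \<alpha> =
     of_bool (\<gamma> i = \<alpha> (i + h + 1)) * kb (mv n (i + h) (i + h + 1) \<gamma>) \<alpha>"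
  proof (cases "\<gamma> (i + h + 1) \<ge> 1")
    case True
    then show ?thesis using wt by auto
  next
    case False
    have "(i + h) mod int n \<noteq> (i + h + 1) mod int n" using int_mod_neq_Suc[OF n4, of "i + h"] by simp
    then have "mv n (i + h) (i + h + 1) \<gamma> \<notin> comps n s" using mv_comps_iff[OF \<gamma> n0] False by blast
    then show ?thesis using kb_outside by simp
  qed
  ultimately show ?thesis by (simp add: mult_ac)
qed

text \<open>If the inequality required by \<open>eq_pmI\<close> failed at i, the unit at i + 1 could
  be moved back to i, giving some \<alpha> to which \<open>kb_relation\<close> applies. As
  \<gamma>_i is then below both thresholds, the right-hand side is zero, and so is the entry at
  (\<gamma>, \<eta>).\<close>

lemma kb_support:
  assumes "kb \<gamma> \<eta> \<noteq> 0"
  shows "\<gamma> = pm \<eta>"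
proof -
  have \<gamma>: "\<gamma> \<in> comps n s" and \<eta>: "\<eta> \<in> comps n s" using assms kb_outside by blast+
  note nn = comps_nonneg[OF \<eta>] comps_nonneg[OF \<gamma>]
  show ?thesis
  proof (rule eq_pmI[OF \<gamma> \<eta> kb_weight[OF assms]], rule ccontr)
    fix i assume ge: "\<eta> (i + h) \<le> \<eta> i" and "\<not> mm \<eta> (i + 1) \<le> \<gamma> i"
    then have lt: "\<gamma> i < \<eta> (i + 1)" "\<gamma> i < \<eta> (i + h + 1)" by (simp_all add: mm_def add_ac)
    define \<alpha> where "\<alpha> = mv n i (i + 1) \<eta>"
    have a1: "\<eta> (i + 1) \<ge> 1" using lt nn(2)[of i] by simp
    then have \<alpha>: "\<alpha> \<in> comps n s" using mv_comps_iff[OF \<eta> n0] by (simp add: \<alpha>_def)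
    have v: "\<alpha> i = \<eta> i + 1" "\<alpha> (i + h) = \<eta> (i + h)" "\<alpha> (i + 1) = \<eta> (i + 1) - 1" "\<alpha> (i + h + 1) = \<eta> (i + h + 1)"
      by (simp_all add: \<alpha>_def mv_def evec_values)
    have "xw (- 1) i * kb \<gamma> (mv n (i + 1) i \<alpha>) = 0"
      using kb_relation[OF \<alpha> _ \<gamma>, of i] v ge lt kb_weight[OF assms, of "i + 1"] by (simp add: add_ac)
    then show False using assms xw_nonzero by (simp add: \<alpha>_def mv_inverse)
  qed
qed

text \<open>Of the two terms on the right of \<open>kb_relation\<close> with \<gamma> =
  \<open>pm \<eta>\<close>, one is the entry at (\<open>pm \<alpha>\<close>, \<alpha>) by
  \<open>pm_mv\<close>. The other belongs to a different row and vanishes by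
  \<open>kb_support\<close>, also when both indicators are 1. The remaining powers of x are exactly
  those of \<open>II_mv\<close>.\<close>

lemma kb_edge:
  assumes \<alpha>: "\<alpha> \<in> comps n s" and gt: "\<alpha> i > \<alpha> (i + h)"
  defines "\<eta> \<equiv> mv n (i + 1) i \<alpha>"
  shows "kb (pm \<eta>) \<eta> = rat_x powi (II \<eta> - II \<alpha>) * kb (pm \<alpha>) \<alpha>"
proof -
  let ?\<gamma> = "pm \<eta>"
  have \<eta>: "\<eta> \<in> comps n s"
    unfolding \<eta>_def using mv_comps_iff[OF \<alpha> n0] gt comps_nonneg[OF \<alpha>, of "i + h"] by auto
  have \<gamma>: "?\<gamma> \<in> comps n s" by (rule pm_comps[OF \<eta>])
  have v: "\<eta> i = \<alpha> i - 1" "\<eta> (i + h) = \<alpha> (i + h)" "\<eta> (i + 1) = \<alpha> (i + 1) + 1" "\<eta> (i + h + 1) = \<alpha> (i + h + 1)"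
    by (simp_all add: \<eta>_def mv_def evec_values)
  have \<gamma>i: "?\<gamma> i = min (\<alpha> (i + 1) + 1) (\<alpha> (i + h + 1))"
    using v gt by (simp add: pm_def mm_def add_ac)
  have wt: "?\<gamma> (i + 1) - ?\<gamma> (i + h + 1) = \<alpha> (i + h + 1) - \<alpha> (i + 1) - 1"
    using pm_diff[OF \<eta>, of "i + 1"] v by (simp add: add_ac)
  have rel: "xw (- 1) i * kb ?\<gamma> \<eta> =
    of_bool (?\<gamma> i = \<alpha> (i + 1) + 1) * xw 1 i * kb (mv n (i + 1) i ?\<gamma>) \<alpha> +
    of_bool (?\<gamma> i = \<alpha> (i + h + 1)) * xw (- 1) (i + h) * kb (mv n (i + h) (i + h + 1) ?\<gamma>) \<alpha>"
    using kb_relation[OF \<alpha> gt \<gamma> wt] \<gamma>i by (simp add: \<eta>_def)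
  have ne: "mv n (i + 1) i ?\<gamma> \<noteq> mv n (i + h) (i + h + 1) ?\<gamma>"
  proof
    assume "mv n (i + 1) i ?\<gamma> = mv n (i + h) (i + h + 1) ?\<gamma>"
    from fun_cong[OF this, of i] show False by (simp add: mv_def evec_values)
  qed
  define up :: int where "up = of_bool (\<alpha> (i + 1) < \<alpha> (i + 1 + h))"
  have ii: "i + 1 + h = i + h + 1" by simp
  have "xw (- 1) i * kb ?\<gamma> \<eta> = (if up = 1 then xw 1 i else xw (- 1) (i + h)) * kb (pm \<alpha>) \<alpha>"
  proof (cases "\<alpha> (i + 1) < \<alpha> (i + 1 + h)")
    case True
    then have p: "pm \<alpha> = mv n (i + 1) i ?\<gamma>" using pm_mv[OF \<alpha> gt] by (simp add: \<eta>_def)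
    then have "kb (mv n (i + h) (i + h + 1) ?\<gamma>) \<alpha> = 0" using kb_support ne by metis
    then show ?thesis using rel True \<gamma>i p unfolding ii by (simp add: up_def ii)
  next
    case False
    then have p: "pm \<alpha> = mv n (i + h) (i + h + 1) ?\<gamma>" using pm_mv[OF \<alpha> gt] by (simp add: \<eta>_def)
    then have "kb (mv n (i + 1) i ?\<gamma>) \<alpha> = 0" using kb_support ne by metis
    then show ?thesis using rel False \<gamma>i p unfolding ii by (simp add: up_def ii)
  qed
  then have "xw 1 i * (xw (- 1) i * kb ?\<gamma> \<eta>) = xw 1 i * ((if up = 1 then xw 1 i else xw (- 1) (i + h)) * kb (pm \<alpha>) \<alpha>)"
    by simp
  moreover have "xw 1 i * xw (- 1) i = 1" using rat_x_nonzero by (simp add: xw_def power_int_minus)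
  ultimately have "kb ?\<gamma> \<eta> = xw 1 i * (if up = 1 then xw 1 i else xw (- 1) (i + h)) * kb (pm \<alpha>) \<alpha>"
    by (simp flip: mult.assoc)
  also have "xw 1 i * (if up = 1 then xw 1 i else xw (- 1) (i + h)) = rat_x powi (II \<eta> - II \<alpha>)"
    using II_mv[OF \<alpha> gt] rat_x_nonzero
    by (auto simp: \<eta>_def up_def xw_def power_int_minus power_int_add[symmetric] power2_eq_square simp del: power_int_add)
  finally show ?thesis .
qed

text \<open>\<open>Q\<close> is constant along edges and holds by definition of \<open>\<mu>\<close>
  at the composition concentrated at 1, so it holds everywhere. If \<open>\<mu>\<close> were zero,
  all entries would vanish.\<close>

lemma kb_formula:
  assumes nz: "\<exists>\<gamma> \<eta>. kb \<gamma> \<eta> \<noteq> 0"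
  shows "\<exists>\<mu>. \<mu> \<noteq> 0 \<and> (\<forall>\<eta>\<in>comps n s. \<forall>\<gamma>. kb \<gamma> \<eta> = \<mu> * (of_bool (\<gamma> = pm \<eta>) * rat_x powi (II \<eta>)))"
proof -
  let ?v = "conc n s 1"
  define \<mu> where "\<mu> = kb (pm ?v) ?v * rat_x powi (- II ?v)"
  define Q where "Q \<eta> \<longleftrightarrow> kb (pm \<eta>) \<eta> = \<mu> * rat_x powi (II \<eta>)" for \<eta>
  have pw: "rat_x powi (a - b) * rat_x powi b = rat_x powi a" for a b
    using rat_x_nonzero by (simp add: power_int_add[symmetric] del: power_int_add)
  have Q: "Q \<eta>" if "\<eta> \<in> comps n s" for \<eta>
  proof (rule connected[OF _ _ that])
    show "Q ?v" unfolding Q_def \<mu>_def using rat_x_nonzero by (simp add: power_int_minus)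
    fix \<alpha> i assume \<alpha>: "\<alpha> \<in> comps n s" "\<alpha> i > \<alpha> (i + h)"
    have "Q (mv n (i + 1) i \<alpha>) \<longleftrightarrow> rat_x powi (II (mv n (i + 1) i \<alpha>) - II \<alpha>) * kb (pm \<alpha>) \<alpha> =
        rat_x powi (II (mv n (i + 1) i \<alpha>) - II \<alpha>) * (\<mu> * rat_x powi (II \<alpha>))"
      unfolding Q_def kb_edge[OF \<alpha>] mult.left_commute[of _ \<mu>] pw ..
    then show "Q \<alpha> \<longleftrightarrow> Q (mv n (i + 1) i \<alpha>)" using rat_x_nonzero by (simp add: Q_def)
  qed
  have f: "kb \<gamma> \<eta> = \<mu> * (of_bool (\<gamma> = pm \<eta>) * rat_x powi (II \<eta>))" if "\<eta> \<in> comps n s" for \<gamma> \<eta>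
    using Q[OF that] kb_support[of \<gamma> \<eta>] by (cases "\<gamma> = pm \<eta>") (auto simp: Q_def)
  have "\<mu> \<noteq> 0"
  proof
    assume "\<mu> = 0"
    then have "kb \<gamma> \<eta> = 0" for \<gamma> \<eta> using f[of \<eta> \<gamma>] kb_outside[of \<gamma> \<eta>] by (cases "\<eta> \<in> comps n s") auto
    with nz show False by blast
  qed
  with f show ?thesis by blast
qed

end

text \<open>The rescaling has two parts: \<open>c0\<close> makes the matrix regular and nonzero at q
  = infinity, and a further factor removes the constant \<open>\<mu>\<close>. The limit is then a
  monomial matrix, a permutation by \<open>pm\<close> with powers of x as entries, so bijectivity on
  the crystal reduces to that of \<open>pm\<close>.\<close>

lemma combinatorial_K:
  assumes KK: "\<And>d \<alpha>. \<alpha> \<in> comps n s \<Longrightarrow> \<K> (crystal_elt d \<alpha>) = crystal_elt (d + II \<alpha>) (pm \<alpha>)"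
  shows "is_combinatorial_K_matrix n s \<K>"
proof -
  note fin = finite_comps[OF n0, of s]
  let ?F = "\<lambda>y. km s (fst y) (snd y)"
  have "\<exists>y\<in>comps n s \<times> comps n s. ?F y \<noteq> 0" using km_nonzero[OF s1] by auto
  then obtain y where y: "y \<in> comps n s \<times> comps n s" "?F y \<noteq> 0"
    and pl: "\<forall>z\<in>comps n s \<times> comps n s. \<exists>c. place 0 (?F z / ?F y) c"
    using place_normalize[of "comps n s \<times> comps n s" ?F 0] fin by blast
  define c0 where "c0 = inverse (?F y)"
  have "\<exists>c. place 0 (c0 * km s \<gamma> \<eta>) c" for \<gamma> \<eta>
  proof (cases "\<gamma> \<in> comps n s \<and> \<eta> \<in> comps n s")
    case True
    then show ?thesis using pl by (auto simp: c0_def divide_inverse mult.commute)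
  next
    case False
    then have "km s \<gamma> \<eta> = 0" using km_outside[OF s1] by blast
    then show ?thesis using place_0 by auto
  qed
  then obtain kb where kb: "\<And>\<gamma> \<eta>. place 0 (c0 * km s \<gamma> \<eta>) (kb \<gamma> \<eta>)" by metis
  have c0: "c0 \<noteq> 0" using y by (simp add: c0_def)
  have "kb (fst y) (snd y) = 1"
    using kb[of "fst y" "snd y"] y place_unique[OF place_1] by (fastforce simp: c0_def)
  then have "\<exists>\<gamma> \<eta>. kb \<gamma> \<eta> \<noteq> 0" by (metis one_neq_zero)
  from kb_formula[OF kb c0 this] obtain \<mu> where \<mu>: "\<mu> \<noteq> 0"
    and f: "\<And>\<gamma> \<eta>. \<eta> \<in> comps n s \<Longrightarrow> kb \<gamma> \<eta> = \<mu> * (of_bool (\<gamma> = pm \<eta>) * rat_x powi (II \<eta>))" by blast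
  \<comment> \<open>\<open>\<mu>\<close> is a rational function of x alone; its inverse is lifted to
    a scalar that does not depend on q.\<close>
  define m where "m = (Fract [:inverse \<mu>:] 1 :: scalar)"
  have m: "place 0 m (inverse \<mu>)" unfolding m_def by (rule place_const)
  define c where "c = m * c0"
  have c: "c \<noteq> 0" using place_nonzero[OF m] \<mu> c0 by (simp add: c_def)
  have pc: "place 0 (c * km s \<gamma> \<eta>) (of_bool (\<gamma> = pm \<eta>) * rat_x powi (II \<eta>))" if "\<eta> \<in> comps n s" for \<gamma> \<eta>
  proof -
    have e: "inverse \<mu> * (\<mu> * z) = z" for z using \<mu> by simp
    show ?thesis using place_mult[OF m kb[of \<gamma> \<eta>]] unfolding f[OF that] c_def mult.assoc e .
  qed
  define K' where "K' g \<gamma> = (\<Sum>\<eta>\<in>comps n s. g \<eta> * (of_bool (\<gamma> = pm \<eta>) * rat_x powi (II \<eta>)))" for g \<gamma>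
  have main: "place 0 (c * kap s f \<gamma>) (K' (reduce f) \<gamma>)" if f: "f \<in> lattice_s n s" for f \<gamma>
  proof -
    have fc: "f \<in> coord_space n s" using f by (simp add: lattice_s_def)
    have pf: "place 0 (f \<eta>) (reduce f \<eta>)" if \<eta>: "\<eta> \<in> comps n s" for \<eta>
    proof -
      obtain d where "place 0 (f \<eta>) d" using f \<eta> by (auto simp: lattice_s_def A_x_iff)
      then show ?thesis using mod_qinv_eq by (auto simp: reduce_def)
    qed
    have "c * kap s f \<gamma> = (\<Sum>\<eta>\<in>comps n s. f \<eta> * (c * km s \<gamma> \<eta>))"
      unfolding kap_linear[OF s1 fc] sum_distrib_left by (simp add: mult.left_commute)
    then show ?thesis unfolding K'_def by (simp only:) (intro place_sum place_mult pf pc)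
  qed
  have K'_elt: "K' (crystal_elt d \<alpha>) = crystal_elt (d + II \<alpha>) (pm \<alpha>)" if \<alpha>: "\<alpha> \<in> comps n s" for d \<alpha>
  proof
    fix \<gamma>
    have "K' (crystal_elt d \<alpha>) \<gamma> =
        (\<Sum>\<eta>\<in>comps n s. if \<eta> = \<alpha> then rat_x powi d * (of_bool (\<gamma> = pm \<alpha>) * rat_x powi (II \<alpha>)) else 0)"
      unfolding K'_def crystal_elt_def by (intro sum.cong) auto
    also have "\<dots> = crystal_elt (d + II \<alpha>) (pm \<alpha>) \<gamma>"
      using \<alpha> fin rat_x_nonzero by (simp add: crystal_elt_def power_int_add)
    finally show "K' (crystal_elt d \<alpha>) \<gamma> = crystal_elt (d + II \<alpha>) (pm \<alpha>) \<gamma>" .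
  qed
  have lat: "\<forall>f\<in>lattice_s n s. (\<lambda>\<alpha>. c * kap s f \<alpha>) \<in> lattice_s n s \<and>
      K' (reduce f) = reduce (\<lambda>\<alpha>. c * kap s f \<alpha>)"
  proof (intro ballI conjI)
    fix f assume f: "f \<in> lattice_s n s"
    have "kap s f \<in> coord_space n s"
      using is_K_Ws_kap[OF s1] f by (auto simp: is_K_Ws_def lattice_s_def)
    then show "(\<lambda>\<alpha>. c * kap s f \<alpha>) \<in> lattice_s n s"
      using main[OF f] by (auto simp: lattice_s_def coord_space_def A_x_iff)
    show "K' (reduce f) = reduce (\<lambda>\<alpha>. c * kap s f \<alpha>)"
      unfolding reduce_def[of "\<lambda>\<alpha>. c * kap s f \<alpha>"] using mod_qinv_eq[OF main[OF f]] by (intro ext) simp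
  qed
  have nonzero: "\<exists>f\<in>lattice_s n s. K' (reduce f) \<noteq> (\<lambda>_. 0)"
  proof -
    let ?v = "conc n s 1"
    define f :: "comp \<Rightarrow> scalar" where "f = (\<lambda>\<beta>. of_bool (\<beta> = ?v))"
    have v: "?v \<in> comps n s" by (rule conc_comps[OF n0])
    have "f \<in> lattice_s n s"
      using v place_0 place_1 by (auto simp: f_def lattice_s_def coord_space_def A_x_iff)
    moreover have "reduce f = crystal_elt 0 ?v"
      unfolding reduce_def f_def crystal_elt_def using mod_qinv_eq[OF place_of_bool] by (intro ext) simp
    then have "K' (reduce f) (pm ?v) = rat_x powi (II ?v)" using K'_elt[OF v, of 0] by (simp add: crystal_elt_def)
    then have "K' (reduce f) \<noteq> (\<lambda>_. 0)" using rat_x_nonzero by auto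
    ultimately show ?thesis by blast
  qed
  have bij: "bij_betw K' (crystal_s n s) (crystal_s n s)"
  proof (rule bij_betw_imageI)
    show "inj_on K' (crystal_s n s)"
      using bij_pm[of s] by (auto simp: inj_on_def crystal_s_def K'_elt crystal_elt_inject bij_betw_def)
    show "K' ` crystal_s n s = crystal_s n s"
    proof (intro equalityI subsetI)
      fix b assume "b \<in> K' ` crystal_s n s"
      then obtain d \<alpha> where "\<alpha> \<in> comps n s" "b = crystal_elt (d + II \<alpha>) (pm \<alpha>)"
        using K'_elt by (auto simp: crystal_s_def)
      then show "b \<in> crystal_s n s" using pm_comps unfolding crystal_s_def by blast
    next
      fix b assume "b \<in> crystal_s n s"
      then obtain d \<beta> where b: "b = crystal_elt d \<beta>" "\<beta> \<in> comps n s" by (auto simp: crystal_s_def)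
      let ?a = "pm_inv \<beta>"
      have a: "?a \<in> comps n s" by (rule pm_inv_comps[OF b(2)])
      then have "K' (crystal_elt (d - II ?a) ?a) = b" using K'_elt[OF a] pm_pm_inv[OF b(2)] b by simp
      moreover have "crystal_elt (d - II ?a) ?a \<in> crystal_s n s" using a by (auto simp: crystal_s_def)
      ultimately show "b \<in> K' ` crystal_s n s" by blast
    qed
  qed
  have "\<forall>b\<in>crystal_s n s. \<K> b = K' b"
    using KK K'_elt by (auto simp: crystal_s_def)
  then show ?thesis
    unfolding is_combinatorial_K_matrix_def using is_K_Ws_kap[OF s1] c lat nonzero bij by blast
qed

end

end

theorem proposition22:
  fixes n n' s :: nat
    and I :: "comp \<Rightarrow> int"
    and alpha' :: "comp \<Rightarrow> comp"
    and \<K> :: "(comp \<Rightarrow> ratx) \<Rightarrow> comp \<Rightarrow> ratx"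
  assumes "n \<ge> 4" and "even n" and "n' = n div 2" and "s \<ge> 1"
    and "\<And>\<alpha>. I \<alpha> = min (\<alpha> 1) (\<alpha> (int n' + 1)) - (\<Sum>j=int n'+1..int n. \<alpha> j)"
    and "\<And>\<alpha> i. alpha' \<alpha> i = \<alpha> (i + 1) + \<alpha> (i + int n' + 1) + max (\<alpha> i) (\<alpha> (i + int n'))
                - \<alpha> i - max (\<alpha> (i + 1)) (\<alpha> (i + int n' + 1))"
    and "\<And>d \<alpha>. \<alpha> \<in> comps n s \<Longrightarrow> \<K> (crystal_elt d \<alpha>) = crystal_elt (d + I \<alpha>) (alpha' \<alpha>)"
  shows "is_combinatorial_K_matrix n s \<K>"
proof -
  interpret even_rank n "int n'"
    using assms(1-3) by unfold_locales auto
  have "alpha' = pm"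
  proof (intro ext)
    fix \<alpha> i
    have "i + 1 + int n' = i + int n' + 1" by simp
    then show "alpha' \<alpha> i = pm \<alpha> i"
      unfolding assms(6) pm_def mm_def by (simp only:)
  qed
  moreover have "I \<alpha> = II \<alpha>" for \<alpha>
    unfolding assms(5) II_def mm_def by (simp add: add.commute)
  ultimately show ?thesis using combinatorial_K[OF assms(4)] assms(7) by simp
qed

end
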